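(* Let $\Omega\subset\mathbb{R}^3$ be the exterior domain of a ball, let $1\le p\le\infty$, and put $$\mu=\begin{cases}\frac12 & \text{if } 1\le p\le 3,\\ \frac{3}{2p} & \text{if } 3<p\le\infty\end{cases}$$ (so $\mu=0$ for $p=\infty$). Then there exist a sequence $\{f_m\}_{m\in\mathbb{N}}$ of nonzero functions in $L^p(\Omega)$ and a sequence $\{t_m\}_{m\in\mathbb{N}}$ of positive real numbers with $t_m\to\infty$ as $m\to\infty$ such that $$\limsup_{m\to\infty}\frac{t_m^{\mu}\,\|\nabla u_m(t_m)\|_{L^p(\Omega)}}{\|f_m\|_{L^p(\Omega)}}>0,$$ where $u_m$ denotes the solution of the Dirichlet problem of the heat equation $$\begin{cases}\partial_t u(t,x)-\Delta u(t,x)=0, & t\in(0,\infty),\ x\in\Omega,\\ u(t,x)=0, & t\in(0,\infty),\ x\in\partial\Omega,\\ u(0,x)=f_m(x), & x\in\Omega.\end{cases}$$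
   Context: The exterior domain of a ball is the complement in $\mathbb{R}^3$ of a closed ball. The solution with initial data $f\in L^p(\Omega)$ is $u(t)=e^{-tH}f$, where $H=-\Delta$ is the self-adjoint Dirichlet Laplacian on $L^2(\Omega)$ and $e^{-tH}$ is the semigroup it generates, acting on $L^p(\Omega)$, $1\le p\le\infty$, through its integral kernel (the Dirichlet heat kernel of $\Omega$). The gradient $\nabla$ is taken with respect to $x$. *)

theory Defs
  imports "HOL-Probability.Essential_Supremum"
begin

section \<open>Lebesgue spaces\<close>

definition Lp_norm :: "'a measure \<Rightarrow> ennreal \<Rightarrow> ('a \<Rightarrow> 'b::real_normed_vector) \<Rightarrow> ennreal" where
  "Lp_norm M p f =
     (if p = \<infinity> then esssup M (\<lambda>x. ennreal (norm (f x)))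
      else let I = (\<integral>\<^sup>+x. ennreal (norm (f x) powr enn2real p) \<partial>M)
           in if I = \<infinity> then \<infinity> else ennreal (enn2real I powr (1 / enn2real p)))"

text \<open>
  Elements of $L^p$ are represented by functions, not by classes modulo a.e. equality.
  In everything below, the values of such functions outside the domain \<open>\<Omega>\<close> are irrelevant.
\<close>

definition Lp_space :: "'a measure \<Rightarrow> ennreal \<Rightarrow> ('a \<Rightarrow> 'b::real_normed_vector) set" where
  "Lp_space M p = {f \<in> borel_measurable M. Lp_norm M p f < \<infinity>}"


section \<open>The Dirichlet Laplacian\<close>

definition grad :: "('a::real_inner \<Rightarrow> real) \<Rightarrow> 'a \<Rightarrow> 'a" where
  "grad f x = (THE D. GDERIV f x :> D)"

definition laplacian :: "(real ^ 'n \<Rightarrow> real) \<Rightarrow> real ^ 'n \<Rightarrow> real" where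
  "laplacian f x = (\<Sum>i\<in>UNIV. grad (\<lambda>y. grad f y $ i) x $ i)"

primrec C_k :: "nat \<Rightarrow> (real ^ 'n \<Rightarrow> real) \<Rightarrow> bool" where
  "C_k 0 f \<longleftrightarrow> continuous_on UNIV f"
| "C_k (Suc k) f \<longleftrightarrow> (\<forall>x. f differentiable (at x)) \<and> (\<forall>i. C_k k (\<lambda>x. grad f x $ i))"

text \<open>$C_c^\infty(\Omega)$, each function being extended by zero to the whole space.\<close>

definition test_functions :: "(real ^ 'n) set \<Rightarrow> (real ^ 'n \<Rightarrow> real) set" where
  "test_functions \<Omega> =
     {\<phi>. (\<forall>k. C_k k \<phi>) \<and> compact (closure {x. \<phi> x \<noteq> 0}) \<and> closure {x. \<phi> x \<noteq> 0} \<subseteq> \<Omega>}"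

text \<open>
  $H^1_0(\Omega)$ is the closure of $C_c^\infty(\Omega)$ in $H^1(\Omega)$. The limit \<open>g\<close> of the
  gradients is necessarily the weak gradient of \<open>u\<close>.
\<close>

definition H10 :: "(real ^ 'n) set \<Rightarrow> (real ^ 'n \<Rightarrow> real) set" where
  "H10 \<Omega> = {u \<in> Lp_space (lebesgue_on \<Omega>) 2.
     \<exists>\<phi> g. g \<in> Lp_space (lebesgue_on \<Omega>) 2 \<and> (\<forall>n::nat. \<phi> n \<in> test_functions \<Omega>) \<and>
       (\<lambda>n. Lp_norm (lebesgue_on \<Omega>) 2 (\<lambda>x. \<phi> n x - u x)) \<longlonglongrightarrow> 0 \<and>
       (\<lambda>n. Lp_norm (lebesgue_on \<Omega>) 2 (\<lambda>x. grad (\<phi> n) x - g x)) \<longlonglongrightarrow> 0}"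

text \<open>
  The graph of the self-adjoint Dirichlet Laplacian $H = -\Delta$ on $L^2(\Omega)$:
  its domain is $\{u \in H^1_0(\Omega) : \Delta u \in L^2(\Omega)\}$, with $\Delta u$ taken in the
  sense of distributions, and \<open>dirichlet_laplacian \<Omega> u v\<close> says that \<open>u\<close> lies in
  the domain and $H u = v$.
\<close>

definition dirichlet_laplacian ::
  "(real ^ 'n) set \<Rightarrow> (real ^ 'n \<Rightarrow> real) \<Rightarrow> (real ^ 'n \<Rightarrow> real) \<Rightarrow> bool" where
  "dirichlet_laplacian \<Omega> u v \<longleftrightarrow>
     u \<in> H10 \<Omega> \<and> v \<in> Lp_space (lebesgue_on \<Omega>) 2 \<and>
     (\<forall>\<phi>\<in>test_functions \<Omega>.
        (\<integral>x. u x * - laplacian \<phi> x \<partial>lebesgue_on \<Omega>) = (\<integral>x. v x * \<phi> x \<partial>lebesgue_on \<Omega>))"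


section \<open>The semigroup and its kernel\<close>

definition C0_semigroup_L2 :: "'a measure \<Rightarrow> (real \<Rightarrow> ('a \<Rightarrow> real) \<Rightarrow> 'a \<Rightarrow> real) \<Rightarrow> bool" where
  "C0_semigroup_L2 M S \<longleftrightarrow>
     (\<forall>t\<ge>0. \<forall>f\<in>Lp_space M 2. S t f \<in> Lp_space M 2) \<and>
     (\<forall>t\<ge>0. \<forall>f\<in>Lp_space M 2. \<forall>g\<in>Lp_space M 2. \<forall>a b.
        AE x in M. S t (\<lambda>y. a * f y + b * g y) x = a * S t f x + b * S t g x) \<and>
     (\<forall>t\<ge>0. \<exists>C::real. \<forall>f\<in>Lp_space M 2. Lp_norm M 2 (S t f) \<le> ennreal C * Lp_norm M 2 f) \<and>
     (\<forall>f\<in>Lp_space M 2. AE x in M. S 0 f x = f x) \<and>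
     (\<forall>s\<ge>0. \<forall>t\<ge>0. \<forall>f\<in>Lp_space M 2. AE x in M. S (s + t) f x = S s (S t f) x) \<and>
     (\<forall>f\<in>Lp_space M 2. ((\<lambda>t. Lp_norm M 2 (\<lambda>x. S t f x - f x)) \<longlongrightarrow> 0) (at_right 0))"

text \<open>The graph of the infinitesimal generator of a semigroup.\<close>

definition generator_L2 ::
  "'a measure \<Rightarrow> (real \<Rightarrow> ('a \<Rightarrow> real) \<Rightarrow> 'a \<Rightarrow> real) \<Rightarrow> ('a \<Rightarrow> real) \<Rightarrow> ('a \<Rightarrow> real) \<Rightarrow> bool" where
  "generator_L2 M S u w \<longleftrightarrow>
     u \<in> Lp_space M 2 \<and> w \<in> Lp_space M 2 \<and>
     ((\<lambda>h. Lp_norm M 2 (\<lambda>x. (S h u x - u x) / h - w x)) \<longlongrightarrow> 0) (at_right 0)"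

text \<open>
  \<open>S\<close> is the semigroup $e^{-tH}$, i.e. the $C_0$-semigroup with generator $-H$.
  A $C_0$-semigroup is determined by its generator, so \<open>S t f\<close> is unique up to a.e. equality.
\<close>

definition dirichlet_heat_semigroup ::
  "(real ^ 'n) set \<Rightarrow> (real \<Rightarrow> (real ^ 'n \<Rightarrow> real) \<Rightarrow> real ^ 'n \<Rightarrow> real) \<Rightarrow> bool" where
  "dirichlet_heat_semigroup \<Omega> S \<longleftrightarrow>
     C0_semigroup_L2 (lebesgue_on \<Omega>) S \<and>
     (\<forall>u v. generator_L2 (lebesgue_on \<Omega>) S u (\<lambda>x. - v x) \<longleftrightarrow> dirichlet_laplacian \<Omega> u v)"

text \<open>
  \<open>k t x y\<close> is the integral kernel of $e^{-tH}$. The integral representation determines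
  \<open>k t\<close> only almost everywhere; continuity selects the usual pointwise-defined (smooth)
  heat kernel, which is thereby unique for positive times and points of \<open>\<Omega>\<close> (for \<open>\<Omega>\<close> open).
\<close>

definition dirichlet_heat_kernel ::
  "(real ^ 'n) set \<Rightarrow> (real \<Rightarrow> real ^ 'n \<Rightarrow> real ^ 'n \<Rightarrow> real) \<Rightarrow> bool" where
  "dirichlet_heat_kernel \<Omega> k \<longleftrightarrow>
     (\<exists>S. dirichlet_heat_semigroup \<Omega> S \<and>
       (\<forall>t>0. continuous_on (\<Omega> \<times> \<Omega>) (\<lambda>(x, y). k t x y) \<and>
         (\<forall>f\<in>Lp_space (lebesgue_on \<Omega>) 2. AE x in lebesgue_on \<Omega>.
            integrable (lebesgue_on \<Omega>) (\<lambda>y. k t x y * f y) \<and>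
            S t f x = (\<integral>y. k t x y * f y \<partial>lebesgue_on \<Omega>))))"

text \<open>The solution $u(t) = e^{-tH} f$ for positive \<open>t\<close> and $f \in L^p(\Omega)$, given the kernel.\<close>

definition heat_solution ::
  "(real ^ 'n) set \<Rightarrow> (real \<Rightarrow> real ^ 'n \<Rightarrow> real ^ 'n \<Rightarrow> real) \<Rightarrow> (real ^ 'n \<Rightarrow> real) \<Rightarrow>
   real \<Rightarrow> real ^ 'n \<Rightarrow> real" where
  "heat_solution \<Omega> k f t x = (\<integral>y. k t x y * f y \<partial>lebesgue_on \<Omega>)"

definition decay_exponent :: "ennreal \<Rightarrow> real" where
  "decay_exponent p =
     (if p \<le> 3 then 1 / 2 else if p < \<infinity> then 3 / (2 * enn2real p) else 0)"

end

theory Submission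
  imports Defs "HOL-Probability.Distributions"
begin

text \<open>
  In three dimensions \<open>r \<cdot> u\<close> solves the one-dimensional heat equation whenever \<open>u\<close> is a radial solution,
  so that, with \<open>r = |x - c|\<close>,
  \<open>u(\<tau>, x) = \<tau> powr (-3/2) * (r - R)/r * exp (-(r - R)^2 / (4 \<tau>))\<close>
  is an explicit solution of the Dirichlet problem outside the ball. With \<open>f\<^sub>m = u(t\<^sub>m)\<close> the solution
  at time \<open>t\<^sub>m\<close> is \<open>u(2 t\<^sub>m)\<close>, and all norms are comparable to powers of \<open>t\<^sub>m\<close>. For \<open>p \<le> 3\<close> the gradient
  is bounded below at distance of order \<open>sqrt t\<^sub>m\<close>, for \<open>p > 3\<close> on a fixed ball near the boundary, where
  the factor \<open>1 - R/r\<close> has a gradient of order one.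

  What has to be shown is that the given kernel produces this solution at every point. The curve
  \<open>u(\<tau>)\<close> is differentiable in \<open>L\<^sup>2\<close> with derivative \<open>-H u(\<tau>)\<close>, which identifies it with the semigroup
  orbit. Since \<open>H\<close> is symmetric so is the semigroup; applied to means over balls shrinking to \<open>x\<close> it
  converges in \<open>L\<^sup>2\<close> to \<open>k(t, \<cdot>, x)\<close>, and this turns the identity almost everywhere into one at every
  point.
\<close>

section \<open>Square-integrable functions as a Hilbert space\<close>

text \<open>The exponent \<mu> comes from counting powers. The datum has norm of order
  \<open>t powr (-3/2 + 3/(2*p))\<close>. At distance \<open>sqrt t\<close> the gradient has order
  \<open>t powr (-2)\<close> on a volume of order \<open>t powr (3/2)\<close>, so the quotient of
  norms decays like \<open>t powr (-1/2)\<close>. Near the ball it has order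
  \<open>t powr (-3/2)\<close> on a fixed volume, and the quotient decays like
  \<open>t powr (-3/(2*p))\<close>. The slower rate is \<mu>; the two agree at \<open>p = 3\<close>.

  The conclusion concerns the pointwise gradient of a kernel integral, about which an identity
  almost everywhere says nothing. Of the kernel only joint continuity and the L2 representation are
  given; its symmetry and the square integrability of \<open>k t y x\<close> in \<open>y\<close>
  have to be derived. The semigroup acts on functions, with laws valid almost everywhere. To
  differentiate orbits it is moved to a complete inner product type of classes on the whole space,
  which serves every domain. Completeness enters twice: through uniform boundedness, which bounds
  the operators locally in time, and through integrals of orbits, which make the domain of the
  generator dense.\<close>

definition sqint :: "('a::euclidean_space \<Rightarrow> real) set" where
  "sqint = {f \<in> borel_measurable lebesgue. integrable lebesgue (\<lambda>x. (f x)\<^sup>2)}"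

lemma sqint_measurable: "f \<in> sqint \<Longrightarrow> f \<in> borel_measurable lebesgue"
  by (simp add: sqint_def)

lemma sqint_mult: "f \<in> sqint \<Longrightarrow> g \<in> sqint \<Longrightarrow> integrable lebesgue (\<lambda>x. f x * g x)"
  unfolding sqint_def
proof (clarsimp)
  assume [measurable]: "f \<in> borel_measurable lebesgue" "g \<in> borel_measurable lebesgue"
    and i: "integrable lebesgue (\<lambda>x. (f x)\<^sup>2)" "integrable lebesgue (\<lambda>x. (g x)\<^sup>2)"
  show "integrable lebesgue (\<lambda>x. f x * g x)"
  proof (rule Bochner_Integration.integrable_bound[OF Bochner_Integration.integrable_add[OF i]])
    show "AE x in lebesgue. norm (f x * g x) \<le> norm ((f x)\<^sup>2 + (g x)\<^sup>2)"
    proof (rule AE_I2)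
      fix x
      have "0 \<le> (\<bar>f x\<bar> - \<bar>g x\<bar>)\<^sup>2" by simp
      then have *: "2 * (\<bar>f x\<bar> * \<bar>g x\<bar>) \<le> (f x)\<^sup>2 + (g x)\<^sup>2" by (simp add: power2_diff)
      have "0 \<le> \<bar>f x\<bar> * \<bar>g x\<bar>" by simp
      with * have "\<bar>f x\<bar> * \<bar>g x\<bar> \<le> (f x)\<^sup>2 + (g x)\<^sup>2" by linarith
      then show "norm (f x * g x) \<le> norm ((f x)\<^sup>2 + (g x)\<^sup>2)" by (simp add: abs_mult)
    qed
  qed measurable
qed

lemma sqint_add: "f \<in> sqint \<Longrightarrow> g \<in> sqint \<Longrightarrow> (\<lambda>x. f x + g x) \<in> sqint"
  using sqint_mult[of f g] unfolding sqint_def by (auto simp: power2_sum mult.assoc)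

lemma sqint_scale: "f \<in> sqint \<Longrightarrow> (\<lambda>x. a * f x) \<in> sqint"
  unfolding sqint_def by (auto simp: power_mult_distrib)

lemma sqint_uminus: "f \<in> sqint \<Longrightarrow> (\<lambda>x. - f x) \<in> sqint"
  using sqint_scale[of f "-1"] by simp

lemma sqint_diff: "f \<in> sqint \<Longrightarrow> g \<in> sqint \<Longrightarrow> (\<lambda>x. f x - g x) \<in> sqint"
  using sqint_add[OF _ sqint_uminus, of f g] by simp

lemma sqint_zero: "(\<lambda>x. 0) \<in> sqint"
  by (simp add: sqint_def)

lemma sqint_abs: "f \<in> sqint \<Longrightarrow> (\<lambda>x. \<bar>f x\<bar>) \<in> sqint"
  unfolding sqint_def by (auto intro!: borel_measurable_abs)

lemma sqint_sum: "(\<And>i. i \<in> I \<Longrightarrow> f i \<in> sqint) \<Longrightarrow> (\<lambda>x. \<Sum>i\<in>I. f i x) \<in> sqint"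
  by (induction I rule: infinite_finite_induct) (auto intro: sqint_zero sqint_add)

lemma sqint_bound:
  assumes "g \<in> sqint" "f \<in> borel_measurable lebesgue" "AE x in lebesgue. \<bar>f x\<bar> \<le> \<bar>g x\<bar>"
  shows "f \<in> sqint"
proof -
  have "integrable lebesgue (\<lambda>x. (f x)\<^sup>2)"
  proof (rule Bochner_Integration.integrable_bound)
    show "integrable lebesgue (\<lambda>x. (g x)\<^sup>2)" using assms by (simp add: sqint_def)
    show "AE x in lebesgue. norm ((f x)\<^sup>2) \<le> norm ((g x)\<^sup>2)"
      using assms(3) by eventually_elim (simp add: abs_le_square_iff)
  qed (use assms in measurable)
  then show ?thesis using assms by (simp add: sqint_def)
qed

quotient_type (overloaded) 'a l2 = "'a::euclidean_space \<Rightarrow> real" / partial: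
  "\<lambda>f g. f \<in> sqint \<and> g \<in> sqint \<and> (AE x in lebesgue. f x = g x)"
proof (rule part_equivpI)
  show "\<exists>x::'a \<Rightarrow> real. x \<in> sqint \<and> x \<in> sqint \<and> (AE xa in lebesgue. x xa = x xa)"
    by (rule exI[of _ "\<lambda>x. 0"]) (simp add: sqint_zero)
  show "symp (\<lambda>f g::'a \<Rightarrow> real. f \<in> sqint \<and> g \<in> sqint \<and> (AE x in lebesgue. f x = g x))"
    by (auto simp: symp_def eq_commute)
  show "transp (\<lambda>f g::'a \<Rightarrow> real. f \<in> sqint \<and> g \<in> sqint \<and> (AE x in lebesgue. f x = g x))"
    by (rule transpI) (auto elim: eventually_elim2)
qed

instantiation l2 :: (euclidean_space) real_vector
begin

lift_definition zero_l2 :: "'a l2" is "\<lambda>x. 0" by (simp add: sqint_zero)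
lift_definition plus_l2 :: "'a l2 \<Rightarrow> 'a l2 \<Rightarrow> 'a l2" is "\<lambda>f g x. f x + g x"
  by (auto intro: sqint_add)
lift_definition minus_l2 :: "'a l2 \<Rightarrow> 'a l2 \<Rightarrow> 'a l2" is "\<lambda>f g x. f x - g x"
  by (auto intro: sqint_diff)
lift_definition uminus_l2 :: "'a l2 \<Rightarrow> 'a l2" is "\<lambda>f x. - f x"
  by (auto intro: sqint_uminus)
lift_definition scaleR_l2 :: "real \<Rightarrow> 'a l2 \<Rightarrow> 'a l2" is "\<lambda>a f x. a * f x"
  by (auto intro: sqint_scale)
instance
proof
  fix x y z :: "'a l2" and a b :: real
  show "x + y + z = x + (y + z)" by transfer (auto intro!: sqint_add)
  show "x + y = y + x" by transfer (auto intro!: sqint_add simp: add.commute)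
  show "0 + x = x" by transfer auto
  show "- x + x = 0" by transfer (auto simp: sqint_zero)
  show "x - y = x + - y" by transfer (auto intro!: sqint_diff)
  show "a *\<^sub>R (x + y) = a *\<^sub>R x + a *\<^sub>R y"
    by transfer (auto intro!: sqint_add sqint_scale simp: algebra_simps)
  show "(a + b) *\<^sub>R x = a *\<^sub>R x + b *\<^sub>R x"
    by transfer (auto intro!: sqint_add sqint_scale simp: algebra_simps)
  show "a *\<^sub>R b *\<^sub>R x = (a * b) *\<^sub>R x"
    by transfer (auto intro!: sqint_scale simp: algebra_simps)
  show "1 *\<^sub>R x = x" by transfer auto
qed

end

instantiation l2 :: (euclidean_space) real_inner
begin

lift_definition inner_l2 :: "'a l2 \<Rightarrow> 'a l2 \<Rightarrow> real" is "\<lambda>f g. \<integral>x. f x * g x \<partial>lebesgue"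
  by (intro integral_cong_AE) (auto intro!: borel_measurable_times dest: sqint_measurable)
definition norm_l2 :: "'a l2 \<Rightarrow> real" where "norm_l2 f = sqrt (inner f f)"
definition sgn_l2 :: "'a l2 \<Rightarrow> 'a l2" where "sgn_l2 f = f /\<^sub>R norm f"
definition dist_l2 :: "'a l2 \<Rightarrow> 'a l2 \<Rightarrow> real" where "dist_l2 f g = norm (f - g)"
definition uniformity_l2 :: "('a l2 \<times> 'a l2) filter" where
  "uniformity_l2 = (INF e\<in>{0<..}. principal {(x, y). dist x y < e})"
definition open_l2 :: "'a l2 set \<Rightarrow> bool" where
  "open_l2 U = (\<forall>x\<in>U. \<forall>\<^sub>F (x', y) in uniformity. x' = x \<longrightarrow> y \<in> U)"

instance
proof
  fix x y z :: "'a l2" and a :: real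
  show "dist x y = norm (x - y)" by (simp add: dist_l2_def)
  show "sgn x = x /\<^sub>R norm x" by (simp add: sgn_l2_def)
  show "uniformity = (INF e\<in>{0<..}. principal {(x::'a l2, y). dist x y < e})"
    by (simp add: uniformity_l2_def)
  show "inner x y = inner y x" by transfer (simp add: mult.commute)
  show "inner (x + y) z = inner x z + inner y z"
    by transfer (auto simp: algebra_simps sqint_mult)
  show "inner (a *\<^sub>R x) y = a * inner x y"
    by transfer (auto simp: algebra_simps sqint_mult)
  show "0 \<le> inner x x" by transfer simp
  have *: "(\<integral>x. f x * f x \<partial>lebesgue) = 0 \<longleftrightarrow> (AE x in lebesgue. f x = 0)"
    if "f \<in> sqint" for f :: "'a \<Rightarrow> real"
    using sqint_mult[OF that that] by (subst integral_nonneg_eq_0_iff_AE) auto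
  show "inner x x = 0 \<longleftrightarrow> x = 0"
    by transfer (auto simp: * sqint_zero)
  show "norm x = sqrt (inner x x)" by (simp add: norm_l2_def)
  fix U :: "'a l2 set"
  show "open U = (\<forall>x\<in>U. \<forall>\<^sub>F (x', y) in uniformity. x' = x \<longrightarrow> y \<in> U)"
    by (simp add: open_l2_def)
qed

end

definition l2_of :: "('a::euclidean_space \<Rightarrow> real) \<Rightarrow> 'a l2" where "l2_of = abs_l2"
definition fun_of :: "'a::euclidean_space l2 \<Rightarrow> 'a \<Rightarrow> real" where "fun_of = rep_l2"

lemma fun_of_sqint: "fun_of F \<in> sqint"
  unfolding fun_of_def using Quotient_rep_reflp[OF Quotient_l2, of F] by simp

lemma l2_of_fun_of: "l2_of (fun_of F) = F"
  unfolding fun_of_def l2_of_def by (rule Quotient_abs_rep[OF Quotient_l2])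

lemma l2_of_eq_iff: "f \<in> sqint \<Longrightarrow> g \<in> sqint \<Longrightarrow> l2_of f = l2_of g \<longleftrightarrow> (AE x in lebesgue. f x = g x)"
  unfolding l2_of_def using Quotient_rel[OF Quotient_l2, of f g] by simp

lemma fun_of_l2_of:
  assumes "f \<in> sqint"
  shows "AE x in lebesgue. fun_of (l2_of f) x = f x"
proof -
  have "l2_of (fun_of (l2_of f)) = l2_of f" by (rule l2_of_fun_of)
  then show ?thesis unfolding l2_of_eq_iff[OF fun_of_sqint assms] .
qed

lemma l2_of_add: "f \<in> sqint \<Longrightarrow> g \<in> sqint \<Longrightarrow> l2_of f + l2_of g = l2_of (\<lambda>x. f x + g x)"
  unfolding l2_of_def by (rule plus_l2.abs_eq) auto

lemma l2_of_diff: "f \<in> sqint \<Longrightarrow> g \<in> sqint \<Longrightarrow> l2_of f - l2_of g = l2_of (\<lambda>x. f x - g x)"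
  unfolding l2_of_def by (rule minus_l2.abs_eq) auto

lemma l2_of_scale: "f \<in> sqint \<Longrightarrow> a *\<^sub>R l2_of f = l2_of (\<lambda>x. a * f x)"
  unfolding l2_of_def by (rule scaleR_l2.abs_eq) auto

lemma l2_of_zero: "l2_of (\<lambda>x. 0) = 0"
  unfolding l2_of_def by (rule zero_l2.abs_eq[symmetric])

lemma inner_l2_of: "f \<in> sqint \<Longrightarrow> g \<in> sqint \<Longrightarrow> inner (l2_of f) (l2_of g) = (\<integral>x. f x * g x \<partial>lebesgue)"
  unfolding l2_of_def by (rule inner_l2.abs_eq) auto

lemma norm_l2_of: "f \<in> sqint \<Longrightarrow> (norm (l2_of f))\<^sup>2 = (\<integral>x. (f x)\<^sup>2 \<partial>lebesgue)"
  by (subst power2_norm_eq_inner) (simp add: inner_l2_of power2_eq_square[of "f _"])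

lemma nn_norm_l2_of:
  "f \<in> sqint \<Longrightarrow> (\<integral>\<^sup>+x. ennreal ((f x)\<^sup>2) \<partial>lebesgue) = ennreal ((norm (l2_of f))\<^sup>2)"
  by (simp add: norm_l2_of nn_integral_eq_integral sqint_def)

lemma sqint_nnI:
  assumes "f \<in> borel_measurable lebesgue" "(\<integral>\<^sup>+x. ennreal ((f x)\<^sup>2) \<partial>lebesgue) < \<infinity>"
  shows "f \<in> sqint"
  using assms unfolding sqint_def by (auto intro!: integrableI_bounded)

lemma l2_of_norm_le:
  assumes "f \<in> sqint" "(\<integral>\<^sup>+x. ennreal ((f x)\<^sup>2) \<partial>lebesgue) \<le> ennreal (e\<^sup>2)" "0 \<le> e"
  shows "norm (l2_of f) \<le> e"
  using assms power2_le_imp_le[of "norm (l2_of f)" e] by (simp add: nn_norm_l2_of)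

text \<open>Taking absolute values is not linear, but it preserves the norm of each summand; what
  remains is the triangle inequality. This controls the majorant of a telescoping sum in the
  completeness proof.\<close>

lemma norm_l2_of_sum_abs:
  assumes "\<And>i. i \<in> I \<Longrightarrow> d i \<in> sqint"
  shows "norm (l2_of (\<lambda>x. \<Sum>i\<in>I. \<bar>d i x\<bar>)) \<le> (\<Sum>i\<in>I. norm (l2_of (d i)))"
  using assms
proof (induction I rule: infinite_finite_induct)
  case (insert i I)
  let ?A = "l2_of (\<lambda>x. \<bar>d i x\<bar>)" and ?B = "l2_of (\<lambda>x. \<Sum>j\<in>I. \<bar>d j x\<bar>)"
  have di: "d i \<in> sqint" using insert.prems by simp
  have "(norm ?A)\<^sup>2 = (norm (l2_of (d i)))\<^sup>2"
    by (simp only: norm_l2_of[OF di] norm_l2_of[OF sqint_abs[OF di]] power2_abs)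
  then have 1: "norm ?A = norm (l2_of (d i))" by (rule power2_eq_imp_eq) simp_all
  have "(\<lambda>x. \<Sum>j\<in>I. \<bar>d j x\<bar>) \<in> sqint"
    by (rule sqint_sum, rule sqint_abs, rule insert.prems) simp
  then have 2: "l2_of (\<lambda>x. \<Sum>j\<in>insert i I. \<bar>d j x\<bar>) = ?A + ?B"
    using insert.hyps by (simp add: l2_of_add[OF sqint_abs[OF di]])
  have "norm ?B \<le> (\<Sum>j\<in>I. norm (l2_of (d j)))"
    using insert by simp
  then show ?case
    unfolding 2 using norm_triangle_ineq[of ?A ?B] 1 insert.hyps by simp
qed (auto simp: l2_of_zero)

section \<open>Completeness (Riesz-Fischer)\<close>

lemma fast_Cauchy_subseq:
  fixes X :: "nat \<Rightarrow> 'a::metric_space"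
  assumes "Cauchy X"
  obtains r :: "nat \<Rightarrow> nat" where "strict_mono r" "\<And>k m. r k \<le> m \<Longrightarrow> dist (X m) (X (r k)) < (1/2) ^ k"
proof -
  have "\<exists>N. \<forall>m\<ge>N. \<forall>n\<ge>N. dist (X m) (X n) < (1/2)^k" for k :: nat
    using assms unfolding Cauchy_def by (meson zero_less_power half_gt_zero zero_less_one)
  then obtain N where N: "\<And>k m n. m \<ge> N k \<Longrightarrow> n \<ge> N k \<Longrightarrow> dist (X m) (X n) < (1/2)^k"
    by metis
  \<comment> \<open>Summing the thresholds makes \<open>r k\<close> at least \<open>N k\<close>; the
    summand \<open>k\<close> makes \<open>r\<close> strictly increasing.\<close>
  define r where "r k = (\<Sum>i\<le>k. N i) + k" for k
  have "N k \<le> r k" for k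
    unfolding r_def by (rule trans_le_add1) (auto intro: member_le_sum)
  then have "dist (X m) (X (r k)) < (1/2) ^ k" if "r k \<le> m" for k m
    using that by (intro N) (auto intro: order_trans)
  then show ?thesis by (intro that[of r]) (auto simp: strict_mono_Suc_iff r_def)
qed

text \<open>The increments have summable norms, so by monotone convergence the sum of their absolute
  values is finite almost everywhere and the representatives converge there. Fatou's lemma then
  turns the bounds on \<open>Y m - Y k\<close> into bounds on the distance to the limit.\<close>

lemma l2_fast_Cauchy_limit:
  fixes Y :: "nat \<Rightarrow> 'a::euclidean_space l2"
  assumes Y: "\<And>k m. k \<le> m \<Longrightarrow> norm (Y m - Y k) \<le> (1/2) ^ k"
  shows "\<exists>F. \<forall>k. norm (F - Y k) \<le> (1/2) ^ k"
proof -
  define y where "y k = fun_of (Y k)" for k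
  have y: "y k \<in> sqint" and yY: "l2_of (y k) = Y k" for k
    by (simp_all add: y_def fun_of_sqint l2_of_fun_of)
  have ym[measurable]: "y k \<in> borel_measurable lebesgue" for k
    using y by (rule sqint_measurable)
  define g where "g k x = (\<Sum>i<k. \<bar>y (Suc i) x - y i x\<bar>)" for k x
  have gm[measurable]: "g k \<in> borel_measurable lebesgue" for k unfolding g_def by measurable
  have gs: "g k \<in> sqint" for k unfolding g_def by (intro sqint_sum sqint_abs sqint_diff y)
  have "norm (l2_of (g k)) \<le> 2" for k
  proof -
    have "norm (l2_of (g k)) \<le> (\<Sum>i<k. norm (l2_of (\<lambda>x. y (Suc i) x - y i x)))"
      unfolding g_def by (intro norm_l2_of_sum_abs sqint_diff y)
    also have "\<dots> \<le> (\<Sum>i<k. (1/2) ^ i)"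
      using Y by (intro sum_mono) (simp add: l2_of_diff[symmetric] y yY)
    also have "\<dots> \<le> 2"
      by (simp add: sum_gp_strict)
    finally show ?thesis .
  qed
  then have gb: "(\<integral>\<^sup>+x. ennreal ((g k x)\<^sup>2) \<partial>lebesgue) \<le> ennreal 4" for k
    using gs power_mono[of "norm (l2_of (g k))" 2 2] by (subst nn_norm_l2_of) (auto simp flip: ennreal_numeral intro!: ennreal_leI)
  have g_mono: "g k x \<le> g l x" if "k \<le> l" for k l x
    unfolding g_def using that by (intro sum_mono2) auto
  have g_nn: "0 \<le> g k x" for k x by (simp add: g_def sum_nonneg)
  have "(\<integral>\<^sup>+x. (SUP k. ennreal ((g k x)\<^sup>2)) \<partial>lebesgue) = (SUP k. \<integral>\<^sup>+x. ennreal ((g k x)\<^sup>2) \<partial>lebesgue)"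
    by (rule nn_integral_monotone_convergence_SUP)
       (auto simp: incseq_def le_fun_def intro!: ennreal_leI power_mono g_mono g_nn)
  also have "\<dots> \<le> ennreal 4" by (intro SUP_least gb)
  also have "ennreal 4 < \<infinity>" by simp
  finally have "(\<integral>\<^sup>+x. (SUP k. ennreal ((g k x)\<^sup>2)) \<partial>lebesgue) < \<infinity>" .
  then have "AE x in lebesgue. (SUP k. ennreal ((g k x)\<^sup>2)) \<noteq> \<infinity>"
    by (intro nn_integral_PInf_AE) auto
  then have conv: "AE x in lebesgue. convergent (\<lambda>k. y k x)"
  proof eventually_elim
    case (elim x)
    then obtain B where B: "(SUP k. ennreal ((g k x)\<^sup>2)) = ennreal B" "0 \<le> B"
      by (metis ennreal_cases infinity_ennreal_def)
    have "(g k x)\<^sup>2 \<le> B" for k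
      using SUP_upper[of k UNIV "\<lambda>k. ennreal ((g k x)\<^sup>2)"] B by simp
    then have "g k x \<le> sqrt B" for k by (simp add: real_le_rsqrt)
    then have "summable (\<lambda>i. \<bar>y (Suc i) x - y i x\<bar>)"
      by (intro summableI_nonneg_bounded[of _ "sqrt B"]) (auto simp: g_def)
    then have "summable (\<lambda>i. y (Suc i) x - y i x)" by (rule summable_rabs_cancel)
    then have "convergent (\<lambda>n. \<Sum>i<n. (y (Suc i) x - y i x))"
      by (simp add: summable_iff_convergent)
    then have "convergent (\<lambda>n. y n x - y 0 x)" by (simp add: sum_lessThan_telescope[of "\<lambda>i. y i x"])
    then have "convergent (\<lambda>n. (y n x - y 0 x) + y 0 x)"
      by (intro convergent_add convergent_const)
    then show ?case by simp
  qed
  \<comment> \<open>On the null set of divergence \<open>lim\<close> is an unspecified value; the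
    function so defined is measurable all the same.\<close>
  define f where "f x = lim (\<lambda>k. y k x)" for x
  have fm[measurable]: "f \<in> borel_measurable lebesgue"
    unfolding f_def by measurable
  have bound: "(\<integral>\<^sup>+x. ennreal ((f x - y k x)\<^sup>2) \<partial>lebesgue) \<le> ennreal (((1/2)^k)\<^sup>2)" for k
  proof -
    have "(\<integral>\<^sup>+x. ennreal ((f x - y k x)\<^sup>2) \<partial>lebesgue) =
        (\<integral>\<^sup>+x. liminf (\<lambda>j. ennreal ((y j x - y k x)\<^sup>2)) \<partial>lebesgue)"
    proof (rule nn_integral_cong_AE, use conv in eventually_elim)
      case (elim x)
      then have "(\<lambda>j. y j x) \<longlonglongrightarrow> f x" by (simp add: f_def convergent_LIMSEQ_iff)
      then have "(\<lambda>j. ennreal ((y j x - y k x)\<^sup>2)) \<longlonglongrightarrow> ennreal ((f x - y k x)\<^sup>2)"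
        by (intro tendsto_intros)
      then show ?case by (intro lim_imp_Liminf[symmetric] sequentially_bot)
    qed
    also have "\<dots> \<le> liminf (\<lambda>j. \<integral>\<^sup>+x. ennreal ((y j x - y k x)\<^sup>2) \<partial>lebesgue)"
      by (rule nn_integral_liminf) measurable
    also have "\<dots> \<le> limsup (\<lambda>j. \<integral>\<^sup>+x. ennreal ((y j x - y k x)\<^sup>2) \<partial>lebesgue)"
      by (rule Liminf_le_Limsup) simp
    also have "\<dots> \<le> ennreal (((1/2)^k)\<^sup>2)"
    proof (rule Limsup_bounded, rule eventually_sequentiallyI[of k])
      fix j assume "k \<le> j"
      have "(\<integral>\<^sup>+x. ennreal ((y j x - y k x)\<^sup>2) \<partial>lebesgue) = ennreal ((norm (Y j - Y k))\<^sup>2)"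
        by (subst nn_norm_l2_of) (auto intro!: sqint_diff y simp: l2_of_diff[symmetric] y yY)
      also have "\<dots> \<le> ennreal (((1/2)^k)\<^sup>2)"
        using Y[OF \<open>k \<le> j\<close>] by (intro ennreal_leI power_mono) auto
      finally show "(\<integral>\<^sup>+x. ennreal ((y j x - y k x)\<^sup>2) \<partial>lebesgue) \<le> ennreal (((1/2)^k)\<^sup>2)" .
    qed
    finally show ?thesis .
  qed
  have d: "(\<lambda>x. f x - y k x) \<in> sqint" for k
    by (rule sqint_nnI) (auto intro: order.strict_trans1[OF bound])
  have fs: "f \<in> sqint" using sqint_add[OF d[of 0] y[of 0]] by simp
  have "norm (l2_of f - Y k) \<le> (1/2)^k" for k
    using l2_of_norm_le[OF d bound[of k]] by (simp add: l2_of_diff fs y flip: yY)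
  then show ?thesis by blast
qed

instance l2 :: (euclidean_space) complete_space
proof
  fix X :: "nat \<Rightarrow> 'a l2" assume X: "Cauchy X"
  obtain r where r: "strict_mono r" "\<And>k m. r k \<le> m \<Longrightarrow> dist (X m) (X (r k)) < (1/2) ^ k"
    using fast_Cauchy_subseq[OF X] by blast
  have "norm (X (r m) - X (r k)) \<le> (1/2) ^ k" if "k \<le> m" for k m
    using r(2)[of k "r m"] that r(1) by (simp add: dist_norm strict_mono_less_eq)
  then obtain F where F: "\<And>k. norm (F - X (r k)) \<le> (1/2) ^ k"
    using l2_fast_Cauchy_limit[of "\<lambda>k. X (r k)"] by blast
  have "(\<lambda>k. norm (X (r k) - F)) \<longlonglongrightarrow> 0"
    by (rule tendsto_sandwich[of "\<lambda>_. 0" _ _ "\<lambda>k. (1/2) ^ k"])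
       (use F in \<open>auto simp: norm_minus_commute intro!: LIMSEQ_power_zero\<close>)
  then have "(X \<circ> r) \<longlonglongrightarrow> F" by (simp add: tendsto_iff dist_norm o_def)
  then have "X \<longlonglongrightarrow> F" using X r(1)
    by (meson Cauchy_converges_subseq)
  then show "convergent X" by (auto simp: convergent_def)
qed

instance l2 :: (euclidean_space) banach ..

section \<open>Strongly continuous semigroups\<close>

text \<open>Sokal's argument: one of \<open>x + v\<close>, \<open>x - v\<close> has an image at least as large as that of \<open>v\<close>.\<close>

lemma bounded_linear_large_value:
  fixes F :: "'a::real_normed_vector \<Rightarrow> 'b::real_normed_vector"
  assumes F: "bounded_linear F" and "r > 0" and big: "onorm F \<ge> B" "B > 0"
  shows "\<exists>y. norm (y - x) \<le> r \<and> norm (F y) \<ge> 2 / 3 * r * B"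
proof -
  interpret bounded_linear F by fact
  have "\<exists>u. norm (F u) > 2 / 3 * B * norm u"
  proof (rule ccontr)
    assume "\<not> ?thesis"
    then have "onorm F \<le> 2 / 3 * B"
      using big by (intro onorm_bound) (auto simp: not_less)
    then show False using big by simp
  qed
  then obtain u where u: "norm (F u) > 2 / 3 * B * norm u" by blast
  then have "u \<noteq> 0" by (auto simp: zero)
  define v where "v = (r / norm u) *\<^sub>R u"
  have nv: "norm v = r" using \<open>u \<noteq> 0\<close> \<open>r > 0\<close> by (simp add: v_def)
  have "norm (F v) = (r / norm u) * norm (F u)"
    using \<open>r > 0\<close> by (simp add: v_def scaleR)
  also have "\<dots> \<ge> (r / norm u) * (2 / 3 * B * norm u)"
    using u \<open>r > 0\<close> by (intro mult_left_mono) auto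
  finally have Fv: "norm (F v) \<ge> 2 / 3 * r * B" using \<open>u \<noteq> 0\<close> by (simp add: mult_ac)
  have "2 *\<^sub>R F v = F (x + v) - F (x - v)"
    by (simp add: add diff scaleR_2)
  then have "2 * norm (F v) \<le> norm (F (x + v)) + norm (F (x - v))"
    by (metis norm_triangle_ineq4 norm_scaleR abs_numeral)
  then have "norm (F (x + v)) \<ge> 2 / 3 * r * B \<or> norm (F (x - v)) \<ge> 2 / 3 * r * B"
    using Fv by linarith
  then show ?thesis
    using nv by (metis add_diff_cancel_left' diff_diff_eq2 add_diff_cancel norm_minus_commute order_refl
        diff_add_cancel)
qed

text \<open>Gliding hump without Baire. Operators of norm at least \<open>4 ^ n\<close> are paired
  with steps of length at most \<open>(1/3) ^ n\<close>, each making the value at the new point at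
  least 2/3 of step times norm. All later steps together have length at most half of
  \<open>(1/3) ^ n\<close>, so at the limit point a share of 2/3 - 1/2 = 1/6 survives, and
  \<open>(4/3) ^ n / 6\<close> is unbounded.\<close>

theorem uniform_boundedness:
  fixes F :: "nat \<Rightarrow> 'a::banach \<Rightarrow> 'b::real_normed_vector"
  assumes F: "\<And>n. bounded_linear (F n)" and pw: "\<And>x. \<exists>B. \<forall>n. norm (F n x) \<le> B"
  shows "\<exists>C. \<forall>n. onorm (F n) \<le> C"
proof (rule ccontr)
  assume "\<not> ?thesis"
  then have "\<forall>n. \<exists>j. onorm (F j) \<ge> 4 ^ n"
    by (meson linear)
  then obtain j where j: "\<And>n. onorm (F (j n)) \<ge> 4 ^ n" by metis
  have "\<forall>n x. \<exists>y. norm (y - x) \<le> (1/3) ^ n \<and> norm (F (j n) y) \<ge> 2 / 3 * (1/3) ^ n * onorm (F (j n))"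
    by (intro allI bounded_linear_large_value F) (auto intro: less_le_trans[OF _ j])
  then obtain g where g: "\<And>n x. norm (g n x - x) \<le> (1/3) ^ n"
    "\<And>n x. norm (F (j n) (g n x)) \<ge> 2 / 3 * (1/3) ^ n * onorm (F (j n))" by metis
  define y where "y = rec_nat 0 g"
  have y: "y (Suc n) = g n (y n)" for n by (simp add: y_def)
  define d where "d n = y (Suc n) - y n" for n
  have nd: "norm (d n) \<le> (1/3) ^ n" for n by (simp add: d_def y g)
  have sd: "summable d"
    by (rule summable_comparison_test[OF _ summable_geometric[of "1/3::real"]]) (use nd in auto)
  define x where "x = suminf d"
  have yd: "y n = (\<Sum>i<n. d i)" for n
    unfolding d_def by (simp add: sum_lessThan_telescope[of y]) (simp add: y_def)
  have tail: "norm (x - y (Suc n)) \<le> 1 / 2 * (1/3) ^ n" for n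
  proof -
    have "x - y (Suc n) = (\<Sum>i. d (i + Suc n))"
      using suminf_split_initial_segment[OF sd, of "Suc n"] by (simp add: x_def yd)
    also have "norm \<dots> \<le> (\<Sum>i. (1/3) ^ (i + Suc n))"
      by (rule norm_suminf_le, rule nd, rule summable_ignore_initial_segment) (simp add: summable_geometric)
    also have "\<dots> = (\<Sum>i. (1/3) ^ i * (1/3) ^ Suc n)" by (simp add: power_add mult_ac)
    also have "\<dots> = (\<Sum>i. (1/3) ^ i) * (1/3) ^ Suc n"
      by (rule suminf_mult2[symmetric]) (simp add: summable_geometric)
    also have "\<dots> = 1 / 2 * (1/3) ^ n" by (simp add: suminf_geometric)
    finally show ?thesis .
  qed
  obtain B where B: "\<And>n. norm (F n x) \<le> B" using pw[of x] by blast
  have large: "1 / 6 * (4/3) ^ n \<le> B" for n :: nat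
  proof -
    let ?N = "onorm (F (j n))" and ?e = "(1/3::real) ^ n"
    interpret bounded_linear "F (j n)" by (rule F)
    have "2 / 3 * ?e * ?N \<le> norm (F (j n) (y (Suc n)))" unfolding y by (rule g)
    also have "\<dots> = norm (F (j n) x - F (j n) (x - y (Suc n)))" by (simp add: diff)
    also have "\<dots> \<le> norm (F (j n) x) + norm (F (j n) (x - y (Suc n)))" by (rule norm_triangle_ineq4)
    also have "norm (F (j n) (x - y (Suc n))) \<le> ?N * (1 / 2 * ?e)"
      using onorm[OF F, of "j n" "x - y (Suc n)"] tail[of n] onorm_pos_le[OF F, of "j n"]
      by (meson mult_left_mono order_trans)
    finally have "1 / 6 * (?e * ?N) \<le> norm (F (j n) x)" by (simp add: algebra_simps)
    moreover have "?e * 4 ^ n \<le> ?e * ?N" using j by (intro mult_left_mono) auto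
    moreover have "?e * 4 ^ n = (4/3) ^ n" by (simp add: power_mult_distrib[symmetric])
    ultimately show ?thesis using B[of "j n"] by linarith
  qed
  obtain n :: nat where "6 * B < (4/3) ^ n"
    using real_arch_pow[of "4/3" "6 * B"] by auto
  then show False using large[of n] by linarith
qed

text \<open>Turns the derivative supplied by the fundamental theorem of calculus into the one-sided
  quotient by which a generator is defined.\<close>

lemma has_vector_derivative_at_right:
  assumes "(f has_vector_derivative D) (at a within {a..b})" "a < b"
  shows "((\<lambda>k. (f (a + k) - f a) /\<^sub>R k) \<longlongrightarrow> D) (at_right 0)"
proof (rule tendstoI)
  fix e :: real assume "0 < e"
  then have "e / 2 > 0" by simp
  then obtain d where d: "d > 0" "\<And>y. y \<in> {a..b} \<Longrightarrow> \<bar>y - a\<bar> < d \<Longrightarrow>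
      norm (f y - f a - (y - a) *\<^sub>R D) \<le> e / 2 * \<bar>y - a\<bar>"
    using assms(1) unfolding has_vector_derivative_def has_derivative_within_alt by (metis real_norm_def)
  have "dist ((f (a + k) - f a) /\<^sub>R k) D < e" if k: "0 < k" "k < min d (b - a)" for k
  proof -
    have "(f (a + k) - f a) /\<^sub>R k - D = (f (a + k) - f a - k *\<^sub>R D) /\<^sub>R k"
      using k by (simp add: scaleR_diff_right)
    also have "norm \<dots> = norm (f (a + k) - f a - k *\<^sub>R D) / k"
      using k by (simp add: divide_inverse mult.commute)
    also have "\<dots> \<le> e / 2" using d(2)[of "a + k"] k by (simp add: divide_le_eq)
    finally show ?thesis using \<open>0 < e\<close> by (simp add: dist_norm)
  qed
  then show "\<forall>\<^sub>F k in at_right 0. dist ((f (a + k) - f a) /\<^sub>R k) D < e"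
    unfolding eventually_at_right_field using d(1) assms(2) by (intro exI[of _ "min d (b - a)"]) auto
qed

text \<open>\<open>T 0\<close> is only a projection: functions on \<open>\<Omega>\<close> are going to be extended by zero to the whole space.\<close>

locale C0_semigroup =
  fixes T :: "real \<Rightarrow> 'a::banach \<Rightarrow> 'a"
  assumes bl: "0 \<le> t \<Longrightarrow> bounded_linear (T t)"
    and semigroup: "0 \<le> s \<Longrightarrow> 0 \<le> t \<Longrightarrow> T (s + t) x = T s (T t x)"
    and strong_cont: "((\<lambda>h. T h x) \<longlongrightarrow> T 0 x) (at_right 0)"
begin

definition gen :: "'a \<Rightarrow> 'a \<Rightarrow> bool" where
  "gen u w \<longleftrightarrow> T 0 u = u \<and> ((\<lambda>h. (T h u - u) /\<^sub>R h) \<longlongrightarrow> w) (at_right 0)"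

lemma T0_T [simp]: "0 \<le> t \<Longrightarrow> T 0 (T t x) = T t x"
  using semigroup[of 0 t x] by simp

lemma T_T0 [simp]: "0 \<le> t \<Longrightarrow> T t (T 0 x) = T t x"
  using semigroup[of t 0 x] by simp

lemma strong_cont_seq:
  assumes "\<And>n. 0 \<le> h n" "h \<longlonglongrightarrow> 0"
  shows "(\<lambda>n. T (h n) x) \<longlonglongrightarrow> T 0 x"
proof -
  have "continuous (at 0 within {0..}) (\<lambda>h. T h x)"
    using strong_cont[of x] by (simp add: continuous_within at_within_Ici_at_right)
  then show ?thesis
    by (rule continuous_within_tendsto_compose) (use assms in auto)
qed

text \<open>Otherwise there are times tending to 0 with unbounded operator norms, although every
  orbit converges along them and is therefore bounded; this contradicts uniform boundedness.\<close>

lemma bounded_near_0: "\<exists>d>0. \<exists>C. \<forall>h\<in>{0..d}. onorm (T h) \<le> C"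
proof (rule ccontr)
  assume *: "\<not> ?thesis"
  have "\<exists>h\<in>{0..1 / Suc n}. onorm (T h) > n" for n :: nat
  proof (rule ccontr)
    assume "\<not> ?thesis"
    then have "\<forall>h\<in>{0..1 / real (Suc n)}. onorm (T h) \<le> real n" by (simp add: not_less)
    moreover have "0 < 1 / real (Suc n)" by simp
    ultimately show False using * by blast
  qed
  then obtain h where h: "\<And>n. h n \<in> {0..1 / Suc n}" "\<And>n::nat. onorm (T (h n)) > n" by metis
  have "h \<longlonglongrightarrow> 0"
    by (rule tendsto_sandwich[OF _ _ tendsto_const LIMSEQ_Suc[OF lim_1_over_n]]) (use h(1) in auto)
  then have "convergent (\<lambda>n. T (h n) x)" for x
    using strong_cont_seq[of h x] h(1) by (auto simp: convergent_def)
  then have "\<exists>B. \<forall>n. norm (T (h n) x) \<le> B" for x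
    by (meson convergent_imp_Bseq BseqE)
  then obtain C where C: "\<And>n. onorm (T (h n)) \<le> C"
    using uniform_boundedness[of "\<lambda>n. T (h n)"] bl h(1) by force
  obtain n :: nat where "C < n" using reals_Archimedean2 by blast
  then show False using C[of n] h(2)[of n] by simp
qed

text \<open>Each step of length \<open>d\<close> costs one factor \<open>C\<close>, and finitely
  many steps reach \<open>L\<close>.\<close>

lemma locally_bounded: "\<exists>C\<ge>1. \<forall>t\<in>{0..L}. \<forall>x. norm (T t x) \<le> C * norm x"
proof -
  obtain d C0 where d: "d > 0" "\<And>h. h \<in> {0..d} \<Longrightarrow> onorm (T h) \<le> C0"
    using bounded_near_0 by blast
  define C where "C = max 1 C0"
  have C: "norm (T h x) \<le> C * norm x" if "h \<in> {0..d}" for h x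
  proof -
    have "norm (T h x) \<le> onorm (T h) * norm x" using that by (intro onorm bl) auto
    also have "\<dots> \<le> C * norm x" using d(2)[OF that] by (intro mult_right_mono) (auto simp: C_def)
    finally show ?thesis .
  qed
  have "\<forall>t\<in>{0..real n * d}. \<forall>x. norm (T t x) \<le> C ^ Suc n * norm x" for n
  proof (induction n)
    case 0
    then show ?case using C d(1) by auto
  next
    case (Suc n)
    show ?case
    proof (intro ballI allI)
      fix t x assume t: "t \<in> {0..real (Suc n) * d}"
      show "norm (T t x) \<le> C ^ Suc (Suc n) * norm x"
      proof (cases "t \<le> d")
        case True
        then have "norm (T t x) \<le> C * norm x" using C t by auto
        also have "C \<le> C ^ Suc (Suc n)" by (rule self_le_power) (auto simp: C_def)
        finally show ?thesis by (simp add: mult_right_mono)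
      next
        case False
        have "T t x = T d (T (t - d) x)" using semigroup[of d "t - d" x] False d(1) by simp
        also have "norm \<dots> \<le> C * norm (T (t - d) x)" using d(1) by (intro C) auto
        also have "norm (T (t - d) x) \<le> C ^ Suc n * norm x"
          using Suc False t by (auto simp: algebra_simps)
        finally show ?thesis by (simp add: C_def mult_left_mono mult.assoc)
      qed
    qed
  qed
  moreover obtain n :: nat where "L \<le> real n * d"
    using d(1) by (metis ex_less_of_nat_mult less_imp_le)
  moreover have "1 \<le> C ^ Suc n" by (rule one_le_power) (simp add: C_def)
  ultimately show ?thesis by (meson atLeastAtMost_iff order_trans)
qed

lemma orbit_diff:
  assumes C: "\<forall>t\<in>{0..L}. \<forall>x. norm (T t x) \<le> C * norm x" and "0 \<le> a" "a \<le> b" "b \<le> L"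
  shows "norm (T b x - T a x) \<le> C * norm (T (b - a) x - T 0 x)"
proof -
  interpret bounded_linear "T a" by (rule bl) fact
  have "T b x - T a x = T a (T (b - a) x - T 0 x)"
    using semigroup[of a "b - a" x] semigroup[of a 0 x] assms by (simp add: diff)
  then show ?thesis using assms by auto
qed

text \<open>Right continuity at 0 gives continuity from both sides: for any ordered pair of times
  the earlier operator is factored out by \<open>orbit_diff\<close>, and its norm is bounded locally
  uniformly.\<close>

lemma orbit_continuous: "continuous_on {0..} (\<lambda>t. T t x)"
  unfolding continuous_on_iff
proof (intro ballI allI impI)
  fix t e :: real assume t: "t \<in> {0..}" and "0 < e"
  obtain C where C: "C \<ge> 1" "\<forall>t\<in>{0..t + 1}. \<forall>x. norm (T t x) \<le> C * norm x"
    using locally_bounded by blast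
  have "continuous (at 0 within {0..}) (\<lambda>h. T h x)"
    using strong_cont[of x] by (simp add: continuous_within at_within_Ici_at_right)
  moreover have "e / C > 0" using \<open>0 < e\<close> C by simp
  ultimately obtain d where d: "d > 0" "\<And>h. h \<ge> 0 \<Longrightarrow> h < d \<Longrightarrow> norm (T h x - T 0 x) < e / C"
    unfolding continuous_within_eps_delta dist_norm by (metis abs_of_nonneg atLeast_iff diff_zero real_norm_def)
  have le: "norm (T b x - T a x) < e" if "0 \<le> a" "a \<le> b" "b \<le> t + 1" "b - a < d" for a b
  proof -
    have "norm (T b x - T a x) \<le> C * norm (T (b - a) x - T 0 x)"
      using that by (intro orbit_diff[OF C(2)]) auto
    also have "\<dots> < C * (e / C)" using d(2)[of "b - a"] that C by (intro mult_strict_left_mono) auto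
    finally show ?thesis using C by simp
  qed
  show "\<exists>d>0. \<forall>s\<in>{0..}. dist s t < d \<longrightarrow> dist (T s x) (T t x) < e"
  proof (intro exI[of _ "min 1 d"] conjI ballI impI)
    fix s assume s: "s \<in> {0..}" "dist s t < min 1 d"
    show "dist (T s x) (T t x) < e"
      using le[of s t] le[of t s] s t
      by (cases s t rule: linorder_cases) (auto simp: dist_norm norm_minus_commute \<open>0 < e\<close>)
  qed (use d in auto)
qed

lemma gen_approx:
  assumes "gen u w" "e > 0"
  shows "\<exists>d>0. \<forall>h. 0 \<le> h \<and> h < d \<longrightarrow> norm (T h u - u - h *\<^sub>R w) \<le> e * h"
proof -
  have "\<forall>\<^sub>F h in at_right 0. norm ((T h u - u) /\<^sub>R h - w) < e"
    using assms unfolding gen_def tendsto_iff dist_norm by blast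
  then obtain d where d: "d > 0" "\<And>h. 0 < h \<Longrightarrow> h < d \<Longrightarrow> norm ((T h u - u) /\<^sub>R h - w) < e"
    unfolding eventually_at_right_field by auto
  have "norm (T h u - u - h *\<^sub>R w) \<le> e * h" if "0 \<le> h" "h < d" for h
  proof (cases "h = 0")
    case True
    then show ?thesis using assms by (simp add: gen_def)
  next
    case False
    then have "T h u - u - h *\<^sub>R w = h *\<^sub>R ((T h u - u) /\<^sub>R h - w)"
      by (simp add: scaleR_diff_right)
    then show ?thesis using d(2)[of h] that False by (simp add: mult.commute mult_left_mono)
  qed
  with d(1) show ?thesis by blast
qed

text \<open>The difference quotients lie in the range of the continuous projection
  \<open>T 0\<close>, and so does their limit.\<close>

lemma gen_T0: assumes "gen u w" shows "T 0 w = w"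
proof -
  interpret bounded_linear "T 0" by (rule bl) simp
  have "((\<lambda>h. T 0 ((T h u - u) /\<^sub>R h)) \<longlongrightarrow> T 0 w) (at_right 0)"
    using assms by (intro tendsto) (simp add: gen_def)
  moreover have "\<forall>\<^sub>F h in at_right 0. T 0 ((T h u - u) /\<^sub>R h) = (T h u - u) /\<^sub>R h"
    unfolding eventually_at_right_field
    using assms by (auto intro!: exI[of _ 1] simp: gen_def scaleR diff)
  ultimately have "((\<lambda>h. (T h u - u) /\<^sub>R h) \<longlongrightarrow> T 0 w) (at_right 0)"
    by (rule Lim_transform_eventually)
  then show ?thesis
    using assms tendsto_unique[of "at_right (0::real)"] unfolding gen_def by (metis trivial_limit_at_right_real)
qed

text \<open>The classical interpolation: \<open>V s = T (t - s) (U s)\<close> runs from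
  \<open>T t (U 0)\<close> to \<open>U t\<close> and has derivative zero, because the derivative of
  \<open>U\<close> cancels against the generator.\<close>

theorem evolution_unique:
  assumes "0 \<le> t"
    and U: "\<And>s. s \<in> {0..t} \<Longrightarrow> (U has_vector_derivative U' s) (at s within {0..t})"
    and g: "\<And>s. s \<in> {0..t} \<Longrightarrow> gen (U s) (U' s)"
  shows "T t (U 0) = U t"
proof -
  define V where "V s = T (t - s) (U s)" for s
  obtain C where C: "C \<ge> 1" "\<forall>s\<in>{0..t}. \<forall>x. norm (T s x) \<le> C * norm x"
    using locally_bounded by blast
  have V: "(V has_derivative (\<lambda>_. 0)) (at s within {0..t})" if s: "s \<in> {0..t}" for s
    unfolding has_derivative_within_alt
  proof (intro conjI allI impI bounded_linear_zero)
    fix e :: real assume "0 < e"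
    \<comment> \<open>The outer operator contributes a factor \<open>C\<close>. Inside, the
      transported remainder of \<open>U\<close> costs \<open>C * \<eta>\<close>, and the remainder
      of the orbit and the continuity of \<open>T h (U' s)\<close> cost \<eta> each.\<close>
    define \<eta> where "\<eta> = e / (C * (C + 2))"
    have \<eta>: "\<eta> > 0" "C * ((C + 2) * \<eta>) = e" using C \<open>0 < e\<close> by (auto simp: \<eta>_def)
    obtain d1 where d1: "d1 > 0" "\<And>h. 0 \<le> h \<Longrightarrow> h < d1 \<Longrightarrow> norm (T h (U s) - U s - h *\<^sub>R U' s) \<le> \<eta> * h"
      using gen_approx[OF g[OF s] \<eta>(1)] by blast
    obtain d2 where d2: "d2 > 0" "\<And>y. y \<in> {0..t} \<Longrightarrow> \<bar>y - s\<bar> < d2 \<Longrightarrow>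
        norm (U y - U s - (y - s) *\<^sub>R U' s) \<le> \<eta> * \<bar>y - s\<bar>"
      using U[OF s] \<eta>(1) unfolding has_vector_derivative_def has_derivative_within_alt by (metis real_norm_def)
    have "continuous (at 0 within {0..}) (\<lambda>h. T h (U' s))"
      using strong_cont by (simp add: continuous_within at_within_Ici_at_right)
    then obtain d3 where d3: "d3 > 0" "\<And>h. h \<ge> 0 \<Longrightarrow> h < d3 \<Longrightarrow> norm (T h (U' s) - U' s) < \<eta>"
      using \<eta>(1) gen_T0[OF g[OF s]] unfolding continuous_within_eps_delta dist_norm
      by (metis abs_of_nonneg atLeast_iff diff_zero real_norm_def)
    have main: "norm (U b - T (b - a) (U a)) \<le> (C + 2) * \<eta> * (b - a)"
      if ab: "0 \<le> a" "a \<le> b" "b \<le> t" "b - a < d1" "b - a < d2" "b - a < d3" "a = s \<or> b = s" for a b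
      using ab(7)
    proof
      assume [simp]: "a = s"
      let ?h = "b - s"
      have "U b - T ?h (U s) = (U b - U s - ?h *\<^sub>R U' s) - (T ?h (U s) - U s - ?h *\<^sub>R U' s)" by simp
      also have "norm \<dots> \<le> norm (U b - U s - ?h *\<^sub>R U' s) + norm (T ?h (U s) - U s - ?h *\<^sub>R U' s)"
        by (rule norm_triangle_ineq4)
      also have "\<dots> \<le> \<eta> * ?h + \<eta> * ?h"
        using ab d2(2)[of b] d1(2)[of ?h] s by (intro add_mono) auto
      also have "\<dots> \<le> (C + 2) * \<eta> * ?h"
        using C \<eta> ab by (simp add: algebra_simps)
      finally show ?thesis by simp
    next
      assume [simp]: "b = s"
      let ?h = "s - a"
      interpret bounded_linear "T ?h" by (rule bl) (use ab in simp)
      let ?A = "T ?h (U a - U s - (a - s) *\<^sub>R U' s)" and ?B = "T ?h (U s) - U s - ?h *\<^sub>R U' s"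
        and ?D = "?h *\<^sub>R (T ?h (U' s) - U' s)"
      have eq: "U s - T ?h (U a) = - (?A + ?B - ?D)"
        by (simp only: diff scaleR) (simp add: algebra_simps)
      have "norm ?A \<le> C * norm (U a - U s - (a - s) *\<^sub>R U' s)"
        by (rule C(2)[rule_format]) (use ab in auto)
      also have "\<dots> \<le> C * (\<eta> * ?h)"
        using ab d2(2)[of a] C by (intro mult_left_mono) auto
      finally have A: "norm ?A \<le> C * (\<eta> * ?h)" .
      have B: "norm ?B \<le> \<eta> * ?h" using d1(2)[of ?h] ab by simp
      have D: "norm ?D \<le> \<eta> * ?h"
        using d3(2)[of ?h] ab by (simp add: mult.commute[of "s - a"] mult_right_mono)
      have "norm (?A + ?B - ?D) \<le> norm ?A + norm ?B + norm ?D"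
        by (rule order_trans[OF norm_triangle_ineq4 add_right_mono[OF norm_triangle_ineq]])
      then have "norm (U s - T ?h (U a)) \<le> C * (\<eta> * ?h) + \<eta> * ?h + \<eta> * ?h"
        unfolding eq norm_minus_cancel using A B D by linarith
      then show ?thesis by (simp add: algebra_simps)
    qed
    have dV: "norm (V b - V a) \<le> e * (b - a)"
      if ab: "0 \<le> a" "a \<le> b" "b \<le> t" "b - a < d1" "b - a < d2" "b - a < d3" "a = s \<or> b = s" for a b
    proof -
      interpret bounded_linear "T (t - b)" by (rule bl) (use ab in simp)
      have "V b - V a = T (t - b) (U b - T (b - a) (U a))"
        using semigroup[of "t - b" "b - a" "U a"] ab by (simp add: V_def diff)
      also have "norm \<dots> \<le> C * norm (U b - T (b - a) (U a))"
        by (rule C(2)[rule_format]) (use ab in auto)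
      also have "\<dots> \<le> C * ((C + 2) * \<eta> * (b - a))" using main[OF ab] C by (intro mult_left_mono) auto
      also have "\<dots> = e * (b - a)" using \<eta>(2) by (simp add: mult.assoc[symmetric])
      finally show ?thesis .
    qed
    show "\<exists>d>0. \<forall>y\<in>{0..t}. norm (y - s) < d \<longrightarrow> norm (V y - V s - 0) \<le> e * norm (y - s)"
    proof (intro exI[of _ "min d1 (min d2 d3)"] conjI ballI impI)
      fix y assume y: "y \<in> {0..t}" "norm (y - s) < min d1 (min d2 d3)"
      show "norm (V y - V s - 0) \<le> e * norm (y - s)"
        using dV[of s y] dV[of y s] y s by (cases "s \<le> y") (auto simp: norm_minus_commute)
    qed (use d1 d2 d3 in auto)
  qed
  obtain c where c: "\<And>s. s \<in> {0..t} \<Longrightarrow> V s = c"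
    using has_derivative_zero_constant[of "{0..t}" V] V by blast
  have "V 0 = V t" using c[of 0] c[of t] \<open>0 \<le> t\<close> by simp
  then show ?thesis using g[of t] \<open>0 \<le> t\<close> by (simp add: V_def gen_def)
qed

lemma gen_T:
  assumes "gen u w" "0 \<le> s"
  shows "gen (T s u) (T s w)"
proof -
  interpret bounded_linear "T s" by (rule bl) fact
  have "((\<lambda>h. T s ((T h u - u) /\<^sub>R h)) \<longlongrightarrow> T s w) (at_right 0)"
    using assms by (intro tendsto) (simp add: gen_def)
  moreover have "\<forall>\<^sub>F h in at_right 0. T s ((T h u - u) /\<^sub>R h) = (T h (T s u) - T s u) /\<^sub>R h"
    unfolding eventually_at_right_field
    using assms semigroup[of s _ u] semigroup[of _ s u]
    by (auto intro!: exI[of _ 1] simp: scaleR diff) (metis add.commute less_imp_le)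
  ultimately have "((\<lambda>h. (T h (T s u) - T s u) /\<^sub>R h) \<longlongrightarrow> T s w) (at_right 0)"
    by (rule Lim_transform_eventually)
  then show ?thesis using assms by (simp add: gen_def)
qed

text \<open>Differentiability at 0 is carried to time \<open>s\<close> by factoring out the operator
  at the earlier of the two times. For the left derivative the slope then appears as
  \<open>T a w\<close> with \<open>a\<close> before \<open>s\<close>, and strong continuity replaces
  it by \<open>T s w\<close>.\<close>

lemma orbit_derivative:
  assumes "gen u w" "s \<in> {0..t}"
  shows "((\<lambda>s. T s u) has_vector_derivative T s w) (at s within {0..t})"
  unfolding has_vector_derivative_def has_derivative_within_alt
proof (intro conjI allI impI bounded_linear_scaleR_left)
  fix e :: real assume "0 < e"
  obtain C where C: "C \<ge> 1" "\<forall>s\<in>{0..t}. \<forall>x. norm (T s x) \<le> C * norm x"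
    using locally_bounded by blast
  define \<eta> where "\<eta> = e / (2 * C)"
  have \<eta>: "\<eta> > 0" "C * \<eta> + C * \<eta> = e" using C \<open>0 < e\<close> by (auto simp: \<eta>_def)
  obtain d1 where d1: "d1 > 0" "\<And>h. 0 \<le> h \<Longrightarrow> h < d1 \<Longrightarrow> norm (T h u - u - h *\<^sub>R w) \<le> \<eta> * h"
    using gen_approx[OF assms(1) \<eta>(1)] by blast
  have "continuous (at 0 within {0..}) (\<lambda>h. T h w)"
    using strong_cont by (simp add: continuous_within at_within_Ici_at_right)
  then obtain d2 where d2: "d2 > 0" "\<And>h. h \<ge> 0 \<Longrightarrow> h < d2 \<Longrightarrow> norm (T h w - w) < \<eta>"
    using \<eta>(1) gen_T0[OF assms(1)] unfolding continuous_within_eps_delta dist_norm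
    by (metis abs_of_nonneg atLeast_iff diff_zero real_norm_def)
  show "\<exists>d>0. \<forall>y\<in>{0..t}. norm (y - s) < d \<longrightarrow>
      norm (T y u - T s u - (y - s) *\<^sub>R T s w) \<le> e * norm (y - s)"
  proof (intro exI[of _ "min d1 d2"] conjI ballI impI)
    fix y assume y: "y \<in> {0..t}" "norm (y - s) < min d1 d2"
    define a where "a = min s y"
    define h where "h = \<bar>y - s\<bar>"
    have a: "a \<in> {0..t}" "0 \<le> h" "h < d1" "h < d2" using y assms(2) by (auto simp: a_def h_def)
    interpret bounded_linear "T a" by (rule bl) (use a in simp)
    have 1: "norm (T a (T h u - u - h *\<^sub>R w)) \<le> C * (\<eta> * h)"
      using C a d1(2)[of h] by (meson mult_left_mono order_trans zero_le_one)
    have 2: "norm (T a (T h w - w)) \<le> C * \<eta>"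
      using C a d2(2)[of h] by (meson mult_left_mono order_trans zero_le_one less_imp_le)
    have sg: "T a (T h x) = T (a + h) x" for x using semigroup[of a h x] a by simp
    have ex: "T a (T h u - u - h *\<^sub>R w) = T (a + h) u - T a u - h *\<^sub>R T a w"
      "T a (T h w - w) = T (a + h) w - T a w"
      by (simp_all only: diff scaleR sg)
    show "norm (T y u - T s u - (y - s) *\<^sub>R T s w) \<le> e * norm (y - s)"
    proof (cases "s \<le> y")
      case True
      then have "a = s" "a + h = y" "h = y - s" by (auto simp: a_def h_def)
      then have "T y u - T s u - (y - s) *\<^sub>R T s w = T a (T h u - u - h *\<^sub>R w)"
        unfolding ex by simp
      then have "norm (T y u - T s u - (y - s) *\<^sub>R T s w) \<le> C * \<eta> * h" using 1 by (simp add: mult.assoc)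
      also have "\<dots> \<le> e * h" using a C \<eta> by (intro mult_right_mono) (auto simp flip: \<eta>(2))
      finally show ?thesis by (simp add: h_def)
    next
      case False
      then have "a = y" "a + h = s" "y - s = - h" by (auto simp: a_def h_def)
      then have "T y u - T s u - (y - s) *\<^sub>R T s w
          = - T a (T h u - u - h *\<^sub>R w) + h *\<^sub>R T a (T h w - w)"
        unfolding ex \<open>y - s = - h\<close> by (simp add: algebra_simps)
      also have "norm \<dots> \<le> norm (T a (T h u - u - h *\<^sub>R w)) + norm (h *\<^sub>R T a (T h w - w))"
        using norm_triangle_ineq[of "- T a (T h u - u - h *\<^sub>R w)"] by (simp only: norm_minus_cancel)
      also have "\<dots> \<le> C * (\<eta> * h) + h * (C * \<eta>)"
        using 1 2 a by (intro add_mono) (auto intro: mult_left_mono)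
      also have "\<dots> = e * h" by (simp add: algebra_simps flip: \<eta>(2))
      finally show ?thesis by (simp add: h_def)
    qed
  qed (use d1 d2 in auto)
qed

text \<open>Averages of an orbit over \<open>{0..h}\<close> lie in the domain and tend to
  \<open>x\<close>. Applying \<open>T k\<close> shifts the interval of integration, so the generator
  quotient of \<open>I h\<close> is the difference quotient of \<open>I\<close> at \<open>h\<close>
  minus the one at 0, with limit \<open>T h x - T 0 x\<close>.\<close>

lemma domain_dense:
  assumes "T 0 x = x" "e > 0"
  shows "\<exists>u w. gen u w \<and> norm (u - x) < e"
proof -
  define I where "I b = integral {0..b} (\<lambda>s. T s x)" for b
  have co: "continuous_on {a..b} (\<lambda>s. T s x)" if "0 \<le> a" for a b
    by (rule continuous_on_subset[OF orbit_continuous]) (use that in auto)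
  have int: "(\<lambda>s. T s x) integrable_on {a..b}" if "0 \<le> a" for a b
    by (rule integrable_continuous_real[OF co[OF that]])
  have dI: "((\<lambda>k. (I (h + k) - I h) /\<^sub>R k) \<longlongrightarrow> T h x) (at_right 0)" if "0 \<le> h" for h
  proof -
    have "(I has_vector_derivative T h x) (at h within {0..h + 1})"
      unfolding I_def using that by (intro integral_has_vector_derivative co) auto
    then have "(I has_vector_derivative T h x) (at h within {h..h + 1})"
      by (rule has_vector_derivative_within_subset) (use that in auto)
    then show ?thesis by (rule has_vector_derivative_at_right) simp
  qed
  have TI: "T k (I h) = I (h + k) - I k" if "0 \<le> k" "0 \<le> h" for k h
  proof -
    have "T k (I h) = integral {0..h} (T k \<circ> (\<lambda>s. T s x))"
      unfolding I_def using that by (intro integral_linear[symmetric] int bl) auto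
    also have "\<dots> = integral {0..h} ((\<lambda>s. T s x) \<circ> (+) k)"
      using semigroup[OF that(1), of _ x] by (intro integral_cong) simp
    also have "\<dots> = integral {0 + k..h + k} (\<lambda>s. T s x)"
      by (rule integral_shift_Icc_real)
    also have "\<dots> = I (h + k) - I k"
      using Henstock_Kurzweil_Integration.integral_combine[of 0 k "h + k" "\<lambda>s. T s x"] int[of 0 "h + k"] that
      by (simp add: I_def algebra_simps)
    finally show ?thesis .
  qed
  have I0: "I 0 = 0" by (simp add: I_def)
  have T0I: "T 0 (I h) = I h" if "0 \<le> h" for h
    using TI[of 0 h] that by (simp add: I0)
  have gI: "gen (I h) (T h x - T 0 x)" if "0 \<le> h" for h
    unfolding gen_def
  proof
    have "((\<lambda>k. (I (h + k) - I h) /\<^sub>R k - (I (0 + k) - I 0) /\<^sub>R k) \<longlongrightarrow> T h x - T 0 x) (at_right 0)"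
      by (intro tendsto_diff dI that) simp
    moreover have "\<forall>\<^sub>F k in at_right 0. (I (h + k) - I h) /\<^sub>R k - (I (0 + k) - I 0) /\<^sub>R k
        = (T k (I h) - I h) /\<^sub>R k"
      unfolding eventually_at_right_field
      using that by (intro exI[of _ 1]) (auto simp: I0 TI algebra_simps)
    ultimately show "((\<lambda>k. (T k (I h) - I h) /\<^sub>R k) \<longlongrightarrow> T h x - T 0 x) (at_right 0)"
      by (rule Lim_transform_eventually)
  qed (rule T0I[OF that])
  have gs: "gen (a *\<^sub>R u) (a *\<^sub>R w)" if "gen u w" for a u w
  proof -
    have "((\<lambda>k. a *\<^sub>R ((T k u - u) /\<^sub>R k)) \<longlongrightarrow> a *\<^sub>R w) (at_right 0)"
      using that unfolding gen_def by (intro tendsto_intros) auto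
    moreover have "\<forall>\<^sub>F k in at_right 0. a *\<^sub>R ((T k u - u) /\<^sub>R k) = (T k (a *\<^sub>R u) - a *\<^sub>R u) /\<^sub>R k"
      unfolding eventually_at_right_field
      by (intro exI[of _ 1]) (auto simp: linear_cmul[OF bounded_linear.linear[OF bl]] algebra_simps)
    ultimately have "((\<lambda>k. (T k (a *\<^sub>R u) - a *\<^sub>R u) /\<^sub>R k) \<longlongrightarrow> a *\<^sub>R w) (at_right 0)"
      by (rule Lim_transform_eventually)
    then show ?thesis
      using that linear_cmul[OF bounded_linear.linear[OF bl[of 0]]] by (simp add: gen_def)
  qed
  have "((\<lambda>k. (I (0 + k) - I 0) /\<^sub>R k) \<longlongrightarrow> x) (at_right 0)"
    using dI[of 0] assms(1) by simp
  then have "\<forall>\<^sub>F k in at_right 0. dist ((I (0 + k) - I 0) /\<^sub>R k) x < e"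
    using assms(2) by (rule tendstoD)
  then obtain d where d: "d > 0" "\<And>k. 0 < k \<Longrightarrow> k < d \<Longrightarrow> dist ((I (0 + k) - I 0) /\<^sub>R k) x < e"
    unfolding eventually_at_right_field by auto
  have "norm (I (d / 2) /\<^sub>R (d / 2) - x) < e"
    using d(2)[of "d / 2"] d(1) by (simp add: dist_norm I_def)
  then show ?thesis using gs[OF gI] d(1) by (metis less_imp_le half_gt_zero)
qed

end

text \<open>For \<open>u\<close>, \<open>u'\<close> in the domain the function
  \<open>inner (T (t - s) u) (T s u')\<close> of \<open>s\<close> has derivative zero, since the
  generator is symmetric; its values at the two ends are the two sides. Density of the domain and
  continuity of \<open>T t\<close> give the general case.\<close>

lemma C0_semigroup_symmetric:
  fixes T :: "real \<Rightarrow> 'a::{real_inner, banach} \<Rightarrow> 'a"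
  assumes "C0_semigroup T"
    and sym: "\<And>u w u' w'. C0_semigroup.gen T u w \<Longrightarrow> C0_semigroup.gen T u' w' \<Longrightarrow> inner w u' = inner u w'"
    and "0 \<le> t" "T 0 f = f" "T 0 g = g"
  shows "inner (T t f) g = inner f (T t g)"
proof -
  interpret C0_semigroup T by fact
  have dom: "inner (T t u) u' = inner u (T t u')" if u: "gen u w" and u': "gen u' w'" for u w u' w'
  proof -
    define P where "P s = inner (T (t - s) u) (T s u')" for s
    have "(P has_derivative (\<lambda>_. 0)) (at s within {0..t})" if s: "s \<in> {0..t}" for s
    proof -
      have "((\<lambda>s. t - s) has_vector_derivative -1) (at s within {0..t})"
        by (auto intro!: derivative_eq_intros)
      moreover have "((\<lambda>s. T s u) has_vector_derivative T (t - s) w) (at (t - s) within (\<lambda>s. t - s) ` {0..t})"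
        using orbit_derivative[OF u, of "t - s" t] s by simp
      ultimately have 1: "((\<lambda>s. T (t - s) u) has_vector_derivative - T (t - s) w) (at s within {0..t})"
        using vector_diff_chain_within[of "\<lambda>s. t - s" "-1" s "{0..t}" "\<lambda>s. T s u"] by (simp add: o_def)
      have "(P has_derivative (\<lambda>h. inner (T (t - s) u) (h *\<^sub>R T s w') + inner (h *\<^sub>R - T (t - s) w) (T s u'))) (at s within {0..t})"
        unfolding P_def using 1 orbit_derivative[OF u' s]
        by (intro has_derivative_inner) (auto simp: has_vector_derivative_def)
      moreover have "inner (T (t - s) w) (T s u') = inner (T (t - s) u) (T s w')"
        by (rule sym; rule gen_T) (use u u' s in auto)
      ultimately show ?thesis by (simp add: algebra_simps)
    qed
    then obtain c where c: "\<And>s. s \<in> {0..t} \<Longrightarrow> P s = c"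
      using has_derivative_zero_constant[of "{0..t}" P] by blast
    have "P 0 = P t" using c[of 0] c[of t] \<open>0 \<le> t\<close> by simp
    then show ?thesis using u u' by (simp add: P_def gen_def)
  qed
  interpret Tt: bounded_linear "T t" by (rule bl) fact
  have "\<exists>u w. gen u w \<and> norm (u - x) < 1 / Suc n" if "T 0 x = x" for x and n :: nat
    by (rule domain_dense[OF that]) simp
  then have "\<exists>X. (\<forall>n::nat. \<exists>w. gen (X n) w) \<and> X \<longlonglongrightarrow> x" if x: "T 0 x = x" for x
  proof -
    obtain X where X: "\<And>n. \<exists>w. gen (X n) w" "\<And>n. norm (X n - x) < 1 / real (Suc n)"
      using \<open>\<And>x n. T 0 x = x \<Longrightarrow> \<exists>u w. gen u w \<and> norm (u - x) < 1 / Suc n\<close>[OF x] by metis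
    have "(\<lambda>n. norm (X n - x)) \<longlonglongrightarrow> 0"
      by (rule tendsto_sandwich[OF _ _ tendsto_const LIMSEQ_Suc[OF lim_1_over_n]])
         (auto intro!: always_eventually less_imp_le[OF X(2)] simp del: of_nat_Suc)
    then have "X \<longlonglongrightarrow> x" by (simp add: tendsto_iff dist_norm)
    then show ?thesis using X(1) by blast
  qed
  then obtain F G where F: "\<And>n. \<exists>w. gen (F n) w" "F \<longlonglongrightarrow> f" and G: "\<And>n. \<exists>w. gen (G n) w" "G \<longlonglongrightarrow> g"
    using assms(4,5) by metis
  have "(\<lambda>n. inner (T t (F n)) (G n)) \<longlonglongrightarrow> inner (T t f) g"
    by (intro tendsto_inner Tt.tendsto F G)
  moreover have "(\<lambda>n. inner (F n) (T t (G n))) \<longlonglongrightarrow> inner f (T t g)"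
    by (intro tendsto_inner Tt.tendsto F G)
  moreover have "inner (T t (F n)) (G n) = inner (F n) (T t (G n))" for n
    using dom F(1) G(1) by blast
  ultimately show ?thesis by (metis (no_types, lifting) LIMSEQ_unique ext)
qed

section \<open>Smooth functions and cut-offs\<close>

lemma grad_eqI: "GDERIV f x :> D \<Longrightarrow> grad f x = D"
  unfolding grad_def
proof (rule the_equality)
  fix E assume "GDERIV f x :> D" "GDERIV f x :> E"
  then have "(\<lambda>h. inner h D) = (\<lambda>h. inner h E)"
    unfolding gderiv_def by (rule has_derivative_unique)
  then have "inner (E - D) (E - D) = 0" by (metis inner_diff_right right_minus_eq)
  then show "E = D" by simp
qed

lemma GDERIV_ex:
  fixes f :: "real ^ 'n \<Rightarrow> real"
  assumes "f differentiable (at x)"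
  shows "\<exists>D. GDERIV f x :> D"
proof -
  obtain L where L: "(f has_derivative L) (at x)" using assms by (auto simp: differentiable_def)
  then interpret linear L using has_derivative_linear by blast
  have "(\<lambda>h. inner h (\<Sum>b\<in>Basis. L b *\<^sub>R b)) = L"
  proof
    fix h
    have "L h = L (\<Sum>b\<in>Basis. inner h b *\<^sub>R b)" by (simp add: euclidean_representation)
    then show "inner h (\<Sum>b\<in>Basis. L b *\<^sub>R b) = L h"
      by (simp add: sum scale inner_sum_right mult.commute)
  qed
  with L show ?thesis unfolding gderiv_def by metis
qed

lemma GDERIV_grad:
  fixes f :: "real ^ 'n \<Rightarrow> real"
  shows "f differentiable (at x) \<Longrightarrow> GDERIV f x :> grad f x"
  using GDERIV_ex grad_eqI by metis

lemma GDERIV_differentiable: "GDERIV f x :> D \<Longrightarrow> f differentiable (at x)"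
  unfolding gderiv_def differentiable_def by blast

lemma C_k_SucI:
  assumes "\<And>x. GDERIV f x :> G x" "\<And>i. C_k k (\<lambda>x. G x $ i)"
  shows "C_k (Suc k) f"
  using assms GDERIV_differentiable[OF assms(1)] grad_eqI[OF assms(1)] by simp

lemma C_k_Suc_imp: "C_k (Suc k) f \<Longrightarrow> C_k k f"
proof (induction k arbitrary: f)
  case 0
  then show ?case
    by (auto simp: continuous_on_eq_continuous_within intro: differentiable_imp_continuous_within)
next
  case (Suc k)
  have *: "(\<forall>x. f differentiable (at x)) \<and> (\<forall>i. C_k (Suc k) (\<lambda>x. grad f x $ i))"
    using Suc.prems unfolding C_k.simps(2)[of "Suc k"] .
  then have "\<forall>i. C_k k (\<lambda>x. grad f x $ i)" using Suc.IH by blast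
  with * show ?case by simp
qed

lemma C_k_add: "C_k k f \<Longrightarrow> C_k k g \<Longrightarrow> C_k k (\<lambda>x. f x + g x)"
proof (induction k arbitrary: f g)
  case 0
  then show ?case by (auto intro: continuous_intros)
next
  case (Suc k)
  show ?case
  proof (rule C_k_SucI)
    show "GDERIV (\<lambda>x. f x + g x) x :> grad f x + grad g x" for x
      using Suc.prems by (intro GDERIV_add GDERIV_grad) auto
    show "C_k k (\<lambda>x. (grad f x + grad g x) $ i)" for i
      using Suc.prems by (simp add: Suc.IH)
  qed
qed

lemma C_k_mult: "C_k k f \<Longrightarrow> C_k k g \<Longrightarrow> C_k k (\<lambda>x. f x * g x)"
proof (induction k arbitrary: f g)
  case 0
  then show ?case by (auto intro: continuous_intros)
next
  case (Suc k)
  show ?case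
  proof (rule C_k_SucI)
    show "GDERIV (\<lambda>x. f x * g x) x :> f x *\<^sub>R grad g x + g x *\<^sub>R grad f x" for x
      using Suc.prems by (intro GDERIV_mult GDERIV_grad) auto
    show "C_k k (\<lambda>x. (f x *\<^sub>R grad g x + g x *\<^sub>R grad f x) $ i)" for i
      using Suc.prems C_k_Suc_imp[of k f] C_k_Suc_imp[of k g] by (simp add: Suc.IH C_k_add)
  qed
qed

lemma C_k_const: "C_k k (\<lambda>x. a)"
proof (induction k arbitrary: a)
  case (Suc k)
  show ?case by (rule C_k_SucI[OF GDERIV_const]) (use Suc in simp)
qed simp

lemma GDERIV_coord: "GDERIV (\<lambda>x. (x - c) $ i) x :> axis i 1"
  unfolding gderiv_def
  using has_derivative_diff[OF bounded_linear_imp_has_derivative[OF bounded_linear_vec_nth] has_derivative_const]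
  by (simp add: inner_axis)

lemma C_k_coord: "C_k k (\<lambda>x. (x - c) $ i)"
proof (cases k)
  case (Suc l)
  show ?thesis unfolding Suc
    by (rule C_k_SucI[OF GDERIV_coord]) (rule C_k_const)
qed (auto intro!: continuous_intros)

section \<open>Differentiability of order k on an open set of the line, for radial profiles singular
  at 0\<close>

primrec D_k :: "nat \<Rightarrow> real set \<Rightarrow> (real \<Rightarrow> real) \<Rightarrow> bool" where
  "D_k 0 S f \<longleftrightarrow> continuous_on S f"
| "D_k (Suc k) S f \<longleftrightarrow> (\<forall>x\<in>S. f differentiable (at x)) \<and> D_k k S (deriv f)"

lemma D_k_cong: "open S \<Longrightarrow> D_k k S f \<Longrightarrow> (\<And>x. x \<in> S \<Longrightarrow> f x = g x) \<Longrightarrow> D_k k S g"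
proof (induction k arbitrary: f g)
  case 0
  then show ?case using continuous_on_cong[of S S f g] by simp
next
  case (Suc k)
  have ev: "\<forall>\<^sub>F y in nhds x. f y = g y" if "x \<in> S" for x
    using Suc.prems(1,3) that unfolding eventually_nhds by blast
  have "deriv f x = deriv g x" if "x \<in> S" for x
    by (rule deriv_cong_ev[OF ev[OF that] refl])
  moreover have "g differentiable (at x)" if "x \<in> S" for x
  proof -
    have "f differentiable (at x)" using Suc.prems(2) that by simp
    then obtain D where "(f has_real_derivative D) (at x)" by (auto simp: real_differentiable_def)
    then have "(g has_real_derivative D) (at x)"
      using DERIV_cong_ev[OF refl ev[OF that] refl] by simp
    then show ?thesis by (auto simp: real_differentiable_def)
  qed
  ultimately show ?case using Suc.prems Suc.IH[of "deriv f" "deriv g"] by simp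
qed

lemma D_k_SucI:
  assumes "open S" "\<And>x. x \<in> S \<Longrightarrow> (f has_real_derivative f' x) (at x)" "D_k k S f'"
  shows "D_k (Suc k) S f"
  using assms DERIV_imp_deriv[OF assms(2)]
  by (auto simp: real_differentiable_def intro: D_k_cong[of S k f'])

lemma D_k_deriv: "D_k (Suc k) S f \<Longrightarrow> x \<in> S \<Longrightarrow> (f has_real_derivative deriv f x) (at x)"
  by (auto simp: DERIV_deriv_iff_real_differentiable)

lemma D_k_Suc_imp: "D_k (Suc k) S f \<Longrightarrow> D_k k S f"
proof (induction k arbitrary: f)
  case 0
  then show ?case
    by (auto intro!: continuous_at_imp_continuous_on differentiable_imp_continuous_within)
next
  case (Suc k)
  then show ?case by (metis D_k.simps(2))
qed

lemma D_k_subset: "D_k k S f \<Longrightarrow> T \<subseteq> S \<Longrightarrow> D_k k T f"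
  by (induction k arbitrary: f) (auto intro: continuous_on_subset)

lemma D_k_add: "open S \<Longrightarrow> D_k k S f \<Longrightarrow> D_k k S g \<Longrightarrow> D_k k S (\<lambda>x. f x + g x)"
proof (induction k arbitrary: f g)
  case (Suc k)
  then show ?case
    by (intro D_k_SucI[where f'="\<lambda>x. deriv f x + deriv g x"] DERIV_add)
       (auto simp: DERIV_deriv_iff_real_differentiable)
qed (auto intro: continuous_intros)

lemma D_k_mult: "open S \<Longrightarrow> D_k k S f \<Longrightarrow> D_k k S g \<Longrightarrow> D_k k S (\<lambda>x. f x * g x)"
proof (induction k arbitrary: f g)
  case (Suc k)
  show ?case
  proof (rule D_k_SucI[OF Suc.prems(1)])
    show "((\<lambda>x. f x * g x) has_real_derivative deriv f x * g x + deriv g x * f x) (at x)" if "x \<in> S" for x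
      by (rule DERIV_mult) (use Suc.prems that in \<open>auto intro: D_k_deriv\<close>)
    show "D_k k S (\<lambda>x. deriv f x * g x + deriv g x * f x)"
      using Suc D_k_Suc_imp[of k S f] D_k_Suc_imp[of k S g] by (intro D_k_add Suc.IH) auto
  qed
qed (auto intro: continuous_intros)

lemma D_k_const: "open S \<Longrightarrow> D_k k S (\<lambda>x. a)"
proof (induction k arbitrary: a)
  case (Suc k)
  then show ?case by (intro D_k_SucI[where f'="\<lambda>x. 0"]) auto
qed simp

lemma D_k_ident: "open S \<Longrightarrow> D_k k S (\<lambda>x. x)"
  by (cases k) (auto simp del: D_k.simps(2) intro!: D_k_SucI[where f'="\<lambda>x. 1"] D_k_const)

lemma D_k_compose:
  assumes "open S" "open T" "\<And>x. x \<in> S \<Longrightarrow> g x \<in> T"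
  shows "D_k k T f \<Longrightarrow> D_k k S g \<Longrightarrow> D_k k S (\<lambda>x. f (g x))"
proof (induction k arbitrary: f)
  case 0
  then show ?case using assms by (auto intro!: continuous_on_compose2[of T f S g])
next
  case (Suc k)
  show ?case
  proof (rule D_k_SucI[OF assms(1)])
    show "((\<lambda>x. f (g x)) has_real_derivative deriv f (g x) * deriv g x) (at x)" if "x \<in> S" for x
      by (rule DERIV_chain2) (use Suc.prems that assms in \<open>auto intro: D_k_deriv\<close>)
    show "D_k k S (\<lambda>x. deriv f (g x) * deriv g x)"
    proof (rule D_k_mult[OF assms(1)])
      show "D_k k S (\<lambda>x. deriv f (g x))"
        by (rule Suc.IH) (use Suc.prems in \<open>auto intro: D_k_Suc_imp\<close>)
      show "D_k k S (deriv g)" using Suc.prems by simp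
    qed
  qed
qed

lemma D_k_exp: "D_k k UNIV (exp :: real \<Rightarrow> real)"
  by (induction k) (auto simp del: D_k.simps(2) intro!: D_k_SucI[where f'=exp] DERIV_exp continuous_intros)

lemma D_k_inverse: "D_k k {0<..} (inverse :: real \<Rightarrow> real)"
proof (induction k)
  case (Suc k)
  show ?case
  proof (rule D_k_SucI)
    show "(inverse has_real_derivative (-1) * (inverse x * inverse x)) (at x)" if "x \<in> {0<..}" for x :: real
      using DERIV_inverse[of x] that by (simp add: power2_eq_square eval_nat_numeral)
    show "D_k k {0<..} (\<lambda>x::real. (-1) * (inverse x * inverse x))"
      by (intro D_k_mult D_k_const Suc) auto
  qed auto
qed (auto intro!: continuous_intros)

text \<open>The polynomial is a parameter because the functions \<open>p(1/x) * exp (-1/x)\<close>,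
  continued by zero, form a family closed under differentiation; smoothness of all orders then needs
  only one derivative formula.\<close>

definition flat :: "real poly \<Rightarrow> real \<Rightarrow> real" where
  "flat p x = (if x > 0 then poly p (1 / x) * exp (- (1 / x)) else 0)"

lemma poly_exp_tendsto_0: "((\<lambda>y. poly p y * exp (- y)) \<longlongrightarrow> 0) (at_top :: real filter)"
proof -
  have "((\<lambda>y. \<Sum>i\<le>degree p. coeff p i * (y ^ i / exp y)) \<longlongrightarrow> (\<Sum>i\<le>degree p. coeff p i * 0)) (at_top :: real filter)"
    by (intro tendsto_intros tendsto_power_div_exp_0)
  then show ?thesis
    by (simp add: poly_altdef exp_minus sum_distrib_right divide_inverse mult.assoc)
qed

text \<open>With \<open>y = 1 / x\<close> the chain rule gives
  \<open>(p y - p' y) * y\<^sup>2 * exp (- y)\<close>, whence the polynomial factor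
  \<open>[:0, 0, 1:]\<close>.\<close>

lemma flat_derivative:
  "(flat p has_real_derivative flat ([:0, 0, 1:] * (p - pderiv p)) x) (at x)"
proof (cases x "0::real" rule: linorder_cases)
  case less
  have "((\<lambda>x. 0) has_real_derivative 0) (at x)" by simp
  moreover have "\<forall>\<^sub>F y in nhds x. flat p y = 0"
    using less eventually_nhds_in_open[of "{..<0}" x] by (auto simp: flat_def elim!: eventually_mono)
  ultimately show ?thesis using less DERIV_cong_ev[of x x "flat p" "\<lambda>x. 0" 0 0] by (simp add: flat_def)
next
  case greater
  have "((\<lambda>x. poly p (1 / x) * exp (- (1 / x))) has_real_derivative
      flat ([:0, 0, 1:] * (p - pderiv p)) x) (at x)"
  proof -
    have g: "((\<lambda>x. 1 / x) has_real_derivative - (1 / x\<^sup>2)) (at x)"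
      using greater by (auto intro!: derivative_eq_intros simp: power2_eq_square)
    show ?thesis
      by (rule DERIV_cong[OF DERIV_mult[OF DERIV_chain2[OF poly_DERIV g] DERIV_chain2[OF DERIV_exp DERIV_minus[OF g]]]])
         (use greater in \<open>simp add: flat_def power2_eq_square algebra_simps divide_inverse\<close>)
  qed
  moreover have ev: "\<forall>\<^sub>F y in nhds x. flat p y = poly p (1 / y) * exp (- (1 / y))"
    using greater eventually_nhds_in_open[of "{0<..}" x] by (auto simp: flat_def elim!: eventually_mono)
  ultimately show ?thesis by (simp only: DERIV_cong_ev[OF refl ev refl])
next
  case equal
  have "((\<lambda>h. flat p h / h) \<longlongrightarrow> 0) (at 0)"
  proof (rule filterlim_split_at)
    show "((\<lambda>h. flat p h / h) \<longlongrightarrow> 0) (at_left 0)"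
      by (rule tendsto_eventually) (auto simp: flat_def eventually_at_left_field intro!: exI[of _ "-1"])
    \<comment> \<open>In terms of \<open>y = 1 / h\<close> the difference quotient at 0 is
      \<open>y * p y * exp (- y)\<close>, and division by \<open>h\<close> accounts for the extra
      factor \<open>y\<close>.\<close>
    have "((\<lambda>y. poly ([:0, 1:] * p) y * exp (- y)) \<longlongrightarrow> 0) at_top" by (rule poly_exp_tendsto_0)
    then have "((\<lambda>h. poly ([:0, 1:] * p) (inverse h) * exp (- inverse h)) \<longlongrightarrow> 0) (at_right 0)"
      by (rule filterlim_compose) (rule filterlim_inverse_at_top_right)
    then show "((\<lambda>h. flat p h / h) \<longlongrightarrow> 0) (at_right 0)"
      by (rule Lim_transform_eventually)
         (auto simp: flat_def eventually_at_right_field field_simps intro!: exI[of _ 1])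
  qed
  then show ?thesis using equal by (simp add: DERIV_def flat_def)
qed

lemma D_k_flat: "D_k k UNIV (flat p)"
proof (induction k arbitrary: p)
  case 0
  then show ?case
    using flat_derivative by (auto intro!: continuous_at_imp_continuous_on DERIV_isCont)
next
  case (Suc k)
  then show ?case by (intro D_k_SucI[OF _ flat_derivative]) auto
qed

definition smoothstep :: "real \<Rightarrow> real" where
  "smoothstep x = flat 1 (x - 1) * inverse (flat 1 (x - 1) + flat 1 (2 - x))"

lemma flat_1: "flat 1 x = (if x > 0 then exp (- (1 / x)) else 0)"
  by (simp add: flat_def)

text \<open>Every \<open>x\<close> satisfies \<open>x > 1\<close> or \<open>x < 2\<close>, so one of
  the two summands is positive.\<close>

lemma smoothstep_denom: "flat 1 (x - 1) + flat 1 (2 - x) > 0"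
  by (auto simp: flat_1 intro: add_pos_pos)

lemma smoothstep_0: "x \<le> 1 \<Longrightarrow> smoothstep x = 0"
  by (simp add: smoothstep_def flat_1)

lemma smoothstep_1: "x \<ge> 2 \<Longrightarrow> smoothstep x = 1"
  using smoothstep_denom[of x] by (simp add: smoothstep_def flat_1)

lemma smoothstep_range: "0 \<le> smoothstep x" "smoothstep x \<le> 1"
  using smoothstep_denom[of x] by (auto simp: smoothstep_def flat_1 divide_inverse[symmetric])

lemma D_k_linear: "open S \<Longrightarrow> D_k k S (\<lambda>x. a * x + b)"
  by (intro D_k_add D_k_mult D_k_const D_k_ident)

lemma D_k_smoothstep: "D_k k UNIV smoothstep"
proof -
  have 1: "D_k k UNIV (\<lambda>x. flat 1 (1 * x + -1))" "D_k k UNIV (\<lambda>x. flat 1 (-1 * x + 2))"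
    by (rule D_k_compose[OF _ _ _ D_k_flat D_k_linear]; simp)+
  then have 2: "D_k k UNIV (\<lambda>x. flat 1 (1 * x + -1) + flat 1 (-1 * x + 2))"
    by (intro D_k_add) auto
  have 3: "D_k k UNIV (\<lambda>x. inverse (flat 1 (1 * x + -1) + flat 1 (-1 * x + 2)))"
    by (rule D_k_compose[OF _ _ _ D_k_inverse 2]) (use smoothstep_denom in auto)
  have "D_k k UNIV (\<lambda>x. flat 1 (1 * x + -1) * inverse (flat 1 (1 * x + -1) + flat 1 (-1 * x + 2)))"
    by (intro D_k_mult 1 3) auto
  then show ?thesis by (simp add: smoothstep_def[abs_def])
qed

lemma smoothstep_deriv:
  "(smoothstep has_real_derivative deriv smoothstep x) (at x)"
  using D_k_smoothstep[of 1] by (auto simp: DERIV_deriv_iff_real_differentiable)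

lemma smoothstep_deriv_0:
  assumes "x < 1 \<or> 2 < x" shows "deriv smoothstep x = 0"
proof -
  obtain a where "\<forall>\<^sub>F y in nhds x. smoothstep y = a"
    using assms
  proof
    assume "x < 1"
    then have "\<forall>\<^sub>F y in nhds x. smoothstep y = 0"
      using eventually_nhds_in_open[of "{..<1}" x] by (auto simp: smoothstep_0 elim!: eventually_mono)
    then show ?thesis by (rule that)
  next
    assume "2 < x"
    then have "\<forall>\<^sub>F y in nhds x. smoothstep y = 1"
      using eventually_nhds_in_open[of "{2<..}" x] by (auto simp: smoothstep_1 elim!: eventually_mono)
    then show ?thesis by (rule that)
  qed
  then have "deriv smoothstep x = deriv (\<lambda>y. a) x" by (rule deriv_cong_ev) simp
  then show ?thesis by simp
qed

lemma smoothstep_deriv_bounded: "\<exists>B>0. \<forall>x. \<bar>deriv smoothstep x\<bar> \<le> B"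
proof -
  have "continuous_on {1..2} (deriv smoothstep)"
    using D_k_smoothstep[of 1] by (auto intro: continuous_on_subset)
  then have "bounded (deriv smoothstep ` {1..2})"
    by (intro compact_imp_bounded compact_continuous_image) auto
  then obtain B where B: "B > 0" "\<And>x. x \<in> {1..2} \<Longrightarrow> \<bar>deriv smoothstep x\<bar> \<le> B"
    unfolding bounded_pos by auto
  have "\<bar>deriv smoothstep x\<bar> \<le> B" for x
    using B smoothstep_deriv_0[of x] by (cases "x \<in> {1..2}") auto
  with B(1) show ?thesis by blast
qed

section \<open>Radial functions\<close>

lemma GDERIV_norm_diff:
  assumes "x \<noteq> c" shows "GDERIV (\<lambda>x. norm (x - c)) x :> sgn (x - c)"
proof -
  have "((\<lambda>x. norm (x - c)) has_derivative (\<lambda>h. inner h (sgn (x - c)))) (at x)"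
    by (rule has_derivative_compose[where f="\<lambda>x. x - c" and g=norm and f'="\<lambda>h. h"])
       (use assms in \<open>auto intro!: has_derivative_norm derivative_eq_intros\<close>)
  then show ?thesis by (simp add: gderiv_def)
qed

lemma GDERIV_radial:
  assumes "x \<noteq> c" "(F has_real_derivative d) (at (norm (x - c)))"
  shows "GDERIV (\<lambda>x. F (norm (x - c))) x :> (d / norm (x - c)) *\<^sub>R (x - c)"
  using GDERIV_DERIV_compose[OF GDERIV_norm_diff[OF assms(1)] assms(2)]
  by (simp add: sgn_div_norm divide_inverse)

lemma GDERIV_cong_ev:
  assumes "GDERIV f x :> D" "\<forall>\<^sub>F y in nhds x. f y = g y"
  shows "GDERIV g x :> D"
  using assms eventually_nhds_x_imp_x[OF assms(2)] unfolding gderiv_def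
  by (elim has_derivative_transform_eventually)
     (auto simp: eventually_at_filter elim: eventually_mono)

text \<open>The factor of \<open>x - c\<close> in the gradient of a radial function. It is again a
  radial profile, which lets derivatives be iterated. At \<open>r = 0\<close> division by zero
  yields 0, the correct value for profiles vanishing near the centre.\<close>

definition radial_slope :: "(real \<Rightarrow> real) \<Rightarrow> real \<Rightarrow> real" where
  "radial_slope F r = deriv F r / r"

lemma GDERIV_radial_all:
  assumes F: "\<And>r. r > 0 \<Longrightarrow> F differentiable (at r)" and z: "\<And>r. 0 \<le> r \<Longrightarrow> r < lo \<Longrightarrow> F r = 0" and "lo > 0"
  shows "GDERIV (\<lambda>x. F (norm (x - c))) x :> radial_slope F (norm (x - c)) *\<^sub>R (x - c)"
proof (cases "x = c")
  case True
  have "\<forall>\<^sub>F y in nhds c. y \<in> ball c lo" using \<open>lo > 0\<close> by (intro eventually_nhds_in_open) auto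
  then have "\<forall>\<^sub>F y in nhds c. 0 = F (norm (y - c))"
    by eventually_elim (use z in \<open>auto simp: dist_norm norm_minus_commute\<close>)
  from GDERIV_cong_ev[OF GDERIV_const this] show ?thesis using True by simp
next
  case False
  then show ?thesis unfolding radial_slope_def
    by (intro GDERIV_radial) (use F in \<open>auto simp: DERIV_deriv_iff_real_differentiable\<close>)
qed

lemma deriv_zero_near:
  fixes F :: "real \<Rightarrow> real"
  assumes "\<And>r. 0 < r \<Longrightarrow> r < lo \<Longrightarrow> F r = 0" "0 < r" "r < lo"
  shows "deriv F r = 0"
proof -
  have "\<forall>\<^sub>F y in nhds r. F y = 0"
    by (rule eventually_mono[OF eventually_nhds_in_open[of "{0<..<lo}"]]) (simp_all add: assms)
  then have "deriv F r = deriv (\<lambda>y. 0) r" by (rule deriv_cong_ev) simp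
  then show ?thesis by simp
qed

lemma D_k_radial_slope: "D_k (Suc k) {0<..} F \<Longrightarrow> D_k k {0<..} (radial_slope F)"
  unfolding radial_slope_def[abs_def] divide_inverse
  by (intro D_k_mult D_k_inverse) (auto)

lemma radial_slope_zero:
  assumes "\<And>r. 0 \<le> r \<Longrightarrow> r < lo \<Longrightarrow> F r = 0" "0 \<le> r" "r < lo"
  shows "radial_slope F r = 0"
  using deriv_zero_near[of lo F r] assms by (cases "r = 0") (auto simp: radial_slope_def)

text \<open>Each partial derivative is a radial function times a coordinate, so the induction stays
  among radial profiles. Vanishing for \<open>r < lo\<close> removes the singularity of the norm at
  the centre and is inherited by the slope.\<close>

lemma C_k_radial:
  fixes c :: "real ^ 'n"
  assumes "D_k k {0<..} F" and z: "\<And>r. 0 \<le> r \<Longrightarrow> r < lo \<Longrightarrow> F r = 0" and "lo > 0"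
  shows "C_k k (\<lambda>x. F (norm (x - c)))"
  using assms(1) z
proof (induction k arbitrary: F)
  case 0
  have "continuous_on {0<..} F" using 0 by simp
  then have c1: "continuous_on (- {c}) (\<lambda>x. F (norm (x - c)))"
    by (rule continuous_on_compose2) (auto intro!: continuous_intros)
  have "continuous_on (ball c lo) (\<lambda>x. F (norm (x - c)))"
    using 0 by (subst continuous_on_cong[OF refl, of _ _ "\<lambda>x. 0"]) (auto simp: dist_norm norm_minus_commute)
  then have "continuous_on (- {c} \<union> ball c lo) (\<lambda>x. F (norm (x - c)))"
    using c1 by (intro continuous_on_open_Un) auto
  moreover have "- {c} \<union> ball c lo = UNIV" using \<open>lo > 0\<close> by auto
  ultimately show ?case by simp
next
  case (Suc k)
  show ?case
  proof (rule C_k_SucI)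
    show "GDERIV (\<lambda>x. F (norm (x - c))) x :> radial_slope F (norm (x - c)) *\<^sub>R (x - c)" for x
      using Suc.prems by (intro GDERIV_radial_all[OF _ _ \<open>lo > 0\<close>]) auto
    have "C_k k (\<lambda>x. radial_slope F (norm (x - c)))"
      by (intro Suc.IH D_k_radial_slope Suc.prems radial_slope_zero[of lo F]) auto
    then show "C_k k (\<lambda>x. (radial_slope F (norm (x - c)) *\<^sub>R (x - c)) $ i)" for i
      using C_k_mult[OF _ C_k_coord] by simp
  qed
qed

text \<open>Two profiles occur because the Laplacian is wanted for \<open>G\<close>, while only
  \<open>F\<close>, in the application a cut-off multiple of \<open>G\<close>, gives a function
  smooth on the whole space; they agree on \<open>I\<close>.\<close>

lemma laplacian_radial:
  fixes c :: "real ^ 'n"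
  assumes F: "D_k 2 {0<..} F" and z: "\<And>r. 0 \<le> r \<Longrightarrow> r < lo \<Longrightarrow> F r = 0" and "lo > 0"
    and I: "open I" "I \<subseteq> {0<..}" "norm (x - c) \<in> I" and eq: "\<And>r. r \<in> I \<Longrightarrow> F r = G r"
    and G: "\<And>r. r \<in> I \<Longrightarrow> (G has_real_derivative G' r) (at r)"
    and G': "(G' has_real_derivative G'') (at (norm (x - c)))"
  shows "laplacian (\<lambda>x. F (norm (x - c))) x = G'' + (real CARD('n) - 1) * G' (norm (x - c)) / norm (x - c)"
proof -
  let ?r = "norm (x - c)"
  have F1: "D_k (Suc 0) {0<..} (radial_slope F)" using F by (intro D_k_radial_slope) (simp add: numeral_2_eq_2)
  have "F differentiable (at r)" if "r > 0" for r using F that by (simp add: numeral_2_eq_2)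
  then have gF: "GDERIV (\<lambda>x. F (norm (x - c))) y :> radial_slope F (norm (y - c)) *\<^sub>R (y - c)" for y
    by (intro GDERIV_radial_all[OF _ z \<open>lo > 0\<close>]) auto
  have gF1: "GDERIV (\<lambda>x. radial_slope F (norm (x - c))) y :> radial_slope (radial_slope F) (norm (y - c)) *\<^sub>R (y - c)" for y
    using F1 by (intro GDERIV_radial_all[OF _ radial_slope_zero[OF z] \<open>lo > 0\<close>]) auto
  have r: "?r > 0" using I by auto
  \<comment> \<open>For \<open>g = F' / r\<close> the i-th term is
    \<open>g + (g' / r) * ((x - c) $ i)\<^sup>2\<close>. The sum over \<open>i\<close> is
    \<open>n * g + r * g'\<close>, and \<open>r * g' = F'' - F' / r\<close>.\<close>
  have comp: "grad (\<lambda>y. grad (\<lambda>x. F (norm (x - c))) y $ i) x $ i = radial_slope F ?r + radial_slope (radial_slope F) ?r * ((x - c) $ i)\<^sup>2" for i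
  proof -
    have "(\<lambda>y. grad (\<lambda>x. F (norm (x - c))) y $ i) = (\<lambda>y. radial_slope F (norm (y - c)) * (y - c) $ i)"
      using grad_eqI[OF gF] by (simp add: fun_eq_iff)
    then show ?thesis
      using grad_eqI[OF GDERIV_mult[OF gF1[of x] GDERIV_coord[of c i x]]]
      by (simp add: axis_def power2_eq_square mult_ac)
  qed
  have "?r\<^sup>2 = (\<Sum>i\<in>UNIV. ((x - c) $ i)\<^sup>2)"
    by (subst power2_norm_eq_inner) (simp add: inner_vec_def power2_eq_square)
  then have lap: "laplacian (\<lambda>x. F (norm (x - c))) x = real CARD('n) * radial_slope F ?r + radial_slope (radial_slope F) ?r * ?r\<^sup>2"
    unfolding laplacian_def comp by (simp add: sum.distrib sum_distrib_left)
  have ev: "\<forall>\<^sub>F s in nhds ?r. s \<in> I" by (rule eventually_nhds_in_open) (use I in auto)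
  have dF: "deriv F s = G' s" if "s \<in> I" for s
  proof -
    have "\<forall>\<^sub>F y in nhds s. F y = G y"
      using eventually_nhds_in_open[OF I(1) that] by eventually_elim (rule eq)
    then have "deriv F s = deriv G s" by (rule deriv_cong_ev) simp
    then show ?thesis using DERIV_imp_deriv[OF G[OF that]] by simp
  qed
  have "\<forall>\<^sub>F s in nhds ?r. radial_slope F s = G' s / s"
    using ev by eventually_elim (simp add: radial_slope_def dF)
  then have "deriv (radial_slope F) ?r = deriv (\<lambda>s. G' s / s) ?r" by (rule deriv_cong_ev) simp
  also have "\<dots> = (G'' * ?r - G' ?r * 1) / (?r * ?r)"
    by (rule DERIV_imp_deriv, rule DERIV_divide[OF G' DERIV_ident]) (use r in simp)
  finally have "radial_slope (radial_slope F) ?r * ?r\<^sup>2 = G'' - G' ?r / ?r"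
    using r by (simp add: radial_slope_def[of "radial_slope F"] field_simps power2_eq_square)
  moreover have "radial_slope F ?r = G' ?r / ?r" using dF I by (simp add: radial_slope_def)
  ultimately show ?thesis unfolding lap by (simp add: algebra_simps diff_divide_distrib)
qed

lemma radial_test_function:
  fixes c :: "real ^ 'n"
  assumes "\<And>k. D_k k {0<..} F" and z: "\<And>r. 0 \<le> r \<Longrightarrow> r < lo \<Longrightarrow> F r = 0"
    and z1: "\<And>r. r > hi \<Longrightarrow> F r = 0" and "0 \<le> R" "R < lo"
  shows "(\<lambda>x. F (norm (x - c))) \<in> test_functions (- cball c R)"
proof -
  have "{x. F (norm (x - c)) \<noteq> 0} \<subseteq> cball c hi - ball c lo"
  proof
    fix x assume "x \<in> {x. F (norm (x - c)) \<noteq> 0}"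
    then have "norm (x - c) \<le> hi" "\<not> norm (x - c) < lo"
      using z[of "norm (x - c)"] z1[of "norm (x - c)"] by (auto simp: not_le[symmetric])
    then show "x \<in> cball c hi - ball c lo" by (simp add: dist_norm norm_minus_commute)
  qed
  moreover have cl: "closed (cball c hi - ball c lo)" by (intro closed_Diff) auto
  ultimately have sub: "closure {x. F (norm (x - c)) \<noteq> 0} \<subseteq> cball c hi - ball c lo"
    by (rule closure_minimal)
  have "compact (closure {x. F (norm (x - c)) \<noteq> 0})"
    using sub bounded_subset[OF bounded_cball[of c hi]] by (auto simp: compact_eq_bounded_closed)
  moreover have "cball c hi - ball c lo \<subseteq> - cball c R" using \<open>R < lo\<close> by auto
  moreover have "C_k k (\<lambda>x. F (norm (x - c)))" for k
    by (rule C_k_radial[OF assms(1) z]) (use assms in auto)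
  ultimately show ?thesis using sub by (auto simp: test_functions_def)
qed

section \<open>Green's formula for test functions\<close>

definition csupp :: "('a::euclidean_space \<Rightarrow> real) \<Rightarrow> bool" where
  "csupp f \<longleftrightarrow> continuous_on UNIV f \<and> (\<exists>B. \<forall>x. B < norm x \<longrightarrow> f x = 0)"

lemma csupp_borel: "csupp f \<Longrightarrow> f \<in> borel_measurable borel"
  by (auto simp: csupp_def intro: borel_measurable_continuous_onI)

lemma csupp_measurable: "csupp f \<Longrightarrow> f \<in> borel_measurable lebesgue"
  by (rule measurable_completion) (use csupp_borel in simp)

lemma csupp_bounded:
  assumes "csupp f" shows "\<exists>K>0. \<forall>x. \<bar>f x\<bar> \<le> K"
proof -
  obtain B where B: "\<And>x. B < norm x \<Longrightarrow> f x = 0" using assms by (auto simp: csupp_def)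
  have "compact (f ` cball 0 B)"
    using assms by (intro compact_continuous_image) (auto simp: csupp_def intro: continuous_on_subset)
  then obtain K where "K > 0" "\<And>x. x \<in> cball 0 B \<Longrightarrow> \<bar>f x\<bar> \<le> K"
    using compact_imp_bounded bounded_pos by (metis (no_types, lifting) imageI real_norm_def)
  moreover from this have "\<bar>f x\<bar> \<le> K" for x
    using B[of x] by (cases "norm x \<le> B") auto
  ultimately show ?thesis by blast
qed

lemma csupp_integrable:
  assumes "csupp f" shows "integrable lborel f"
proof -
  obtain B where B: "\<And>x. B < norm x \<Longrightarrow> f x = 0" using assms by (auto simp: csupp_def)
  obtain K where K: "\<And>x. \<bar>f x\<bar> \<le> K" using csupp_bounded[OF assms] by blast
  show ?thesis
  proof (rule integrableI_bounded_set[where A="cball 0 B" and B=K])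
    show "emeasure lborel (cball 0 B) < \<infinity>" by (rule emeasure_bounded_finite) simp
  qed (use B K csupp_borel[OF assms] in \<open>auto intro!: AE_I2 simp: not_le\<close>)
qed

lemma csupp_mult: "csupp f \<Longrightarrow> csupp g \<Longrightarrow> csupp (\<lambda>x. f x * g x)"
  unfolding csupp_def by (auto intro!: continuous_intros)

lemma csupp_add:
  assumes "csupp f" "csupp g" shows "csupp (\<lambda>x. f x + g x)"
proof -
  obtain B C where "\<And>x. B < norm x \<Longrightarrow> f x = 0" "\<And>x. C < norm x \<Longrightarrow> g x = 0"
    using assms by (auto simp: csupp_def)
  then have "\<forall>x. max B C < norm x \<longrightarrow> f x + g x = 0" by simp
  moreover have "continuous_on UNIV (\<lambda>x. f x + g x)"
    using assms by (intro continuous_intros) (auto simp: csupp_def)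
  ultimately show ?thesis unfolding csupp_def by blast
qed

lemma csupp_sqint: "csupp f \<Longrightarrow> f \<in> sqint"
  using csupp_integrable[OF csupp_mult[of f f]] csupp_measurable[of f] csupp_borel[of f]
  by (simp add: sqint_def power2_eq_square integrable_completion)

text \<open>The difference quotients have integral zero by translation invariance.\<close>

lemma integral_partial_derivative_0:
  fixes w :: "real ^ 'n \<Rightarrow> real"
  assumes w: "csupp w" and G: "\<And>x. GDERIV w x :> G x" and Gi: "csupp (\<lambda>x. G x $ i)"
  shows "(\<integral>x. G x $ i \<partial>lborel) = 0"
proof -
  obtain K where K: "\<And>x. \<bar>G x $ i\<bar> \<le> K" using csupp_bounded[OF Gi] by blast
  obtain B where B: "\<And>x. B < norm x \<Longrightarrow> w x = 0" using w by (auto simp: csupp_def)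
  define e :: "real ^ 'n" where "e = axis i 1"
  have ne: "norm e = 1" by (simp add: e_def)
  define h where "h n = 1 / real (Suc n)" for n
  have h: "h n > 0" "h n \<le> 1" for n by (auto simp: h_def)
  define q where "q n x = (w (x + h n *\<^sub>R e) - w x) / h n" for n x
  note [measurable] = csupp_borel[OF w] csupp_borel[OF Gi]
  have D: "((\<lambda>t. w (x + t *\<^sub>R e)) has_real_derivative G (x + t *\<^sub>R e) $ i) (at t)" for x t
  proof -
    have "((\<lambda>t. w (x + t *\<^sub>R e)) has_derivative (\<lambda>s. inner (s *\<^sub>R e) (G (x + t *\<^sub>R e)))) (at t)"
      by (rule has_derivative_compose[where f="\<lambda>t. x + t *\<^sub>R e" and g=w])
         (use G in \<open>auto intro!: derivative_eq_intros simp: gderiv_def\<close>)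
    then show ?thesis
      by (simp add: has_field_derivative_def e_def inner_axis' mult.commute[of _ "G _ $ i"] mult_commute_abs)
  qed
  \<comment> \<open>By the mean value theorem a difference quotient is a value of the partial
    derivative, which gives a bound independent of \<open>n\<close>. As the shifts are at most 1,
    all quotients live in one ball, and dominated convergence applies.\<close>
  have qK: "\<bar>q n x\<bar> \<le> K" for n x
  proof -
    have "\<exists>z>0. z < h n \<and> w (x + h n *\<^sub>R e) - w (x + 0 *\<^sub>R e) = (h n - 0) * (G (x + z *\<^sub>R e) $ i)"
      by (rule MVT2[OF h(1)]) (rule D)
    then obtain z where "w (x + h n *\<^sub>R e) - w x = h n * (G (x + z *\<^sub>R e) $ i)" by auto
    then have "q n x = G (x + z *\<^sub>R e) $ i" using h(1)[of n] by (simp add: q_def)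
    then show ?thesis using K by simp
  qed
  have q0: "q n x = 0" if "B + 1 < norm x" for n x
  proof -
    have "norm x \<le> norm (x + h n *\<^sub>R e) + norm (h n *\<^sub>R e)"
      using norm_triangle_ineq4[of "x + h n *\<^sub>R e" "h n *\<^sub>R e"] by simp
    then have "B < norm (x + h n *\<^sub>R e)" using h[of n] ne that by simp
    then show ?thesis using B that by (simp add: q_def)
  qed
  have "(\<lambda>n. \<integral>x. q n x \<partial>lborel) \<longlonglongrightarrow> (\<integral>x. G x $ i \<partial>lborel)"
  proof (rule integral_dominated_convergence[where w="\<lambda>x. K * indicator (cball 0 (B + 1)) x"])
    show "integrable lborel (\<lambda>x::real^'n. K * indicator (cball 0 (B + 1)) x)"
      using emeasure_bounded_finite[OF bounded_cball[of "0::real^'n" "B+1"]]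
      by (intro integrable_mult_right integrable_real_indicator) auto
    show "AE x in lborel. norm (q n x) \<le> K * indicator (cball 0 (B + 1)) x" for n
      using qK[of n] q0[of _ n] by (intro AE_I2) (auto simp: indicator_def not_le)
    show "AE x in lborel. (\<lambda>n. q n x) \<longlonglongrightarrow> G x $ i"
    proof (rule AE_I2)
      fix x
      have "((\<lambda>t. (w (x + (0 + t) *\<^sub>R e) - w (x + 0 *\<^sub>R e)) / t) \<longlongrightarrow> G (x + 0 *\<^sub>R e) $ i) (at 0)"
        using D[of x 0] unfolding DERIV_def .
      moreover have "filterlim h (at 0) sequentially"
        using LIMSEQ_Suc[OF lim_1_over_n[where 'a=real]] by (auto simp: h_def[abs_def] filterlim_at)
      ultimately show "(\<lambda>n. q n x) \<longlonglongrightarrow> G x $ i"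
        unfolding q_def by (auto dest: filterlim_compose)
    qed
  qed (auto simp: q_def[abs_def])
  moreover have "(\<integral>x. q n x \<partial>lborel) = 0" for n
  proof -
    have "(\<integral>x. w (h n *\<^sub>R e + x) \<partial>lborel) = (\<integral>x. w x \<partial>distr lborel borel ((+) (h n *\<^sub>R e)))"
      by (subst integral_distr) auto
    then have eq: "(\<integral>x. w (h n *\<^sub>R e + x) \<partial>lborel) = (\<integral>x. w x \<partial>lborel)"
      by (simp add: lborel_distr_plus)
    have "integrable (distr lborel borel ((+) (h n *\<^sub>R e))) w"
      using csupp_integrable[OF w] by (simp add: lborel_distr_plus)
    then have "integrable lborel (\<lambda>x. w (h n *\<^sub>R e + x))"
      by (subst (asm) integrable_distr_eq) auto
    then show ?thesis
      unfolding q_def using eq csupp_integrable[OF w] by (simp add: add.commute)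
  qed
  ultimately show ?thesis by (simp add: LIMSEQ_const_iff)
qed

lemma test_csupp: "\<phi> \<in> test_functions \<Omega> \<Longrightarrow> csupp \<phi>"
proof -
  assume \<phi>: "\<phi> \<in> test_functions \<Omega>"
  then have "bounded {x. \<phi> x \<noteq> 0}"
    by (auto simp: test_functions_def intro: bounded_subset[OF compact_imp_bounded closure_subset])
  then obtain B where "\<And>x. \<phi> x \<noteq> 0 \<Longrightarrow> norm x \<le> B" by (auto simp: bounded_iff)
  moreover have "C_k 0 \<phi>" using \<phi> by (simp add: test_functions_def del: C_k.simps)
  ultimately show "csupp \<phi>" unfolding csupp_def by (auto simp: not_le[symmetric])
qed

lemma test_GDERIV: "\<phi> \<in> test_functions \<Omega> \<Longrightarrow> GDERIV \<phi> x :> grad \<phi> x"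
proof -
  assume "\<phi> \<in> test_functions \<Omega>"
  then have "C_k 1 \<phi>" by (simp add: test_functions_def del: C_k.simps)
  then show ?thesis by (auto intro: GDERIV_grad)
qed

lemma grad_0_off_support:
  assumes "x \<notin> closure {x. \<phi> x \<noteq> 0}" shows "grad \<phi> x = 0"
proof -
  have "\<forall>\<^sub>F y in nhds x. y \<in> - closure {x. \<phi> x \<noteq> 0}"
    using assms by (intro eventually_nhds_in_open) auto
  then have ev: "\<forall>\<^sub>F y in nhds x. 0 = \<phi> y"
  proof eventually_elim
    case (elim y)
    then show ?case using closure_subset[of "{x. \<phi> x \<noteq> 0}"] by auto
  qed
  show ?thesis by (rule grad_eqI[OF GDERIV_cong_ev[OF GDERIV_const ev]])
qed

lemma test_grad:
  assumes \<phi>: "\<phi> \<in> test_functions \<Omega>" shows "(\<lambda>x. grad \<phi> x $ i) \<in> test_functions \<Omega>"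
proof -
  have "C_k (Suc k) \<phi>" for k using \<phi> by (simp add: test_functions_def del: C_k.simps)
  then have ck: "C_k k (\<lambda>x. grad \<phi> x $ i)" for k by simp
  have "{x. grad \<phi> x $ i \<noteq> 0} \<subseteq> closure {x. \<phi> x \<noteq> 0}"
    using grad_0_off_support[of _ \<phi>] by force
  then have "closure {x. grad \<phi> x $ i \<noteq> 0} \<subseteq> closure {x. \<phi> x \<noteq> 0}"
    by (rule closure_minimal) simp
  moreover have "compact (closure {x. grad \<phi> x $ i \<noteq> 0})"
    using calculation \<phi> by (auto simp: test_functions_def compact_eq_bounded_closed intro: bounded_subset)
  moreover have "closure {x. \<phi> x \<noteq> 0} \<subseteq> \<Omega>" using \<phi> by (simp add: test_functions_def)
  ultimately show ?thesis unfolding test_functions_def using ck by blast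
qed

lemma test_0_off: "\<phi> \<in> test_functions \<Omega> \<Longrightarrow> x \<notin> \<Omega> \<Longrightarrow> \<phi> x = 0"
  unfolding test_functions_def using closure_subset[of "{x. \<phi> x \<noteq> 0}"] by blast

lemma test_laplacian_sqint:
  "\<phi> \<in> test_functions \<Omega> \<Longrightarrow> laplacian \<phi> \<in> sqint"
  unfolding laplacian_def[abs_def]
  by (intro sqint_sum csupp_sqint test_csupp[of _ \<Omega>] test_grad)

lemma laplacian_0_off: "\<phi> \<in> test_functions \<Omega> \<Longrightarrow> x \<notin> \<Omega> \<Longrightarrow> laplacian \<phi> x = 0"
  unfolding laplacian_def by (intro sum.neutral ballI test_0_off[of _ \<Omega>] test_grad)

text \<open>Componentwise integration by parts: the i-th partial derivative of \<open>\<phi>\<close>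
  times the i-th partial derivative of \<open>\<psi>\<close> has integral zero.\<close>

lemma green:
  assumes \<phi>: "\<phi> \<in> test_functions \<Omega>" and \<psi>: "\<psi> \<in> test_functions \<Omega>"
  shows "(\<integral>x. \<phi> x * - laplacian \<psi> x \<partial>lebesgue) = (\<Sum>i\<in>UNIV. \<integral>x. grad \<phi> x $ i * grad \<psi> x $ i \<partial>lebesgue)"
proof -
  have parts: "(\<integral>x. \<phi> x * - (grad (\<lambda>y. grad \<psi> y $ i) x $ i) \<partial>lebesgue) = (\<integral>x. grad \<phi> x $ i * grad \<psi> x $ i \<partial>lebesgue)"
    and int: "integrable lebesgue (\<lambda>x. \<phi> x * - (grad (\<lambda>y. grad \<psi> y $ i) x $ i))" for i
  proof -
    let ?p = "\<lambda>y. grad \<psi> y $ i"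
    have p: "?p \<in> test_functions \<Omega>" "(\<lambda>x. grad ?p x $ i) \<in> test_functions \<Omega>" "(\<lambda>x. grad \<phi> x $ i) \<in> test_functions \<Omega>"
      by (intro test_grad \<phi> \<psi>)+
    have c1: "csupp (\<lambda>x. \<phi> x * grad ?p x $ i)" and c2: "csupp (\<lambda>x. grad \<phi> x $ i * ?p x)"
      by (intro csupp_mult test_csupp[OF \<phi>] test_csupp[OF p(1)] test_csupp[OF p(2)] test_csupp[OF p(3)])+
    have "(\<integral>x. (\<phi> x *\<^sub>R grad ?p x + ?p x *\<^sub>R grad \<phi> x) $ i \<partial>lborel) = 0"
    proof (rule integral_partial_derivative_0[where w="\<lambda>x. \<phi> x * ?p x"])
      show "csupp (\<lambda>x. \<phi> x * ?p x)" by (intro csupp_mult test_csupp[OF \<phi>] test_csupp[OF p(1)])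
      show "GDERIV (\<lambda>x. \<phi> x * ?p x) x :> \<phi> x *\<^sub>R grad ?p x + ?p x *\<^sub>R grad \<phi> x" for x
        by (intro GDERIV_mult test_GDERIV[OF \<phi>] test_GDERIV[OF p(1)])
      show "csupp (\<lambda>x. (\<phi> x *\<^sub>R grad ?p x + ?p x *\<^sub>R grad \<phi> x) $ i)"
        using csupp_add[OF c1 c2] by (simp add: mult.commute)
    qed
    then have "(\<integral>x. \<phi> x * grad ?p x $ i \<partial>lborel) = - (\<integral>x. grad \<phi> x $ i * ?p x \<partial>lborel)"
      using csupp_integrable[OF c1] csupp_integrable[OF c2] by (simp add: mult.commute)
    then show "(\<integral>x. \<phi> x * - (grad ?p x $ i) \<partial>lebesgue) = (\<integral>x. grad \<phi> x $ i * ?p x \<partial>lebesgue)"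
      using csupp_borel[OF c1] csupp_borel[OF c2] by (simp add: integral_completion)
    show "integrable lebesgue (\<lambda>x. \<phi> x * - (grad ?p x $ i))"
      using csupp_integrable[OF c1] csupp_borel[OF c1] by (simp add: integrable_completion)
  qed
  have "(\<integral>x. \<phi> x * - laplacian \<psi> x \<partial>lebesgue) = (\<integral>x. (\<Sum>i\<in>UNIV. \<phi> x * - (grad (\<lambda>y. grad \<psi> y $ i) x $ i)) \<partial>lebesgue)"
    unfolding laplacian_def by (simp add: sum_distrib_left sum_negf)
  also have "\<dots> = (\<Sum>i\<in>UNIV. \<integral>x. grad \<phi> x $ i * grad \<psi> x $ i \<partial>lebesgue)"
    by (subst Bochner_Integration.integral_sum) (simp_all only: int parts)
  finally show ?thesis .
qed

section \<open>The semigroup on the Hilbert space\<close>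

lemma Lp_norm_2:
  "Lp_norm M 2 f = (let I = (\<integral>\<^sup>+x. ennreal ((norm (f x))\<^sup>2) \<partial>M) in if I = \<infinity> then \<infinity> else ennreal (sqrt (enn2real I)))"
proof -
  have "enn2real 2 = 2" by (metis enn2real_ennreal ennreal_numeral zero_le_numeral)
  then show ?thesis
    by (simp add: Lp_norm_def powr_half_sqrt Let_def)
qed

lemma Lp_norm_2_le:
  assumes "(\<integral>\<^sup>+x. ennreal ((norm (f x))\<^sup>2) \<partial>M) \<le> ennreal (e\<^sup>2)" "0 \<le> e"
  shows "Lp_norm M 2 f \<le> ennreal e"
proof -
  let ?I = "\<integral>\<^sup>+x. ennreal ((norm (f x))\<^sup>2) \<partial>M"
  have "?I \<noteq> \<infinity>" using assms(1) by (auto simp: top_unique)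
  moreover have "enn2real ?I \<le> e\<^sup>2" using assms(1) by (intro enn2real_leI) auto
  then have "sqrt (enn2real ?I) \<le> e" using assms(2) real_le_lsqrt by simp
  ultimately show ?thesis by (simp add: Lp_norm_2 ennreal_leI)
qed

lemma Lp_norm_2_mono:
  assumes "AE x in M. norm (f x) \<le> norm (g x)"
  shows "Lp_norm M 2 f \<le> Lp_norm M 2 g"
proof -
  have "(\<integral>\<^sup>+x. ennreal ((norm (f x))\<^sup>2) \<partial>M) \<le> (\<integral>\<^sup>+x. ennreal ((norm (g x))\<^sup>2) \<partial>M)"
    using assms by (intro nn_integral_mono_AE) (auto elim!: eventually_mono intro!: ennreal_leI power_mono)
  then show ?thesis
    by (auto simp: Lp_norm_2 Let_def top_unique less_top intro!: ennreal_leI real_sqrt_le_mono enn2real_mono)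
qed

text \<open>The indicator discards the values off \<Omega>, which carry no information in the
  representation of functions on \<Omega>.\<close>

definition emb :: "'a::euclidean_space set \<Rightarrow> ('a \<Rightarrow> real) \<Rightarrow> 'a l2" where
  "emb \<Omega> f = l2_of (\<lambda>x. indicator \<Omega> x * f x)"

locale domain =
  fixes \<Omega> :: "'a::euclidean_space set"
  assumes \<Omega>: "open \<Omega>"
begin

abbreviation "M \<equiv> lebesgue_on \<Omega>"

lemma \<Omega>_sets [measurable, simp]: "\<Omega> \<in> sets lebesgue"
  using \<Omega> by auto

lemma nn_M: "(\<integral>\<^sup>+x. ennreal ((norm (f x))\<^sup>2) \<partial>M) = (\<integral>\<^sup>+x. ennreal ((indicator \<Omega> x * f x)\<^sup>2) \<partial>lebesgue)" for f :: "'a \<Rightarrow> real"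
  by (subst nn_integral_restrict_space) (auto intro!: nn_integral_cong split: split_indicator)

lemma measurable_M_iff:
  "f \<in> borel_measurable M \<longleftrightarrow> (\<lambda>x. indicator \<Omega> x * f x) \<in> borel_measurable lebesgue" for f :: "'a \<Rightarrow> real"
  by (subst borel_measurable_restrict_space_iff) auto

lemma AE_M: "(AE x in M. P x) \<longleftrightarrow> (AE x in lebesgue. x \<in> \<Omega> \<longrightarrow> P x)"
  by (rule AE_restrict_space_iff) simp

lemma Lp2_iff: "f \<in> Lp_space M 2 \<longleftrightarrow> (\<lambda>x. indicator \<Omega> x * f x) \<in> sqint" for f :: "'a \<Rightarrow> real"
proof
  assume "f \<in> Lp_space M 2"
  then show "(\<lambda>x. indicator \<Omega> x * f x) \<in> sqint"
    unfolding Lp_space_def measurable_M_iff Lp_norm_2 nn_M Let_def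
    by (intro sqint_nnI) (auto simp: less_top split: if_splits)
next
  assume s: "(\<lambda>x. indicator \<Omega> x * f x) \<in> sqint"
  show "f \<in> Lp_space M 2"
    unfolding Lp_space_def measurable_M_iff Lp_norm_2 nn_M Let_def
    using sqint_measurable[OF s] nn_norm_l2_of[OF s] by simp
qed

lemma Lp_norm_emb: "f \<in> Lp_space M 2 \<Longrightarrow> Lp_norm M 2 f = ennreal (norm (emb \<Omega> f))" for f :: "'a \<Rightarrow> real"
  unfolding Lp2_iff Lp_norm_2 nn_M Let_def emb_def by (simp add: nn_norm_l2_of)

lemma Lp2_lin: "f \<in> Lp_space M 2 \<Longrightarrow> g \<in> Lp_space M 2 \<Longrightarrow> (\<lambda>x. a * f x + b * g x) \<in> Lp_space M 2" for f g :: "'a \<Rightarrow> real"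
  unfolding Lp2_iff using sqint_add[OF sqint_scale[of "\<lambda>x. indicator \<Omega> x * f x" a] sqint_scale[of "\<lambda>x. indicator \<Omega> x * g x" b]]
  by (simp add: algebra_simps)

lemma emb_lin:
  fixes f g :: "'a \<Rightarrow> real"
  assumes "f \<in> Lp_space M 2" "g \<in> Lp_space M 2"
  shows "emb \<Omega> (\<lambda>x. a * f x + b * g x) = a *\<^sub>R emb \<Omega> f + b *\<^sub>R emb \<Omega> g"
  using assms unfolding Lp2_iff emb_def
  by (simp add: l2_of_scale l2_of_add sqint_scale algebra_simps)

lemma Lp2_diff: "f \<in> Lp_space M 2 \<Longrightarrow> g \<in> Lp_space M 2 \<Longrightarrow> (\<lambda>x. f x - g x) \<in> Lp_space M 2" for f g :: "'a \<Rightarrow> real"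
  using Lp2_lin[of f g 1 "-1"] by simp

lemma emb_diff: "f \<in> Lp_space M 2 \<Longrightarrow> g \<in> Lp_space M 2 \<Longrightarrow> emb \<Omega> (\<lambda>x. f x - g x) = emb \<Omega> f - emb \<Omega> g" for f g :: "'a \<Rightarrow> real"
  using emb_lin[of f g 1 "-1"] by simp

lemma emb_eq_iff:
  fixes f g :: "'a \<Rightarrow> real"
  assumes "f \<in> Lp_space M 2" "g \<in> Lp_space M 2"
  shows "emb \<Omega> f = emb \<Omega> g \<longleftrightarrow> (AE x in M. f x = g x)"
  using assms unfolding Lp2_iff emb_def AE_M
  by (subst l2_of_eq_iff) (auto intro!: AE_cong split: split_indicator)

lemma fun_of_Lp2: "fun_of F \<in> Lp_space M 2"
  unfolding Lp2_iff
proof (rule sqint_bound[OF fun_of_sqint])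
  show "(\<lambda>x. indicator \<Omega> x * fun_of F x) \<in> borel_measurable lebesgue"
    using sqint_measurable[OF fun_of_sqint, of F] by measurable
qed (auto split: split_indicator)

lemma norm_emb_fun_of: "norm (emb \<Omega> (fun_of F)) \<le> norm F"
proof -
  have s: "(\<lambda>x. indicator \<Omega> x * fun_of F x) \<in> sqint" using fun_of_Lp2 by (simp add: Lp2_iff)
  have "(norm (emb \<Omega> (fun_of F)))\<^sup>2 \<le> (norm (l2_of (fun_of F)))\<^sup>2"
    unfolding emb_def norm_l2_of[OF s] norm_l2_of[OF fun_of_sqint]
    using s fun_of_sqint[of F] by (intro integral_mono) (auto simp: sqint_def split: split_indicator)
  then show ?thesis unfolding l2_of_fun_of by (rule power2_le_imp_le) simp
qed

lemma emb_fun_of_emb: "f \<in> Lp_space M 2 \<Longrightarrow> emb \<Omega> (fun_of (emb \<Omega> f)) = emb \<Omega> f"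
proof -
  assume f: "f \<in> Lp_space M 2"
  have "AE x in lebesgue. fun_of (emb \<Omega> f) x = indicator \<Omega> x * f x"
    unfolding emb_def by (rule fun_of_l2_of) (use f in \<open>simp add: Lp2_iff\<close>)
  then have "AE x in M. fun_of (emb \<Omega> f) x = f x" unfolding AE_M by eventually_elim auto
  then show ?thesis using emb_eq_iff[OF fun_of_Lp2 f] by simp
qed

lemma Lp_norm_tendsto_iff:
  fixes f :: "'b \<Rightarrow> 'a \<Rightarrow> real"
  assumes "\<And>n. f n \<in> Lp_space M 2" "g \<in> Lp_space M 2"
  shows "((\<lambda>n. Lp_norm M 2 (\<lambda>x. f n x - g x)) \<longlongrightarrow> 0) F \<longleftrightarrow> ((\<lambda>n. emb \<Omega> (f n)) \<longlongrightarrow> emb \<Omega> g) F"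
proof -
  have eq: "Lp_norm M 2 (\<lambda>x. f n x - g x) = ennreal (norm (emb \<Omega> (f n) - emb \<Omega> g))" for n
    using assms by (simp add: Lp_norm_emb Lp2_diff emb_diff)
  have "((\<lambda>n. emb \<Omega> (f n)) \<longlongrightarrow> emb \<Omega> g) F \<longleftrightarrow> ((\<lambda>n. norm (emb \<Omega> (f n) - emb \<Omega> g)) \<longlongrightarrow> 0) F"
    by (metis LIM_zero_iff tendsto_norm_zero_iff)
  also have "\<dots> \<longleftrightarrow> ((\<lambda>n. ennreal (norm (emb \<Omega> (f n) - emb \<Omega> g))) \<longlongrightarrow> ennreal 0) F"
    by (subst tendsto_ennreal_iff) auto
  finally show ?thesis by (simp add: eq)
qed

lemma inner_emb:
  fixes f g :: "'a \<Rightarrow> real"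
  assumes "f \<in> Lp_space M 2" "g \<in> Lp_space M 2"
  shows "inner (emb \<Omega> f) (emb \<Omega> g) = (\<integral>x. f x * g x \<partial>M)"
proof -
  have "inner (emb \<Omega> f) (emb \<Omega> g) = (\<integral>x. indicator \<Omega> x *\<^sub>R (f x * g x) \<partial>lebesgue)"
    using assms unfolding Lp2_iff emb_def
    by (subst inner_l2_of) (auto intro!: Bochner_Integration.integral_cong split: split_indicator)
  also have "\<dots> = (\<integral>x. f x * g x \<partial>M)" by (subst integral_restrict_space) auto
  finally show ?thesis .
qed

text \<open>\<open>fun_of\<close> picks an arbitrary representative; \<open>S_cong\<close> shows
  that the choice does not affect the class of the result.\<close>

definition semi :: "(real \<Rightarrow> ('a \<Rightarrow> real) \<Rightarrow> 'a \<Rightarrow> real) \<Rightarrow> real \<Rightarrow> 'a l2 \<Rightarrow> 'a l2" where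
  "semi S t F = emb \<Omega> (S t (fun_of F))"

context
  fixes S :: "real \<Rightarrow> ('a \<Rightarrow> real) \<Rightarrow> 'a \<Rightarrow> real"
  assumes S: "C0_semigroup_L2 M S"
begin

lemma S_Lp2: "0 \<le> t \<Longrightarrow> f \<in> Lp_space M 2 \<Longrightarrow> S t f \<in> Lp_space M 2"
  using S by (simp add: C0_semigroup_L2_def)

lemma S_lin:
  assumes "0 \<le> t" "f \<in> Lp_space M 2" "g \<in> Lp_space M 2"
  shows "emb \<Omega> (S t (\<lambda>x. a * f x + b * g x)) = a *\<^sub>R emb \<Omega> (S t f) + b *\<^sub>R emb \<Omega> (S t g)"
proof -
  have "AE x in M. S t (\<lambda>y. a * f y + b * g y) x = a * S t f x + b * S t g x"
    using S assms by (simp add: C0_semigroup_L2_def)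
  then have "emb \<Omega> (S t (\<lambda>x. a * f x + b * g x)) = emb \<Omega> (\<lambda>x. a * S t f x + b * S t g x)"
    using assms by (subst emb_eq_iff) (auto intro!: S_Lp2 Lp2_lin)
  then show ?thesis using assms by (simp add: emb_lin S_Lp2)
qed

lemma S_bound:
  assumes "0 \<le> t" shows "\<exists>C\<ge>0. \<forall>f\<in>Lp_space M 2. norm (emb \<Omega> (S t f)) \<le> C * norm (emb \<Omega> f)"
proof -
  obtain C :: real where C: "\<And>f. f \<in> Lp_space M 2 \<Longrightarrow> Lp_norm M 2 (S t f) \<le> ennreal C * Lp_norm M 2 f"
    using S assms unfolding C0_semigroup_L2_def by meson
  have "norm (emb \<Omega> (S t f)) \<le> max 0 C * norm (emb \<Omega> f)" if f: "f \<in> Lp_space M 2" for f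
  proof -
    have "ennreal (norm (emb \<Omega> (S t f))) \<le> ennreal C * ennreal (norm (emb \<Omega> f))"
      using C[OF f] f assms by (simp add: Lp_norm_emb S_Lp2)
    also have "\<dots> \<le> ennreal (max 0 C) * ennreal (norm (emb \<Omega> f))"
      by (intro mult_right_mono ennreal_leI) auto
    also have "\<dots> = ennreal (max 0 C * norm (emb \<Omega> f))"
      by (rule ennreal_mult[symmetric]) auto
    finally show ?thesis by (simp add: mult_nonneg_nonneg)
  qed
  then show ?thesis by (intro exI[of _ "max 0 C"]) auto
qed

text \<open>\<open>C0_semigroup_L2\<close> does not state that \<open>S t\<close> respects equality
  almost everywhere. It follows from linearity and the norm bound, applied to the difference of the
  two functions.\<close>

lemma S_cong:
  assumes "0 \<le> t" "f \<in> Lp_space M 2" "g \<in> Lp_space M 2" "emb \<Omega> f = emb \<Omega> g"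
  shows "emb \<Omega> (S t f) = emb \<Omega> (S t g)"
proof -
  obtain C where C: "\<forall>f\<in>Lp_space M 2. norm (emb \<Omega> (S t f)) \<le> C * norm (emb \<Omega> f)"
    using S_bound[OF assms(1)] by blast
  have "norm (emb \<Omega> (S t (\<lambda>x. 1 * f x + (-1) * g x))) \<le> C * norm (emb \<Omega> (\<lambda>x. 1 * f x + (-1) * g x))"
    using C Lp2_lin[OF assms(2,3)] by blast
  then show ?thesis unfolding S_lin[OF assms(1-3)] emb_lin[OF assms(2,3)] using assms(4) by simp
qed

lemma semi_emb: "0 \<le> t \<Longrightarrow> f \<in> Lp_space M 2 \<Longrightarrow> semi S t (emb \<Omega> f) = emb \<Omega> (S t f)"
  unfolding semi_def by (intro S_cong fun_of_Lp2 emb_fun_of_emb)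

lemma semi_0: "semi S 0 F = emb \<Omega> (fun_of F)"
  unfolding semi_def using S
  by (subst emb_eq_iff) (auto intro!: S_Lp2 fun_of_Lp2 simp: C0_semigroup_L2_def)

lemma semi_bounded_linear:
  assumes t: "0 \<le> t" shows "bounded_linear (semi S t)"
proof -
  obtain C where C: "C \<ge> 0" "\<forall>f\<in>Lp_space M 2. norm (emb \<Omega> (S t f)) \<le> C * norm (emb \<Omega> f)"
    using S_bound[OF t] by blast
  have lin: "semi S t (a *\<^sub>R F + b *\<^sub>R G) = a *\<^sub>R semi S t F + b *\<^sub>R semi S t G" for a b F G
  proof -
    have "a *\<^sub>R F + b *\<^sub>R G = l2_of (\<lambda>x. a * fun_of F x + b * fun_of G x)"
      by (subst l2_of_add[symmetric]) (auto intro!: sqint_scale simp: l2_of_scale[symmetric] fun_of_sqint l2_of_fun_of)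
    then have "AE x in lebesgue. fun_of (a *\<^sub>R F + b *\<^sub>R G) x = a * fun_of F x + b * fun_of G x"
      by (auto intro!: fun_of_l2_of sqint_add sqint_scale fun_of_sqint)
    then have "emb \<Omega> (fun_of (a *\<^sub>R F + b *\<^sub>R G)) = emb \<Omega> (\<lambda>x. a * fun_of F x + b * fun_of G x)"
      by (subst emb_eq_iff) (auto intro!: fun_of_Lp2 Lp2_lin simp: AE_M)
    then have "semi S t (a *\<^sub>R F + b *\<^sub>R G) = emb \<Omega> (S t (\<lambda>x. a * fun_of F x + b * fun_of G x))"
      unfolding semi_def using t by (intro S_cong fun_of_Lp2 Lp2_lin)
    then show ?thesis using t by (simp add: S_lin fun_of_Lp2 semi_def)
  qed
  show ?thesis
  proof (rule bounded_linear_intro)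
    show "semi S t (F + G) = semi S t F + semi S t G" for F G using lin[of 1 F 1 G] by simp
    show "semi S t (a *\<^sub>R F) = a *\<^sub>R semi S t F" for a F using lin[of a F 0 F] by simp
    show "norm (semi S t F) \<le> norm F * C" for F
    proof -
      have "norm (semi S t F) \<le> C * norm (emb \<Omega> (fun_of F))" using C fun_of_Lp2 by (simp add: semi_def)
      also have "\<dots> \<le> C * norm F" using C norm_emb_fun_of by (intro mult_left_mono)
      finally show ?thesis by (simp add: mult.commute)
    qed
  qed
qed

lemma semi_C0: "C0_semigroup (semi S)"
proof (rule C0_semigroup.intro)
  show "bounded_linear (semi S t)" if "0 \<le> t" for t by (rule semi_bounded_linear[OF that])
  show "semi S (s + t) F = semi S s (semi S t F)" if "0 \<le> s" "0 \<le> t" for s t F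
  proof -
    have "AE x in M. S (s + t) (fun_of F) x = S s (S t (fun_of F)) x"
      using S that fun_of_Lp2 by (simp add: C0_semigroup_L2_def)
    then have "semi S (s + t) F = emb \<Omega> (S s (S t (fun_of F)))"
      unfolding semi_def using that by (subst emb_eq_iff) (auto intro!: S_Lp2 fun_of_Lp2)
    also have "\<dots> = semi S s (emb \<Omega> (S t (fun_of F)))"
      using that by (subst semi_emb) (auto intro!: S_Lp2 fun_of_Lp2)
    finally show ?thesis by (simp add: semi_def)
  qed
  show "((\<lambda>h. semi S h F) \<longlongrightarrow> semi S 0 F) (at_right 0)" for F
  proof -
    have eq: "Lp_norm M 2 (\<lambda>x. S h (fun_of F) x - fun_of F x) = ennreal (norm (semi S h F - semi S 0 F))" if "0 \<le> h" for h
      using that by (simp add: Lp_norm_emb Lp2_diff S_Lp2 fun_of_Lp2 emb_diff semi_0) (simp add: semi_def)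
    have "((\<lambda>h. Lp_norm M 2 (\<lambda>x. S h (fun_of F) x - fun_of F x)) \<longlongrightarrow> 0) (at_right 0)"
      using S fun_of_Lp2 by (simp add: C0_semigroup_L2_def)
    then have "((\<lambda>h. ennreal (norm (semi S h F - semi S 0 F))) \<longlongrightarrow> ennreal 0) (at_right 0)"
      by (simp, rule Lim_transform_eventually)
         (auto simp: eventually_at_right_field eq intro!: exI[of _ 1])
    then have "((\<lambda>h. norm (semi S h F - semi S 0 F)) \<longlongrightarrow> 0) (at_right 0)"
      by (subst (asm) tendsto_ennreal_iff) auto
    then show ?thesis by (simp add: LIM_zero_iff tendsto_norm_zero_iff)
  qed
qed

interpretation C0_semigroup "semi S" by (rule semi_C0)

lemma gen_emb_iff:
  assumes "u \<in> Lp_space M 2" "w \<in> Lp_space M 2"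
  shows "gen (emb \<Omega> u) (emb \<Omega> w) \<longleftrightarrow> generator_L2 M S u w"
proof -
  have 0: "semi S 0 (emb \<Omega> u) = emb \<Omega> u" using assms by (simp add: semi_0 emb_fun_of_emb)
  have L: "(\<lambda>x. (S h u x - u x) / h) \<in> Lp_space M 2" if "0 \<le> h" for h
    using Lp2_lin[OF S_Lp2[OF that assms(1)] assms(1), of "1/h" "-(1/h)"] by (simp add: diff_divide_distrib)
  have E: "emb \<Omega> (\<lambda>x. (S h u x - u x) / h) = (semi S h (emb \<Omega> u) - emb \<Omega> u) /\<^sub>R h" if "0 \<le> h" for h
    using emb_lin[OF S_Lp2[OF that assms(1)] assms(1), of "1/h" "-(1/h)"] semi_emb[OF that assms(1)]
    by (simp add: diff_divide_distrib scaleR_diff_right divide_inverse_commute right_diff_distrib)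
  have eq: "Lp_norm M 2 (\<lambda>x. (S h u x - u x) / h - w x) = ennreal (norm ((semi S h (emb \<Omega> u) - emb \<Omega> u) /\<^sub>R h - emb \<Omega> w))"
    if "0 \<le> h" for h
    using that assms by (simp add: Lp_norm_emb Lp2_diff L emb_diff E)
  have "generator_L2 M S u w \<longleftrightarrow> ((\<lambda>h. Lp_norm M 2 (\<lambda>x. (S h u x - u x) / h - w x)) \<longlongrightarrow> 0) (at_right 0)"
    using assms by (simp add: generator_L2_def)
  also have "\<dots> \<longleftrightarrow> ((\<lambda>h. ennreal (norm ((semi S h (emb \<Omega> u) - emb \<Omega> u) /\<^sub>R h - emb \<Omega> w))) \<longlongrightarrow> ennreal 0) (at_right 0)"
    unfolding ennreal_0
    by (rule tendsto_cong) (auto simp: eventually_at_right_field eq intro!: exI[of _ 1])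
  also have "\<dots> \<longleftrightarrow> ((\<lambda>h. norm ((semi S h (emb \<Omega> u) - emb \<Omega> u) /\<^sub>R h - emb \<Omega> w)) \<longlongrightarrow> 0) (at_right 0)"
    by (rule tendsto_ennreal_iff) auto
  also have "\<dots> \<longleftrightarrow> gen (emb \<Omega> u) (emb \<Omega> w)"
    by (simp add: gen_def 0 tendsto_norm_zero_iff LIM_zero_iff)
  finally show ?thesis by simp
qed

end

end

section \<open>Symmetry and the heat kernel\<close>

locale vdomain = domain \<Omega> for \<Omega> :: "(real ^ 'n) set"
begin

lemma test_ext: "\<phi> \<in> test_functions \<Omega> \<Longrightarrow> (\<lambda>x. indicator \<Omega> x * \<phi> x) = \<phi>"
  using test_0_off by (fastforce split: split_indicator)

lemma test_emb: "\<phi> \<in> test_functions \<Omega> \<Longrightarrow> emb \<Omega> \<phi> = l2_of \<phi>"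
  by (simp add: emb_def test_ext)

lemma test_Lp2: "\<phi> \<in> test_functions \<Omega> \<Longrightarrow> \<phi> \<in> Lp_space M 2"
  by (simp add: Lp2_iff test_ext csupp_sqint test_csupp)

lemma Lp2_component:
  fixes g :: "real ^ 'n \<Rightarrow> real ^ 'n"
  assumes "g \<in> Lp_space M 2" shows "(\<lambda>x. g x $ i) \<in> Lp_space M 2"
proof -
  have "Lp_norm M 2 (\<lambda>x. g x $ i) \<le> Lp_norm M 2 g"
    by (rule Lp_norm_2_mono) (simp add: component_le_norm_cart)
  moreover have "(\<lambda>x. g x $ i) \<in> borel_measurable M"
  proof -
    have "g \<in> borel_measurable M" using assms by (simp add: Lp_space_def)
    then have "(\<lambda>x. inner (g x) (axis i 1)) \<in> borel_measurable M" by measurable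
    then show ?thesis by (simp add: inner_axis)
  qed
  ultimately show ?thesis using assms by (simp add: Lp_space_def less_top[symmetric]) (metis top_unique)
qed

lemma laplacian_Lp2: "\<phi> \<in> test_functions \<Omega> \<Longrightarrow> (\<lambda>x. - laplacian \<phi> x) \<in> Lp_space M 2"
proof -
  assume \<phi>: "\<phi> \<in> test_functions \<Omega>"
  have "(\<lambda>x. indicator \<Omega> x * - laplacian \<phi> x) = (\<lambda>x. - laplacian \<phi> x)"
    using laplacian_0_off[OF \<phi>] by (auto simp: fun_eq_iff split: split_indicator)
  then show ?thesis unfolding Lp2_iff using sqint_uminus[OF test_laplacian_sqint[OF \<phi>]] by simp
qed

lemma inner_test:
  assumes "\<phi> \<in> test_functions \<Omega>" "\<psi> \<in> test_functions \<Omega>"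
  shows "inner (emb \<Omega> \<phi>) (emb \<Omega> \<psi>) = (\<integral>x. \<phi> x * \<psi> x \<partial>lebesgue)"
  using assms by (simp add: test_emb inner_l2_of csupp_sqint[OF test_csupp])

lemma green_emb:
  assumes "\<phi> \<in> test_functions \<Omega>" "\<psi> \<in> test_functions \<Omega>"
  shows "inner (emb \<Omega> \<phi>) (emb \<Omega> (\<lambda>x. - laplacian \<psi> x)) =
    (\<Sum>i\<in>UNIV. inner (emb \<Omega> (\<lambda>x. grad \<phi> x $ i)) (emb \<Omega> (\<lambda>x. grad \<psi> x $ i)))"
proof -
  have "emb \<Omega> (\<lambda>x. - laplacian \<psi> x) = l2_of (\<lambda>x. - laplacian \<psi> x)"
    unfolding emb_def using laplacian_0_off[OF assms(2)] by (intro arg_cong[where f=l2_of]) (auto split: split_indicator)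
  then have "inner (emb \<Omega> \<phi>) (emb \<Omega> (\<lambda>x. - laplacian \<psi> x)) = (\<integral>x. \<phi> x * - laplacian \<psi> x \<partial>lebesgue)"
    by (simp only: test_emb[OF assms(1)]
        inner_l2_of[OF csupp_sqint[OF test_csupp[OF assms(1)]] sqint_uminus[OF test_laplacian_sqint[OF assms(2)]]])
  also have "\<dots> = (\<Sum>i\<in>UNIV. inner (emb \<Omega> (\<lambda>x. grad \<phi> x $ i)) (emb \<Omega> (\<lambda>x. grad \<psi> x $ i)))"
    unfolding green[OF assms] by (intro sum.cong refl inner_test[symmetric] test_grad assms)
  finally show ?thesis .
qed

text \<open>The vector-valued gradients are split into components, so that their convergence takes
  place in the scalar space \<open>l2\<close>.\<close>

lemma H10_E:
  assumes "u \<in> H10 \<Omega>"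
  obtains \<phi> g where "\<And>n::nat. \<phi> n \<in> test_functions \<Omega>" "g \<in> Lp_space M 2"
    "(\<lambda>n. emb \<Omega> (\<phi> n)) \<longlonglongrightarrow> emb \<Omega> u"
    "\<And>i. (\<lambda>n. emb \<Omega> (\<lambda>x. grad (\<phi> n) x $ i)) \<longlonglongrightarrow> emb \<Omega> (\<lambda>x. g x $ i)"
proof -
  obtain \<phi> g where u: "u \<in> Lp_space M 2" and g: "g \<in> Lp_space M 2" and \<phi>: "\<And>n::nat. \<phi> n \<in> test_functions \<Omega>"
    and 1: "(\<lambda>n. Lp_norm M 2 (\<lambda>x. \<phi> n x - u x)) \<longlonglongrightarrow> 0"
    and 2: "(\<lambda>n. Lp_norm M 2 (\<lambda>x. grad (\<phi> n) x - g x)) \<longlonglongrightarrow> 0"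
    using assms unfolding H10_def by blast
  have "(\<lambda>n. emb \<Omega> (\<lambda>x. grad (\<phi> n) x $ i)) \<longlonglongrightarrow> emb \<Omega> (\<lambda>x. g x $ i)" for i
  proof (subst Lp_norm_tendsto_iff[symmetric])
    show "(\<lambda>n. Lp_norm M 2 (\<lambda>x. grad (\<phi> n) x $ i - g x $ i)) \<longlonglongrightarrow> 0"
    proof (rule tendsto_sandwich[OF _ _ tendsto_const 2])
      show "\<forall>\<^sub>F n in sequentially. Lp_norm M 2 (\<lambda>x. grad (\<phi> n) x $ i - g x $ i) \<le> Lp_norm M 2 (\<lambda>x. grad (\<phi> n) x - g x)"
        by (intro always_eventually allI Lp_norm_2_mono AE_I2)
           (metis component_le_norm_cart real_norm_def vector_minus_component)
    qed simp
  qed (intro test_Lp2 test_grad \<phi> Lp2_component g)+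
  moreover have "(\<lambda>n. emb \<Omega> (\<phi> n)) \<longlonglongrightarrow> emb \<Omega> u"
    using 1 Lp_norm_tendsto_iff[of \<phi> u sequentially] test_Lp2[OF \<phi>] u by simp
  ultimately show ?thesis using that[of \<phi> g] \<phi> g by blast
qed

text \<open>Both sides equal the Dirichlet form, the sum of the inner products of the components of
  the weak gradients. Against a test function \<open>\<psi> n\<close> the weak equation moves the
  Laplacian onto \<open>\<psi> n\<close>; there \<open>u\<close> is approximated by test functions,
  Green's formula applies, and finally \<open>\<psi> n\<close> tends to \<open>u'\<close>.
  Exchanging the roles of the two pairs gives the other side.\<close>

lemma dirichlet_symmetric:
  assumes "dirichlet_laplacian \<Omega> u v" "dirichlet_laplacian \<Omega> u' v'"
  shows "inner (emb \<Omega> v) (emb \<Omega> u') = inner (emb \<Omega> u) (emb \<Omega> v')"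
proof -
  have form: "inner (emb \<Omega> v) (emb \<Omega> u') = (\<Sum>i\<in>UNIV. inner (emb \<Omega> (\<lambda>x. g x $ i)) (emb \<Omega> (\<lambda>x. g' x $ i)))"
    if d: "dirichlet_laplacian \<Omega> u v"
      and \<phi>: "\<And>n::nat. \<phi> n \<in> test_functions \<Omega>" "(\<lambda>n. emb \<Omega> (\<phi> n)) \<longlonglongrightarrow> emb \<Omega> u"
         "\<And>i. (\<lambda>n. emb \<Omega> (\<lambda>x. grad (\<phi> n) x $ i)) \<longlonglongrightarrow> emb \<Omega> (\<lambda>x. g x $ i)"
      and \<psi>: "\<And>n::nat. \<psi> n \<in> test_functions \<Omega>" "(\<lambda>n. emb \<Omega> (\<psi> n)) \<longlonglongrightarrow> emb \<Omega> u'"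
         "\<And>i. (\<lambda>n. emb \<Omega> (\<lambda>x. grad (\<psi> n) x $ i)) \<longlonglongrightarrow> emb \<Omega> (\<lambda>x. g' x $ i)"
    for u v u' g g' \<phi> \<psi>
  proof -
    have uv: "u \<in> Lp_space M 2" "v \<in> Lp_space M 2"
      using d by (auto simp: dirichlet_laplacian_def H10_def)
    have "inner (emb \<Omega> v) (emb \<Omega> (\<psi> n)) = (\<Sum>i\<in>UNIV. inner (emb \<Omega> (\<lambda>x. g x $ i)) (emb \<Omega> (\<lambda>x. grad (\<psi> n) x $ i)))" for n
    proof -
      have "inner (emb \<Omega> v) (emb \<Omega> (\<psi> n)) = inner (emb \<Omega> u) (emb \<Omega> (\<lambda>x. - laplacian (\<psi> n) x))"
        using d \<psi>(1)[of n] uv by (simp add: inner_emb test_Lp2 laplacian_Lp2 dirichlet_laplacian_def)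
      moreover have l1: "(\<lambda>m. inner (emb \<Omega> (\<phi> m)) (emb \<Omega> (\<lambda>x. - laplacian (\<psi> n) x))) \<longlonglongrightarrow>
          inner (emb \<Omega> u) (emb \<Omega> (\<lambda>x. - laplacian (\<psi> n) x))"
        by (intro tendsto_inner \<phi> tendsto_const)
      moreover have l2: "(\<lambda>m. inner (emb \<Omega> (\<phi> m)) (emb \<Omega> (\<lambda>x. - laplacian (\<psi> n) x))) \<longlonglongrightarrow>
          (\<Sum>i\<in>UNIV. inner (emb \<Omega> (\<lambda>x. g x $ i)) (emb \<Omega> (\<lambda>x. grad (\<psi> n) x $ i)))"
        unfolding green_emb[OF \<phi>(1) \<psi>(1)] by (intro tendsto_sum tendsto_inner \<phi> tendsto_const)
      ultimately show ?thesis using LIMSEQ_unique[OF l1 l2] by simp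
    qed
    then have "(\<lambda>n. inner (emb \<Omega> v) (emb \<Omega> (\<psi> n))) \<longlonglongrightarrow> (\<Sum>i\<in>UNIV. inner (emb \<Omega> (\<lambda>x. g x $ i)) (emb \<Omega> (\<lambda>x. g' x $ i)))"
      by (simp only:) (intro tendsto_sum tendsto_inner \<psi> tendsto_const)
    moreover have "(\<lambda>n. inner (emb \<Omega> v) (emb \<Omega> (\<psi> n))) \<longlonglongrightarrow> inner (emb \<Omega> v) (emb \<Omega> u')"
      by (intro tendsto_inner \<psi> tendsto_const)
    ultimately show ?thesis using LIMSEQ_unique by blast
  qed
  have "u \<in> H10 \<Omega>" "u' \<in> H10 \<Omega>" using assms by (auto simp: dirichlet_laplacian_def)
  then obtain \<phi> g \<psi> g' where \<phi>: "\<And>n::nat. \<phi> n \<in> test_functions \<Omega>" "(\<lambda>n. emb \<Omega> (\<phi> n)) \<longlonglongrightarrow> emb \<Omega> u"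
         "\<And>i. (\<lambda>n. emb \<Omega> (\<lambda>x. grad (\<phi> n) x $ i)) \<longlonglongrightarrow> emb \<Omega> (\<lambda>x. g x $ i)"
      and \<psi>: "\<And>n::nat. \<psi> n \<in> test_functions \<Omega>" "(\<lambda>n. emb \<Omega> (\<psi> n)) \<longlonglongrightarrow> emb \<Omega> u'"
         "\<And>i. (\<lambda>n. emb \<Omega> (\<lambda>x. grad (\<psi> n) x $ i)) \<longlonglongrightarrow> emb \<Omega> (\<lambda>x. g' x $ i)"
    by (elim H10_E) blast
  show ?thesis
    using form[OF assms(1) \<phi> \<psi>] form[OF assms(2) \<psi> \<phi>] by (simp add: inner_commute)
qed

section \<open>Approximate point masses and the pointwise kernel\<close>

definition ball_mean :: "real ^ 'n \<Rightarrow> nat \<Rightarrow> real ^ 'n \<Rightarrow> real" where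
  "ball_mean x n y = indicator (ball x (1 / Suc n)) y / measure lebesgue (ball x (1 / Suc n))"

lemma measure_ball_pos: "0 < measure lebesgue (ball x (1 / real (Suc n)))" for x :: "real ^ 'n"
  using content_ball_pos[of "1 / real (Suc n)" x] by simp

lemma ball_mean_sqint: "ball_mean x n \<in> sqint"
proof -
  have "integrable lebesgue (\<lambda>y. (1 / measure lebesgue (ball x (1 / Suc n)))\<^sup>2 * indicator (ball x (1 / Suc n)) y)"
    using emeasure_bounded_finite[OF bounded_ball, of x "1 / Suc n"]
    by (intro integrable_mult_right integrable_real_indicator) auto
  moreover have "(ball_mean x n y)\<^sup>2 = (1 / measure lebesgue (ball x (1 / Suc n)))\<^sup>2 * indicator (ball x (1 / Suc n)) y" for y
    by (auto simp: ball_mean_def split: split_indicator)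
  ultimately show ?thesis by (simp add: sqint_def ball_mean_def[abs_def])
qed

lemma ball_mean_Lp2: "ball_mean x n \<in> Lp_space M 2"
  unfolding Lp2_iff by (rule sqint_bound[OF ball_mean_sqint[of x n]])
    (use sqint_measurable[OF ball_mean_sqint[of x n]] in \<open>auto split: split_indicator\<close>)

lemma Lp2_mult: "f \<in> Lp_space M 2 \<Longrightarrow> g \<in> Lp_space M 2 \<Longrightarrow> integrable M (\<lambda>x. f x * g x)" for f g :: "real ^ 'n \<Rightarrow> real"
proof -
  assume fg: "f \<in> Lp_space M 2" "g \<in> Lp_space M 2"
  have "(\<lambda>x. indicator \<Omega> x *\<^sub>R (f x * g x)) = (\<lambda>x. (indicator \<Omega> x * f x) * (indicator \<Omega> x * g x))"
    by (auto simp: fun_eq_iff split: split_indicator)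
  then have "integrable lebesgue (\<lambda>x. indicator \<Omega> x *\<^sub>R (f x * g x))"
    using sqint_mult fg unfolding Lp2_iff by (simp only:)
  then show ?thesis by (subst integrable_restrict_space) (simp_all only: \<Omega>_sets sets.Int_space_eq2)
qed

text \<open>Closeness almost everywhere suffices for averages; this matters because the lemma is
  also applied to \<open>S t (ball_mean x n)\<close>, which is known only up to null sets.\<close>

lemma ball_mean_average:
  fixes h :: "real ^ 'n \<Rightarrow> real"
  assumes sub: "ball x (1 / Suc n) \<subseteq> \<Omega>"
    and close: "AE y in M. y \<in> ball x (1 / Suc n) \<longrightarrow> \<bar>h y - a\<bar> \<le> e" and int: "integrable M (\<lambda>y. h y * ball_mean x n y)"
  shows "\<bar>(\<integral>y. h y * ball_mean x n y \<partial>M) - a\<bar> \<le> e"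
proof -
  let ?B = "ball x (1 / Suc n)"
  have B: "emeasure lebesgue ?B < \<infinity>"
    using emeasure_bounded_finite[OF bounded_ball, of x "1 / Suc n"] by simp
  have iD': "integrable lebesgue (ball_mean x n)"
    unfolding ball_mean_def[abs_def] using B by (intro integrable_divide_zero integrable_real_indicator) auto
  have eqD: "indicator \<Omega> y *\<^sub>R ball_mean x n y = ball_mean x n y" for y using sub by (auto simp: ball_mean_def split: split_indicator)
  have iD: "integrable M (ball_mean x n)"
    using iD' by (subst integrable_restrict_space) (simp_all only: eqD \<Omega>_sets sets.Int_space_eq2)
  have "(\<integral>y. ball_mean x n y \<partial>M) = (\<integral>y. ball_mean x n y \<partial>lebesgue)"
    by (subst integral_restrict_space) (simp_all only: eqD \<Omega>_sets sets.Int_space_eq2)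
  also have "\<dots> = 1" using measure_ball_pos[of x n] B by (simp add: ball_mean_def)
  finally have 1: "(\<integral>y. ball_mean x n y \<partial>M) = 1" .
  have "(\<integral>y. h y * ball_mean x n y \<partial>M) - a = (\<integral>y. (h y - a) * ball_mean x n y \<partial>M)"
    using iD int 1 by (simp add: left_diff_distrib)
  also have "\<bar>\<dots>\<bar> \<le> (\<integral>y. \<bar>(h y - a) * ball_mean x n y\<bar> \<partial>M)" by (rule integral_abs_bound)
  also have "\<dots> \<le> (\<integral>y. e * ball_mean x n y \<partial>M)"
  proof (rule integral_mono_AE)
    show "integrable M (\<lambda>y. \<bar>(h y - a) * ball_mean x n y\<bar>)" using iD int by (intro integrable_abs) (simp add: left_diff_distrib)
    show "integrable M (\<lambda>y. e * ball_mean x n y)" using iD by simp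
    show "AE y in M. \<bar>(h y - a) * ball_mean x n y\<bar> \<le> e * ball_mean x n y"
      using close
    proof eventually_elim
      case (elim y)
      have "0 \<le> ball_mean x n y" "y \<notin> ?B \<Longrightarrow> ball_mean x n y = 0" by (auto simp: ball_mean_def)
      then show ?case using elim by (cases "y \<in> ?B") (auto simp: abs_mult intro: mult_right_mono)
    qed
  qed
  also have "\<dots> = e" using 1 by simp
  finally show ?thesis .
qed

context
  fixes S k
  assumes heat: "dirichlet_heat_semigroup \<Omega> S"
    and cont: "\<And>t. t > 0 \<Longrightarrow> continuous_on (\<Omega> \<times> \<Omega>) (\<lambda>(x, y). k t x y)"
    and kern: "\<And>t f. t > 0 \<Longrightarrow> f \<in> Lp_space M 2 \<Longrightarrow> AE x in M.
            integrable M (\<lambda>y. k t x y * f y) \<and> S t f x = (\<integral>y. k t x y * f y \<partial>M)"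
begin

lemma C0_S: "C0_semigroup_L2 M S"
  using heat by (simp add: dirichlet_heat_semigroup_def)

interpretation C0_semigroup "semi S" by (rule semi_C0[OF C0_S])

lemma gen_dirichlet:
  assumes "dirichlet_laplacian \<Omega> u v"
  shows "gen (emb \<Omega> u) (emb \<Omega> (\<lambda>x. - v x))"
proof -
  have "u \<in> Lp_space M 2" "v \<in> Lp_space M 2"
    using assms by (auto simp: dirichlet_laplacian_def H10_def)
  moreover have "generator_L2 M S u (\<lambda>x. - v x)"
    using heat assms by (simp add: dirichlet_heat_semigroup_def)
  moreover have "(\<lambda>x. - v x) \<in> Lp_space M 2"
    using Lp2_lin[OF \<open>v \<in> _\<close> \<open>v \<in> _\<close>, of "-1" 0] by simp
  ultimately show ?thesis using gen_emb_iff[OF C0_S] by blast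
qed

text \<open>\<open>dirichlet_heat_semigroup\<close> is an equivalence, so every pair in the graph of
  the generator comes from the Dirichlet Laplacian, and \<open>dirichlet_symmetric\<close>
  applies.\<close>

lemma gen_symmetric:
  assumes "gen u w" "gen u' w'" shows "inner w u' = inner u w'"
proof -
  have rep: "\<exists>a b. u = emb \<Omega> a \<and> w = - emb \<Omega> b \<and> dirichlet_laplacian \<Omega> a b" if g: "gen u w" for u w
  proof -
    let ?a = "fun_of u" and ?w = "fun_of w"
    have e: "emb \<Omega> ?a = u" "emb \<Omega> ?w = w"
      using g gen_T0[OF g] semi_0[OF C0_S] by (auto simp: gen_def)
    have "generator_L2 M S ?a ?w" using g gen_emb_iff[OF C0_S fun_of_Lp2 fun_of_Lp2, of u w] by (simp add: e)
    then have "generator_L2 M S ?a (\<lambda>x. - (- ?w x))" by simp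
    then have "dirichlet_laplacian \<Omega> ?a (\<lambda>x. - ?w x)"
      using heat unfolding dirichlet_heat_semigroup_def by blast
    moreover have "w = - emb \<Omega> (\<lambda>x. - ?w x)"
      using emb_lin[OF fun_of_Lp2 fun_of_Lp2, of "-1" w 0 w] e by simp
    ultimately show ?thesis using e(1)
      by (intro exI[of _ ?a] exI[of _ "\<lambda>x. - ?w x"]) simp
  qed
  from rep[OF assms(1)] rep[OF assms(2)] show ?thesis using dirichlet_symmetric by force
qed

lemma semi_symmetric:
  assumes "0 \<le> t" "f \<in> Lp_space M 2" "g \<in> Lp_space M 2"
  shows "inner (semi S t (emb \<Omega> f)) (emb \<Omega> g) = inner (emb \<Omega> f) (semi S t (emb \<Omega> g))"
proof (rule C0_semigroup_symmetric[OF semi_C0[OF C0_S] gen_symmetric assms(1)])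
  show "semi S 0 (emb \<Omega> f) = emb \<Omega> f" "semi S 0 (emb \<Omega> g) = emb \<Omega> g"
    using assms by (simp_all add: semi_0[OF C0_S] emb_fun_of_emb)
qed

lemma k_near:
  assumes "t > 0" "x \<in> \<Omega>" "y \<in> \<Omega>" "e > 0"
  obtains N where "\<And>n. n \<ge> N \<Longrightarrow> ball x (1 / Suc n) \<subseteq> \<Omega>" "\<And>n. n \<ge> N \<Longrightarrow> ball y (1 / Suc n) \<subseteq> \<Omega>"
    "\<And>m n z w. m \<ge> N \<Longrightarrow> n \<ge> N \<Longrightarrow> z \<in> ball y (1 / Suc m) \<Longrightarrow> w \<in> ball x (1 / Suc n) \<Longrightarrow>
       \<bar>k t z w - k t y x\<bar> \<le> e"
proof -
  obtain d1 where d1: "d1 > 0" "ball x d1 \<subseteq> \<Omega>" using \<Omega> assms open_contains_ball by blast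
  obtain d2 where d2: "d2 > 0" "ball y d2 \<subseteq> \<Omega>" using \<Omega> assms open_contains_ball by blast
  obtain d3 where d3: "d3 > 0" "\<And>p. p \<in> \<Omega> \<times> \<Omega> \<Longrightarrow> dist p (y, x) < d3 \<Longrightarrow> dist (case p of (x, y) \<Rightarrow> k t x y) (k t y x) < e"
    using cont[OF assms(1)] assms unfolding continuous_on_iff by (metis (no_types, lifting) case_prod_conv mem_Sigma_iff)
  define d where "d = min d1 (min d2 (d3 / 2))"
  have "d > 0" using d1 d2 d3 by (simp add: d_def)
  then obtain N where N: "1 / real (Suc N) < d" using nat_approx_posE by blast
  have n: "1 / real (Suc n) < d" if "n \<ge> N" for n
    using N that by (meson frac_le le_less_trans less_eq_real_def of_nat_0_less_iff of_nat_mono Suc_le_mono zero_less_Suc zero_le_one)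
  show ?thesis
  proof (rule that[of N])
    fix m nn z w assume h: "m \<ge> N" "nn \<ge> N" "z \<in> ball y (1 / Suc m)" "w \<in> ball x (1 / Suc nn)"
    have zw: "dist z y < d" "dist w x < d"
      using h n[of m] n[of nn] by (auto simp: dist_commute simp del: of_nat_Suc)
    have "dist (z, w) (y, x) \<le> dist z y + dist w x" by (simp add: dist_Pair_Pair sqrt_sum_squares_le_sum)
    then have "dist (z, w) (y, x) < d3" using zw by (simp add: d_def)
    moreover have "z \<in> \<Omega>" "w \<in> \<Omega>" using zw d1 d2 by (auto simp: d_def dist_commute)
    ultimately show "\<bar>k t z w - k t y x\<bar> \<le> e" using d3(2)[of "(z, w)"] by (simp add: dist_real_def)
  qed (use n d1 d2 in \<open>force simp: d_def simp del: of_nat_Suc\<close>)+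
qed

lemma S_ball_mean_near:
  assumes "t > 0" "x \<in> \<Omega>" "y \<in> \<Omega>" "e > 0"
  obtains N where "\<And>n. n \<ge> N \<Longrightarrow> ball y (1 / Suc n) \<subseteq> \<Omega>"
    "\<And>m n. m \<ge> N \<Longrightarrow> n \<ge> N \<Longrightarrow> AE z in M. z \<in> ball y (1 / Suc m) \<longrightarrow> \<bar>S t (ball_mean x n) z - k t y x\<bar> \<le> e"
proof -
  obtain N where N: "\<And>n. n \<ge> N \<Longrightarrow> ball x (1 / Suc n) \<subseteq> \<Omega>" "\<And>n. n \<ge> N \<Longrightarrow> ball y (1 / Suc n) \<subseteq> \<Omega>"
    "\<And>m n z w. m \<ge> N \<Longrightarrow> n \<ge> N \<Longrightarrow> z \<in> ball y (1 / Suc m) \<Longrightarrow> w \<in> ball x (1 / Suc n) \<Longrightarrow>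
       \<bar>k t z w - k t y x\<bar> \<le> e"
    using k_near[OF assms] by blast
  show ?thesis
  proof (rule that[of N])
    fix m n assume mn: "m \<ge> N" "n \<ge> N"
    show "AE z in M. z \<in> ball y (1 / Suc m) \<longrightarrow> \<bar>S t (ball_mean x n) z - k t y x\<bar> \<le> e"
      using kern[OF assms(1) ball_mean_Lp2[of x n]]
    proof eventually_elim
      case (elim z)
      show ?case
      proof
        assume z: "z \<in> ball y (1 / Suc m)"
        have "\<bar>(\<integral>w. k t z w * ball_mean x n w \<partial>M) - k t y x\<bar> \<le> e"
          by (rule ball_mean_average[OF N(1)[OF mn(2)]]) (use N(3)[OF mn z] elim in auto)
        then show "\<bar>S t (ball_mean x n) z - k t y x\<bar> \<le> e" using elim by simp
      qed
    qed
  qed (rule N)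
qed

text \<open>Averaging the kernel in both variables approaches its value by joint continuity. One
  threshold serves \<open>m\<close> and \<open>n\<close> independently, as the Cauchy argument below
  requires.\<close>

lemma inner_semi_ball_mean:
  assumes "t > 0" "x \<in> \<Omega>" "y \<in> \<Omega>" "e > 0"
  shows "\<exists>N. \<forall>m\<ge>N. \<forall>n\<ge>N. \<bar>inner (semi S t (emb \<Omega> (ball_mean x n))) (emb \<Omega> (ball_mean y m)) - k t y x\<bar> \<le> e"
proof -
  obtain N where N: "\<And>n. n \<ge> N \<Longrightarrow> ball y (1 / Suc n) \<subseteq> \<Omega>"
    "\<And>m n. m \<ge> N \<Longrightarrow> n \<ge> N \<Longrightarrow> AE z in M. z \<in> ball y (1 / Suc m) \<longrightarrow> \<bar>S t (ball_mean x n) z - k t y x\<bar> \<le> e"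
    using S_ball_mean_near[OF assms] by blast
  show ?thesis
  proof (intro exI allI impI)
    fix m n assume mn: "m \<ge> N" "n \<ge> N"
    have L: "S t (ball_mean x n) \<in> Lp_space M 2" using assms(1) by (intro S_Lp2[OF C0_S] ball_mean_Lp2) simp
    have eq: "inner (semi S t (emb \<Omega> (ball_mean x n))) (emb \<Omega> (ball_mean y m)) = (\<integral>z. S t (ball_mean x n) z * ball_mean y m z \<partial>M)"
      using assms(1) L by (simp add: semi_emb[OF C0_S] ball_mean_Lp2 inner_emb)
    show "\<bar>inner (semi S t (emb \<Omega> (ball_mean x n))) (emb \<Omega> (ball_mean y m)) - k t y x\<bar> \<le> e"
      unfolding eq
      by (rule ball_mean_average[OF N(1)[OF mn(1)] N(2)[OF mn]]) (rule Lp2_mult[OF L ball_mean_Lp2])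
  qed
qed

text \<open>The doubly averaged kernel is symmetric because the semigroup is, and the averages
  shrink to the two values.\<close>

lemma k_symmetric:
  assumes "t > 0" "x \<in> \<Omega>" "y \<in> \<Omega>"
  shows "k t x y = k t y x"
proof -
  have "\<bar>k t x y - k t y x\<bar> \<le> 0 + e" if "e > 0" for e
  proof -
    from that
  have "e / 2 > 0" by simp
  obtain N1 where N1: "\<And>m n. m \<ge> N1 \<Longrightarrow> n \<ge> N1 \<Longrightarrow> \<bar>inner (semi S t (emb \<Omega> (ball_mean x n))) (emb \<Omega> (ball_mean y m)) - k t y x\<bar> \<le> e / 2"
    using inner_semi_ball_mean[OF assms \<open>e / 2 > 0\<close>] by blast
  obtain N2 where N2: "\<And>m n. m \<ge> N2 \<Longrightarrow> n \<ge> N2 \<Longrightarrow> \<bar>inner (semi S t (emb \<Omega> (ball_mean y n))) (emb \<Omega> (ball_mean x m)) - k t x y\<bar> \<le> e / 2"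
    using inner_semi_ball_mean[OF assms(1,3,2) \<open>e / 2 > 0\<close>] by blast
  define n where "n = max N1 N2"
  have "inner (semi S t (emb \<Omega> (ball_mean x n))) (emb \<Omega> (ball_mean y n)) = inner (semi S t (emb \<Omega> (ball_mean y n))) (emb \<Omega> (ball_mean x n))"
    using semi_symmetric[of t "ball_mean x n" "ball_mean y n"] assms(1) ball_mean_Lp2 by (simp add: inner_commute)
  moreover have "\<bar>inner (semi S t (emb \<Omega> (ball_mean x n))) (emb \<Omega> (ball_mean y n)) - k t y x\<bar> \<le> e / 2"
    by (rule N1) (simp_all add: n_def)
  moreover have "\<bar>inner (semi S t (emb \<Omega> (ball_mean y n))) (emb \<Omega> (ball_mean x n)) - k t x y\<bar> \<le> e / 2"
    by (rule N2) (simp_all add: n_def)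
  ultimately show ?thesis by linarith
  qed
  then have "\<bar>k t x y - k t y x\<bar> \<le> 0" by (rule field_le_epsilon)
  then show ?thesis by simp
qed

lemma S_ball_mean_tendsto:
  assumes "t > 0" "x \<in> \<Omega>"
  shows "AE y in M. (\<lambda>n. S t (ball_mean x n) y) \<longlonglongrightarrow> k t y x"
proof -
  \<comment> \<open>Countably many null sets are merged, so that one exceptional set serves all
    \<open>n\<close>.\<close>
  have "AE y in M. \<forall>n. integrable M (\<lambda>z. k t y z * ball_mean x n z) \<and> S t (ball_mean x n) y = (\<integral>z. k t y z * ball_mean x n z \<partial>M)"
    unfolding AE_all_countable using kern[OF assms(1) ball_mean_Lp2] by blast
  moreover have "AE y in M. y \<in> \<Omega>" by (simp add: AE_M)
  ultimately show ?thesis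
  proof eventually_elim
    case (elim y)
    show ?case
    proof (rule LIMSEQ_I)
      fix r :: real assume "r > 0"
      then have "r / 2 > 0" by simp
      then obtain N where N: "\<And>n. n \<ge> N \<Longrightarrow> ball x (1 / Suc n) \<subseteq> \<Omega>"
        "\<And>m n z w. m \<ge> N \<Longrightarrow> n \<ge> N \<Longrightarrow> z \<in> ball y (1 / Suc m) \<Longrightarrow> w \<in> ball x (1 / Suc n) \<Longrightarrow>
          \<bar>k t z w - k t y x\<bar> \<le> r / 2"
        using k_near[OF assms(1,2) \<open>y \<in> \<Omega>\<close>] by metis
      have "\<bar>S t (ball_mean x n) y - k t y x\<bar> \<le> r / 2" if "n \<ge> N" for n
      proof -
        have "\<bar>(\<integral>w. k t y w * ball_mean x n w \<partial>M) - k t y x\<bar> \<le> r / 2"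
        proof (rule ball_mean_average[OF N(1)[OF that]])
          show "AE w in M. w \<in> ball x (1 / Suc n) \<longrightarrow> \<bar>k t y w - k t y x\<bar> \<le> r / 2"
            by (intro AE_I2 impI, rule N(2)[OF order_refl that]) (simp_all del: of_nat_Suc)
        qed (use elim in blast)
        then show ?thesis using elim by simp
      qed
      then show "\<exists>no. \<forall>n\<ge>no. norm (S t (ball_mean x n) y - k t y x) < r"
        using \<open>r > 0\<close> by (intro exI[of _ N]) fastforce
    qed
  qed
qed

text \<open>With \<open>D\<^sub>n = ball_mean x n\<close>, symmetry shows that \<open>\<langle>T\<^sub>t D\<^sub>n, T\<^sub>t D\<^sub>m\<rangle> = \<langle>T\<^sub>2\<^sub>t D\<^sub>n, D\<^sub>m\<rangle>\<close>
  tends to \<open>k (2 t) x x\<close>.\<close>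

lemma semi_ball_mean_Cauchy:
  assumes "t > 0" "x \<in> \<Omega>" "e > 0"
  shows "\<exists>N. \<forall>m\<ge>N. \<forall>n\<ge>N. (norm (semi S t (emb \<Omega> (ball_mean x m)) - semi S t (emb \<Omega> (ball_mean x n))))\<^sup>2 \<le> e\<^sup>2"
proof -
  let ?H = "\<lambda>n. semi S t (emb \<Omega> (ball_mean x n))" and ?a = "k (t + t) x x"
  \<comment> \<open>The squared norm expands into three inner products with coefficients 1, -2, 1,
    each within a quarter of \<open>e\<^sup>2\<close> of the same number.\<close>
  have "t + t > 0" "e\<^sup>2 / 4 > 0" using assms by auto
  then obtain N where N: "\<And>m n. m \<ge> N \<Longrightarrow> n \<ge> N \<Longrightarrow> \<bar>inner (semi S (t + t) (emb \<Omega> (ball_mean x n))) (emb \<Omega> (ball_mean x m)) - ?a\<bar> \<le> e\<^sup>2 / 4"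
    using inner_semi_ball_mean[of "t + t" x x "e\<^sup>2 / 4"] assms by blast
  have H: "\<bar>inner (?H n) (?H m) - ?a\<bar> \<le> e\<^sup>2 / 4" if "m \<ge> N" "n \<ge> N" for m n
  proof -
    have "?H n = emb \<Omega> (S t (ball_mean x n))" using assms by (simp add: semi_emb[OF C0_S] ball_mean_Lp2)
    then have "inner (?H n) (?H m) = inner (semi S t (?H n)) (emb \<Omega> (ball_mean x m))"
      using assms semi_symmetric[of t "S t (ball_mean x n)" "ball_mean x m"] by (simp add: ball_mean_Lp2 S_Lp2[OF C0_S])
    also have "\<dots> = inner (semi S (t + t) (emb \<Omega> (ball_mean x n))) (emb \<Omega> (ball_mean x m))"
      using semigroup[of t t "emb \<Omega> (ball_mean x n)"] assms by simp
    finally show ?thesis using N[OF that] by simp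
  qed
  have "(norm (?H m - ?H n))\<^sup>2 \<le> e\<^sup>2" if "m \<ge> N" "n \<ge> N" for m n
  proof -
    have "(norm (?H m - ?H n))\<^sup>2 = inner (?H m) (?H m) - 2 * inner (?H m) (?H n) + inner (?H n) (?H n)"
      unfolding power2_norm_eq_inner by (simp add: inner_diff_left inner_diff_right inner_commute)
    moreover have "\<bar>inner (?H m) (?H m) - ?a\<bar> \<le> e\<^sup>2 / 4" "\<bar>inner (?H m) (?H n) - ?a\<bar> \<le> e\<^sup>2 / 4"
      "\<bar>inner (?H n) (?H n) - ?a\<bar> \<le> e\<^sup>2 / 4" by (intro H that)+
    ultimately show ?thesis by linarith
  qed
  then show ?thesis by blast
qed

text \<open>The sequence is Cauchy in norm and converges almost everywhere to
  \<open>k t y x\<close>. Fatou's lemma identifies the norm limit with the pointwise one; square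
  integrability of the kernel in its first variable comes out at the same time.\<close>

lemma semi_ball_mean_tendsto:
  assumes "t > 0" "x \<in> \<Omega>"
  shows "(\<lambda>y. k t y x) \<in> Lp_space M 2" "(\<lambda>n. semi S t (emb \<Omega> (ball_mean x n))) \<longlonglongrightarrow> emb \<Omega> (\<lambda>y. k t y x)"
proof -
  have hL: "S t (ball_mean x n) \<in> Lp_space M 2" for n using assms by (intro S_Lp2[OF C0_S] ball_mean_Lp2) simp
  then have hm[measurable]: "S t (ball_mean x n) \<in> borel_measurable M" for n by (simp add: Lp_space_def)
  have "continuous_on \<Omega> (\<lambda>y. k t y x)"
  proof -
    have "continuous_on \<Omega> (\<lambda>y. case (y, x) of (x, y) \<Rightarrow> k t x y)"
      by (rule continuous_on_compose2[OF cont[OF assms(1)]]) (use assms(2) in \<open>auto intro!: continuous_intros\<close>)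
    then show ?thesis by simp
  qed
  then have [measurable]: "(\<lambda>y. k t y x) \<in> borel_measurable M"
    by (rule continuous_imp_measurable_on_sets_lebesgue) simp
  have fatou: "\<exists>N. \<forall>n\<ge>N. (\<integral>\<^sup>+y. ennreal ((norm (S t (ball_mean x n) y - k t y x))\<^sup>2) \<partial>M) \<le> ennreal (e\<^sup>2)" if e: "e > 0" for e
  proof -
    obtain N where N: "\<And>m n. m \<ge> N \<Longrightarrow> n \<ge> N \<Longrightarrow> (norm (semi S t (emb \<Omega> (ball_mean x m)) - semi S t (emb \<Omega> (ball_mean x n))))\<^sup>2 \<le> e\<^sup>2"
      using semi_ball_mean_Cauchy[OF assms e] by blast
    have "(\<integral>\<^sup>+y. ennreal ((norm (S t (ball_mean x n) y - k t y x))\<^sup>2) \<partial>M) \<le> ennreal (e\<^sup>2)" if "n \<ge> N" for n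
    proof -
      have "(\<integral>\<^sup>+y. ennreal ((norm (S t (ball_mean x n) y - k t y x))\<^sup>2) \<partial>M) =
          (\<integral>\<^sup>+y. liminf (\<lambda>m. ennreal ((norm (S t (ball_mean x n) y - S t (ball_mean x m) y))\<^sup>2)) \<partial>M)"
      proof (rule nn_integral_cong_AE, use S_ball_mean_tendsto[OF assms] in eventually_elim)
        case (elim y)
        then have "(\<lambda>m. ennreal ((norm (S t (ball_mean x n) y - S t (ball_mean x m) y))\<^sup>2)) \<longlonglongrightarrow> ennreal ((norm (S t (ball_mean x n) y - k t y x))\<^sup>2)"
          by (intro tendsto_intros)
        then show ?case by (intro lim_imp_Liminf[symmetric] sequentially_bot)
      qed
      also have "\<dots> \<le> liminf (\<lambda>m. \<integral>\<^sup>+y. ennreal ((norm (S t (ball_mean x n) y - S t (ball_mean x m) y))\<^sup>2) \<partial>M)"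
        by (rule nn_integral_liminf) measurable
      also have "\<dots> \<le> limsup (\<lambda>m. \<integral>\<^sup>+y. ennreal ((norm (S t (ball_mean x n) y - S t (ball_mean x m) y))\<^sup>2) \<partial>M)"
        by (rule Liminf_le_Limsup) simp
      also have "\<dots> \<le> ennreal (e\<^sup>2)"
      proof (rule Limsup_bounded, rule eventually_sequentiallyI[of N])
        fix m assume "N \<le> m"
        let ?d = "\<lambda>y. S t (ball_mean x n) y - S t (ball_mean x m) y"
        have "?d \<in> Lp_space M 2" using hL by (rule Lp2_diff) (rule hL)
        then have "(\<integral>\<^sup>+y. ennreal ((norm (?d y))\<^sup>2) \<partial>M) = ennreal ((norm (emb \<Omega> ?d))\<^sup>2)"
          unfolding nn_M emb_def Lp2_iff by (rule nn_norm_l2_of)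
        also have "emb \<Omega> ?d = semi S t (emb \<Omega> (ball_mean x n)) - semi S t (emb \<Omega> (ball_mean x m))"
          using assms by (simp add: emb_diff hL semi_emb[OF C0_S] ball_mean_Lp2)
        finally show "(\<integral>\<^sup>+y. ennreal ((norm (?d y))\<^sup>2) \<partial>M) \<le> ennreal (e\<^sup>2)"
          using N[OF that \<open>N \<le> m\<close>] by (simp add: ennreal_leI)
      qed
      finally show ?thesis .
    qed
    then show ?thesis by blast
  qed
  have diffL: "(\<lambda>y. S t (ball_mean x n) y - k t y x) \<in> Lp_space M 2"
    if "(\<integral>\<^sup>+y. ennreal ((norm (S t (ball_mean x n) y - k t y x))\<^sup>2) \<partial>M) \<le> ennreal (e\<^sup>2)" "e > 0" for n e
    using Lp_norm_2_le[OF that(1)] that(2) by (auto simp: Lp_space_def intro: le_less_trans)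
  obtain N1 where N1: "(\<integral>\<^sup>+y. ennreal ((norm (S t (ball_mean x N1) y - k t y x))\<^sup>2) \<partial>M) \<le> ennreal (1\<^sup>2)"
    using fatou[of 1] by auto
  \<comment> \<open>The kernel is written as a difference of two functions already known to be
    square integrable.\<close>
  have "(\<lambda>y. S t (ball_mean x N1) y - (S t (ball_mean x N1) y - k t y x)) \<in> Lp_space M 2"
    by (rule Lp2_diff[OF hL diffL[OF N1]]) simp
  then show L: "(\<lambda>y. k t y x) \<in> Lp_space M 2" by simp
  show "(\<lambda>n. semi S t (emb \<Omega> (ball_mean x n))) \<longlonglongrightarrow> emb \<Omega> (\<lambda>y. k t y x)"
  proof (rule LIMSEQ_I)
    fix r :: real assume "r > 0"
    then obtain N where N: "\<And>n. n \<ge> N \<Longrightarrow> (\<integral>\<^sup>+y. ennreal ((norm (S t (ball_mean x n) y - k t y x))\<^sup>2) \<partial>M) \<le> ennreal ((r / 2)\<^sup>2)"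
      using fatou[of "r / 2"] by auto
    have "norm (semi S t (emb \<Omega> (ball_mean x n)) - emb \<Omega> (\<lambda>y. k t y x)) < r" if "n \<ge> N" for n
    proof -
      have "ennreal (norm (emb \<Omega> (\<lambda>y. S t (ball_mean x n) y - k t y x))) \<le> ennreal (r / 2)"
        using Lp_norm_2_le[OF N[OF that]] \<open>r > 0\<close> Lp_norm_emb[OF Lp2_diff[OF hL L], of n] by simp
      then show ?thesis using \<open>r > 0\<close> assms by (simp add: emb_diff hL L semi_emb[OF C0_S] ball_mean_Lp2)
    qed
    then show "\<exists>no. \<forall>n\<ge>no. norm (semi S t (emb \<Omega> (ball_mean x n)) - emb \<Omega> (\<lambda>y. k t y x)) < r" by blast
  qed
qed

text \<open>The inner product of \<open>semi S t (emb \<Omega> (ball_mean x n))\<close> with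
  \<open>emb \<Omega> f\<close> is computed in two ways. In the limit it is the integral of
  \<open>k t y x * f y\<close>, which is the heat solution at \<open>x\<close> because the kernel is
  symmetric. Moving the semigroup onto \<open>f\<close> makes it a mean of \<open>U\<close> over a
  ball, which tends to \<open>U x\<close> by continuity.\<close>

theorem heat_solution_eq:
  assumes t: "t > 0" and f: "f \<in> Lp_space M 2" and U: "U \<in> Lp_space M 2" "continuous_on \<Omega> U"
    and sol: "semi S t (emb \<Omega> f) = emb \<Omega> U" and x: "x \<in> \<Omega>"
  shows "heat_solution \<Omega> k f t x = U x"
proof -
  note L = semi_ball_mean_tendsto[OF t x]
  have "(\<lambda>n. inner (semi S t (emb \<Omega> (ball_mean x n))) (emb \<Omega> f)) \<longlonglongrightarrow> inner (emb \<Omega> (\<lambda>y. k t y x)) (emb \<Omega> f)"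
    by (intro tendsto_inner L tendsto_const)
  moreover have "inner (semi S t (emb \<Omega> (ball_mean x n))) (emb \<Omega> f) = (\<integral>y. U y * ball_mean x n y \<partial>M)" for n
    using semi_symmetric[of t "ball_mean x n" f] t f sol inner_emb[OF U(1) ball_mean_Lp2] by (simp add: ball_mean_Lp2 inner_commute)
  moreover have "inner (emb \<Omega> (\<lambda>y. k t y x)) (emb \<Omega> f) = heat_solution \<Omega> k f t x"
    unfolding inner_emb[OF L(1) f] heat_solution_def
    by (rule Bochner_Integration.integral_cong) (use k_symmetric[OF t x] in auto)
  ultimately have 1: "(\<lambda>n. \<integral>y. U y * ball_mean x n y \<partial>M) \<longlonglongrightarrow> heat_solution \<Omega> k f t x" by simp
  have "(\<lambda>n. \<integral>y. U y * ball_mean x n y \<partial>M) \<longlonglongrightarrow> U x"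
  proof (rule LIMSEQ_I)
    fix r :: real assume "r > 0"
    obtain d1 where d1: "d1 > 0" "ball x d1 \<subseteq> \<Omega>" using \<Omega> x open_contains_ball by blast
    obtain d2 where d2: "d2 > 0" "\<And>y. y \<in> \<Omega> \<Longrightarrow> dist y x < d2 \<Longrightarrow> dist (U y) (U x) < r / 2"
      using U(2) x \<open>r > 0\<close> unfolding continuous_on_iff by (metis half_gt_zero)
    obtain N where N: "1 / real (Suc N) < min d1 d2" using nat_approx_posE[of "min d1 d2"] d1 d2 by auto
    have "\<bar>(\<integral>y. U y * ball_mean x n y \<partial>M) - U x\<bar> \<le> r / 2" if "n \<ge> N" for n
    proof -
      have n: "1 / real (Suc n) < min d1 d2"
        using N that by (meson frac_le le_less_trans of_nat_0_less_iff of_nat_mono Suc_le_mono zero_less_Suc zero_le_one order_refl)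
      have sub: "ball x (1 / Suc n) \<subseteq> ball x d1" using n by (intro subset_ball) simp
      show ?thesis
      proof (rule ball_mean_average)
        show "ball x (1 / Suc n) \<subseteq> \<Omega>" using sub d1 by blast
        have "\<bar>U y - U x\<bar> \<le> r / 2" if "y \<in> ball x (1 / Suc n)" for y
        proof -
          have "y \<in> \<Omega>" using that sub d1 by blast
          moreover have "dist y x < d2" using that n by (simp add: dist_commute del: of_nat_Suc)
          ultimately show ?thesis using d2(2)[of y] by (simp add: dist_real_def)
        qed
        then show "AE y in M. y \<in> ball x (1 / Suc n) \<longrightarrow> \<bar>U y - U x\<bar> \<le> r / 2" by (intro AE_I2) blast
        show "integrable M (\<lambda>y. U y * ball_mean x n y)" by (rule Lp2_mult[OF U(1) ball_mean_Lp2])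
      qed
    qed
    then show "\<exists>no. \<forall>n\<ge>no. norm ((\<integral>y. U y * ball_mean x n y \<partial>M) - U x) < r"
      using \<open>r > 0\<close> by (intro exI[of _ N]) fastforce
  qed
  then show ?thesis using 1 LIMSEQ_unique by blast
qed

end

end

section \<open>Radial functions in the domain of the Dirichlet Laplacian\<close>

lemma Lp_norm_2_dominated:
  fixes h :: "nat \<Rightarrow> 'a \<Rightarrow> 'b::real_normed_vector"
  assumes m: "\<And>n. (\<lambda>x. norm (h n x)) \<in> borel_measurable M" and H: "H \<in> borel_measurable M"
    and fin: "(\<integral>\<^sup>+x. ennreal ((H x)\<^sup>2) \<partial>M) < \<infinity>"
    and lim: "\<And>x. x \<in> space M \<Longrightarrow> (\<lambda>n. norm (h n x)) \<longlonglongrightarrow> 0"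
    and bound: "\<And>n x. x \<in> space M \<Longrightarrow> norm (h n x) \<le> H x"
  shows "(\<lambda>n. Lp_norm M 2 (h n)) \<longlonglongrightarrow> 0"
proof -
  note [measurable] = m H
  have "(\<lambda>n. \<integral>\<^sup>+x. ennreal ((norm (h n x))\<^sup>2) \<partial>M) \<longlonglongrightarrow> (\<integral>\<^sup>+x. 0 \<partial>M)"
  proof (rule nn_integral_dominated_convergence[where w="\<lambda>x. ennreal ((H x)\<^sup>2)"])
    show "AE x in M. (\<lambda>n. ennreal ((norm (h n x))\<^sup>2)) \<longlonglongrightarrow> 0"
    proof (rule AE_I2)
      fix x assume "x \<in> space M"
      then have "(\<lambda>n. ennreal ((norm (h n x))\<^sup>2)) \<longlonglongrightarrow> ennreal (0\<^sup>2)" by (intro tendsto_intros lim)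
      then show "(\<lambda>n. ennreal ((norm (h n x))\<^sup>2)) \<longlonglongrightarrow> 0" by simp
    qed
  qed (use fin bound in \<open>auto intro!: AE_I2 ennreal_leI power_mono\<close>)
  then have lim0: "(\<lambda>n. \<integral>\<^sup>+x. ennreal ((norm (h n x))\<^sup>2) \<partial>M) \<longlonglongrightarrow> 0" by simp
  show ?thesis
  proof (rule order_tendstoI)
    fix a :: ennreal assume "0 < a"
    then obtain b where b: "0 < b" "b < a" using dense by blast
    then obtain e where e: "0 < e" "ennreal e < a" by (cases b) auto
    have "0 < ennreal (e\<^sup>2)" using e by simp
    then have "\<forall>\<^sub>F n in sequentially. (\<integral>\<^sup>+x. ennreal ((norm (h n x))\<^sup>2) \<partial>M) < ennreal (e\<^sup>2)"
      by (rule order_tendstoD(2)[OF lim0])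
    then show "\<forall>\<^sub>F n in sequentially. Lp_norm M 2 (h n) < a"
    proof eventually_elim
      case (elim n)
      then have "Lp_norm M 2 (h n) \<le> ennreal e" using e by (intro Lp_norm_2_le) auto
      then show ?case using e(2) by (rule le_less_trans)
    qed
  qed simp
qed

text \<open>The derivative of the cut-off grows like \<open>1 / (r - R)\<close> at the boundary, which is compensated by a profile vanishing there to first order.\<close>

definition cutoff :: "real \<Rightarrow> nat \<Rightarrow> real \<Rightarrow> real" where
  "cutoff R n r = smoothstep (real (Suc n) * (r - R)) * smoothstep (3 - (r - R) / real (Suc n))"

definition cutoff' :: "real \<Rightarrow> nat \<Rightarrow> real \<Rightarrow> real" where
  "cutoff' R n r = real (Suc n) * deriv smoothstep (real (Suc n) * (r - R)) * smoothstep (3 - (r - R) / real (Suc n))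
     - smoothstep (real (Suc n) * (r - R)) * deriv smoothstep (3 - (r - R) / real (Suc n)) / real (Suc n)"

lemma cutoff_deriv: "(cutoff R n has_real_derivative cutoff' R n r) (at r)"
proof -
  have 1: "((\<lambda>r. smoothstep (real (Suc n) * (r - R))) has_real_derivative
      deriv smoothstep (real (Suc n) * (r - R)) * real (Suc n)) (at r)"
    by (rule DERIV_chain2[OF smoothstep_deriv]) (auto intro!: derivative_eq_intros)
  have 2: "((\<lambda>r. smoothstep (3 - (r - R) / real (Suc n))) has_real_derivative
      deriv smoothstep (3 - (r - R) / real (Suc n)) * (- (1 / real (Suc n)))) (at r)"
    by (rule DERIV_chain2[OF smoothstep_deriv]) (auto intro!: derivative_eq_intros)
  have "((\<lambda>r. smoothstep (real (Suc n) * (r - R)) * smoothstep (3 - (r - R) / real (Suc n))) has_real_derivative cutoff' R n r) (at r)"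
    by (rule DERIV_cong[OF DERIV_mult[OF 1 2]]) (simp add: cutoff'_def)
  then show ?thesis by (simp add: cutoff_def[abs_def])
qed

lemma D_k_cutoff: "D_k k UNIV (cutoff R n)"
proof -
  have 1: "D_k k UNIV (\<lambda>r. smoothstep (real (Suc n) * r + - (real (Suc n) * R)))"
    by (rule D_k_compose[OF _ _ _ D_k_smoothstep D_k_linear]) auto
  have 2: "D_k k UNIV (\<lambda>r. smoothstep ((- 1 / real (Suc n)) * r + (3 + R / real (Suc n))))"
    by (rule D_k_compose[OF _ _ _ D_k_smoothstep D_k_linear]) auto
  have "cutoff R n = (\<lambda>r. smoothstep (real (Suc n) * r + - (real (Suc n) * R)) *
      smoothstep ((- 1 / real (Suc n)) * r + (3 + R / real (Suc n))))"
    unfolding cutoff_def by (intro ext arg_cong2[where f="(*)"] arg_cong[where f=smoothstep])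
      (simp_all add: right_diff_distrib diff_divide_distrib del: of_nat_Suc)
  then show ?thesis using D_k_mult[OF _ 1 2] by simp
qed

lemma cutoff_near: "r < R + 1 / real (Suc n) \<Longrightarrow> cutoff R n r = 0"
  unfolding cutoff_def by (subst smoothstep_0) (simp_all add: field_simps)

lemma cutoff_far: "r > R + 2 * real (Suc n) \<Longrightarrow> cutoff R n r = 0"
  unfolding cutoff_def by (subst (2) smoothstep_0) (simp_all add: field_simps)

lemma cutoff_range: "0 \<le> cutoff R n r" "cutoff R n r \<le> 1"
  unfolding cutoff_def by (intro mult_nonneg_nonneg mult_le_one smoothstep_range)+

text \<open>The outer factor is 1 as long as \<open>r - R\<close> is at most \<open>Suc n\<close>,
  because \<open>3 - s\<close> is at least 2 for \<open>s\<close> at most 1. The inequalities are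
  strict so that both arguments lie where the derivative of \<open>smoothstep\<close> is known to
  vanish.\<close>

lemma cutoff_plateau:
  assumes "2 < real (Suc n) * (r - R)" "r - R < real (Suc n)"
  shows "cutoff R n r = 1" "cutoff' R n r = 0"
proof -
  have "(r - R) / real (Suc n) < 1" using assms by (simp add: divide_less_eq)
  then have 1: "3 - (r - R) / real (Suc n) > 2" by simp
  show "cutoff R n r = 1" using assms 1 unfolding cutoff_def by (simp only: smoothstep_1 less_imp_le)
  have 2: "deriv smoothstep (real (Suc n) * (r - R)) = 0" "deriv smoothstep (3 - (r - R) / real (Suc n)) = 0"
    using assms 1 by (auto intro!: smoothstep_deriv_0 simp del: of_nat_Suc)
  show "cutoff' R n r = 0" unfolding cutoff'_def 2 by simp
qed

lemma cutoff_eventually: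
  assumes "r > R"
  shows "\<forall>\<^sub>F n in sequentially. 2 < real (Suc n) * (r - R) \<and> r - R < real (Suc n)"
proof -
  obtain N :: nat where N: "2 / (r - R) < real N" using reals_Archimedean2 by blast
  obtain N' :: nat where N': "r - R < real N'" using reals_Archimedean2 by blast
  show ?thesis
  proof (rule eventually_sequentiallyI[of "max N N'"])
    fix n assume n: "max N N' \<le> n"
    have "2 < real N * (r - R)" using N assms by (simp add: divide_less_eq)
    also have "\<dots> \<le> real (Suc n) * (r - R)" using n assms by (intro mult_right_mono) auto
    finally show "2 < real (Suc n) * (r - R) \<and> r - R < real (Suc n)" using N' n by auto
  qed
qed

text \<open>The inner part of the derivative has size \<open>Suc n * B\<close> but is supported
  where \<open>Suc n * (r - R)\<close> is at most 2; the outer part is bounded by \<open>B\<close>.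
  The result is uniform in \<open>n\<close>.\<close>

lemma cutoff'_bound:
  assumes B: "\<And>x. \<bar>deriv smoothstep x\<bar> \<le> B" and "r > R"
  shows "\<bar>cutoff' R n r\<bar> * (r - R) \<le> 2 * B + B * (r - R)"
proof -
  let ?v = "real (Suc n)" and ?s = "r - R"
  have s: "?s > 0" using assms by simp
  have B0: "B \<ge> 0" using B[of 0] by linarith
  have 1: "\<bar>?v * deriv smoothstep (?v * ?s)\<bar> * ?s \<le> 2 * B"
  proof (cases "?v * ?s > 2")
    case True
    then have "deriv smoothstep (?v * ?s) = 0" by (intro smoothstep_deriv_0) simp
    then show ?thesis using B0 by simp
  next
    case False
    have "\<bar>?v * deriv smoothstep (?v * ?s)\<bar> * ?s = (?v * ?s) * \<bar>deriv smoothstep (?v * ?s)\<bar>"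
      using s by (simp add: abs_mult)
    also have "\<dots> \<le> 2 * B" using False B s by (intro mult_mono) auto
    finally show ?thesis .
  qed
  have 2: "\<bar>?v * deriv smoothstep (?v * ?s) * smoothstep (3 - ?s / ?v)\<bar> \<le> \<bar>?v * deriv smoothstep (?v * ?s)\<bar>"
    unfolding abs_mult[of _ "smoothstep _"]
    by (rule mult_right_le_one_le) (use smoothstep_range in \<open>auto simp: abs_le_iff\<close>)
  have 3: "\<bar>smoothstep (?v * ?s) * deriv smoothstep (3 - ?s / ?v) / ?v\<bar> \<le> B"
  proof -
    have "\<bar>smoothstep (?v * ?s) * deriv smoothstep (3 - ?s / ?v) / ?v\<bar>
        = \<bar>smoothstep (?v * ?s)\<bar> * \<bar>deriv smoothstep (3 - ?s / ?v)\<bar> / ?v"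
      by (simp add: abs_mult)
    also have "\<dots> \<le> 1 * B / 1"
      using smoothstep_range B B0 by (intro frac_le mult_mono mult_nonneg_nonneg) (auto simp: abs_le_iff intro: order_trans[OF _ smoothstep_range(1)])
    finally show ?thesis by simp
  qed
  have "\<bar>cutoff' R n r\<bar> \<le> \<bar>?v * deriv smoothstep (?v * ?s)\<bar> + B"
    unfolding cutoff'_def using 2 3 by linarith
  then have "\<bar>cutoff' R n r\<bar> * ?s \<le> (\<bar>?v * deriv smoothstep (?v * ?s)\<bar> + B) * ?s"
    using s by (intro mult_right_mono) auto
  also have "\<dots> \<le> 2 * B + B * ?s" using 1 by (simp add: distrib_right)
  finally show ?thesis .
qed

locale exterior =
  fixes c :: "real ^ 'n" and R :: real
  assumes R: "R > 0"

sublocale exterior \<subseteq> vdomain "- cball c R"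
  by unfold_locales (simp add: open_Compl)

context exterior
begin

abbreviation "\<Omega> \<equiv> - cball c R"

lemma in_\<Omega>: "x \<in> \<Omega> \<longleftrightarrow> R < norm (x - c)"
  by (simp add: dist_norm norm_minus_commute not_le)

lemma radial_measurable:
  assumes "continuous_on {R<..} F" shows "(\<lambda>x. F (norm (x - c))) \<in> borel_measurable (lebesgue_on \<Omega>)"
proof (rule continuous_imp_measurable_on_sets_lebesgue)
  show "continuous_on \<Omega> (\<lambda>x. F (norm (x - c)))"
    by (rule continuous_on_compose2[OF assms]) (auto intro!: continuous_intros simp: in_\<Omega>[simplified])
qed simp

definition approx :: "(real \<Rightarrow> real) \<Rightarrow> nat \<Rightarrow> real ^ 'n \<Rightarrow> real" where
  "approx G n x = cutoff R n (norm (x - c)) * G (norm (x - c))"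

context
  fixes G :: "real \<Rightarrow> real"
  assumes G: "\<And>k. D_k k {0<..} G"
begin

lemma D_k_approx: "D_k k {0<..} (\<lambda>r. cutoff R n r * G r)"
  by (rule D_k_mult[OF _ D_k_subset[OF D_k_cutoff] G]) auto

lemma approx_test: "approx G n \<in> test_functions \<Omega>"
  unfolding approx_def[abs_def]
  by (rule radial_test_function[where lo="R + 1 / real (Suc n)" and hi="R + 2 * real (Suc n)" and F="\<lambda>r. cutoff R n r * G r"])
     (use D_k_approx R in \<open>auto simp: cutoff_near cutoff_far simp del: of_nat_Suc\<close>)

lemma G_deriv: "r > 0 \<Longrightarrow> (G has_real_derivative deriv G r) (at r)"
  using D_k_deriv[of 0 "{0<..}" G r] G[of "Suc 0"] by simp

lemma approx_grad:
  assumes "x \<in> \<Omega>"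
  shows "grad (approx G n) x = ((cutoff' R n (norm (x - c)) * G (norm (x - c)) + cutoff R n (norm (x - c)) * deriv G (norm (x - c)))
     / norm (x - c)) *\<^sub>R (x - c)"
proof -
  have r: "norm (x - c) > 0" "x \<noteq> c" using assms R by (auto simp: in_\<Omega>[simplified])
  have "((\<lambda>r. cutoff R n r * G r) has_real_derivative
      cutoff' R n (norm (x - c)) * G (norm (x - c)) + deriv G (norm (x - c)) * cutoff R n (norm (x - c))) (at (norm (x - c)))"
    by (intro DERIV_mult cutoff_deriv G_deriv r)
  from GDERIV_radial[OF r(2) this] show ?thesis
    unfolding approx_def[abs_def] by (simp add: grad_eqI mult.commute)
qed

text \<open>The truncations \<open>approx G n\<close> converge together with their gradients by
  dominated convergence. The first-order zero of \<open>G\<close> at \<open>r = R\<close> is what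
  bounds the product of \<open>cutoff'\<close> and \<open>G\<close>; the linear factor in the
  integrability assumption leaves room for the growth in \<open>cutoff'_bound\<close>.\<close>

lemma radial_H10:
  assumes q: "\<And>r. r > R \<Longrightarrow> \<bar>G r\<bar> \<le> K * (r - R) * q r" "\<And>r. r > R \<Longrightarrow> \<bar>deriv G r\<bar> \<le> K * q r"
    and L: "(\<lambda>x. (1 + (norm (x - c) - R)) * q (norm (x - c))) \<in> Lp_space (lebesgue_on \<Omega>) 2" and "K \<ge> 0"
  shows "(\<lambda>x. G (norm (x - c))) \<in> H10 \<Omega>"
proof -
  let ?M = "lebesgue_on \<Omega>"
  obtain B where B: "B > 0" "\<And>x. \<bar>deriv smoothstep x\<bar> \<le> B" using smoothstep_deriv_bounded by blast
  \<comment> \<open>With \<open>s = r - R\<close>, the term with \<open>cutoff'\<close> is at most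
    \<open>(2 * B + B * s) * K * q\<close> and the one with \<open>deriv G\<close> at most
    \<open>K * q\<close>; their sum is below \<open>(2 * B + 1) * (1 + s) * K * q\<close>.\<close>
  define H where "H x = (K * (2 * B + 1)) * ((1 + (norm (x - c) - R)) * q (norm (x - c)))" for x
  have HL: "H \<in> Lp_space ?M 2"
    using Lp2_lin[OF L L, of "K * (2 * B + 1)" 0] by (simp add: H_def[abs_def])
  then have Hm: "H \<in> borel_measurable ?M" by (simp add: Lp_space_def)
  have "(\<integral>\<^sup>+x. ennreal ((norm (H x))\<^sup>2) \<partial>?M) < \<infinity>"
    using HL unfolding nn_M Lp2_iff by (subst nn_norm_l2_of) auto
  then have Hfin: "(\<integral>\<^sup>+x. ennreal ((H x)\<^sup>2) \<partial>?M) < \<infinity>" by simp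
  have q0: "0 \<le> K * q r" if "r > R" for r using q(2)[OF that] by linarith
  have bG: "\<bar>G r\<bar> \<le> (1 + (r - R)) * (K * q r)" "\<bar>deriv G r\<bar> \<le> (1 + (r - R)) * (K * q r)" if "r > R" for r
  proof -
    have "\<bar>G r\<bar> \<le> (r - R) * (K * q r)" using q(1)[OF that] by (simp add: mult_ac)
    also have "\<dots> \<le> (1 + (r - R)) * (K * q r)" using q0[OF that] by (intro mult_right_mono) auto
    finally show "\<bar>G r\<bar> \<le> (1 + (r - R)) * (K * q r)" .
    have "\<bar>deriv G r\<bar> \<le> 1 * (K * q r)" using q(2)[OF that] by simp
    also have "\<dots> \<le> (1 + (r - R)) * (K * q r)" using q0[OF that] that by (intro mult_right_mono) auto
    finally show "\<bar>deriv G r\<bar> \<le> (1 + (r - R)) * (K * q r)" .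
  qed
  have leH: "(1 + (r - R)) * (K * q r) \<le> H x" if "x \<in> \<Omega>" "r = norm (x - c)" for x r
  proof -
    have "1 * ((1 + (r - R)) * (K * q r)) \<le> (2 * B + 1) * ((1 + (r - R)) * (K * q r))"
      using q0[of r] that B(1) by (intro mult_right_mono) (auto simp: in_\<Omega>[simplified])
    then show ?thesis by (simp add: H_def that mult_ac)
  qed
  have contG: "continuous_on {R<..} G" "continuous_on {R<..} (deriv G)"
    using G[of 0] G[of 1] R by (auto intro: continuous_on_subset)
  define g where "g x = (deriv G (norm (x - c)) / norm (x - c)) *\<^sub>R (x - c)" for x
  have ng: "norm (g x) = \<bar>deriv G (norm (x - c))\<bar>" if "x \<in> \<Omega>" for x
    using that R by (auto simp: g_def in_\<Omega>[simplified])
  have uL: "(\<lambda>x. G (norm (x - c))) \<in> Lp_space ?M 2"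
  proof -
    have "Lp_norm ?M 2 (\<lambda>x. G (norm (x - c))) \<le> Lp_norm ?M 2 H"
    proof (rule Lp_norm_2_mono, rule AE_I2)
      fix x assume "x \<in> space ?M"
      then have x: "x \<in> \<Omega>" by simp
      show "norm (G (norm (x - c))) \<le> norm (H x)"
        using bG(1)[of "norm (x - c)"] leH[OF x refl] x by (simp add: in_\<Omega>[simplified])
    qed
    then show ?thesis using HL radial_measurable[OF contG(1)] by (auto simp: Lp_space_def intro: le_less_trans)
  qed
  have gL: "g \<in> Lp_space ?M 2"
  proof -
    have "continuous_on \<Omega> (\<lambda>x. deriv G (norm (x - c)))"
      by (rule continuous_on_compose2[OF contG(2)]) (auto intro!: continuous_intros simp: in_\<Omega>[simplified])
    moreover have "\<forall>x\<in>\<Omega>. norm (x - c) \<noteq> 0" 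
    proof
      fix x assume "x \<in> \<Omega>"
      then have "R < norm (x - c)" by (rule in_\<Omega>[THEN iffD1])
      then show "norm (x - c) \<noteq> 0" using R by linarith
    qed
    ultimately have "continuous_on \<Omega> g"
      unfolding g_def by (intro continuous_intros)
    then have "g \<in> borel_measurable ?M" by (rule continuous_imp_measurable_on_sets_lebesgue) simp
    moreover have "Lp_norm ?M 2 g \<le> Lp_norm ?M 2 H"
    proof (rule Lp_norm_2_mono, rule AE_I2)
      fix x assume "x \<in> space ?M"
      then have x: "x \<in> \<Omega>" by simp
      show "norm (g x) \<le> norm (H x)"
        using bG(2)[of "norm (x - c)"] leH[OF x refl] x ng[OF x] by (simp add: in_\<Omega>[simplified])
    qed
    ultimately show ?thesis using HL by (auto simp: Lp_space_def intro: le_less_trans)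
  qed
  have grad_diff: "norm (grad (approx G n) x - g x) =
      \<bar>cutoff' R n (norm (x - c)) * G (norm (x - c)) + (cutoff R n (norm (x - c)) - 1) * deriv G (norm (x - c))\<bar>"
    if "x \<in> \<Omega>" for x n
  proof -
    have r: "norm (x - c) > 0" using that[THEN in_\<Omega>[THEN iffD1]] R by linarith
    have "grad (approx G n) x - g x = ((cutoff' R n (norm (x - c)) * G (norm (x - c))
       + (cutoff R n (norm (x - c)) - 1) * deriv G (norm (x - c))) / norm (x - c)) *\<^sub>R (x - c)"
      unfolding approx_grad[OF that] g_def scaleR_left_diff_distrib[symmetric] diff_divide_distrib[symmetric]
      by (rule arg_cong[where f="\<lambda>a. (a / norm (x - c)) *\<^sub>R (x - c)"]) (simp add: left_diff_distrib)
    then show ?thesis using r by simp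
  qed
  have c1: "continuous_on {R<..} (cutoff R n)" for n
    using D_k_cutoff[of 0 R n] by (auto intro: continuous_on_subset)
  have c2: "continuous_on {R<..} (cutoff' R n)" for n
  proof -
    have "deriv (cutoff R n) = cutoff' R n" using DERIV_imp_deriv[OF cutoff_deriv] by blast
    then show ?thesis using D_k_cutoff[of 1 R n] by (auto intro: continuous_on_subset)
  qed
  have lim1: "(\<lambda>n. Lp_norm ?M 2 (\<lambda>x. approx G n x - G (norm (x - c)))) \<longlonglongrightarrow> 0"
  proof (rule Lp_norm_2_dominated[OF _ Hm Hfin])
    have "continuous_on {R<..} (\<lambda>r. \<bar>cutoff R n r * G r - G r\<bar>)" for n
      by (intro continuous_intros c1 contG)
    from radial_measurable[OF this]
    show "(\<lambda>x. norm (approx G n x - G (norm (x - c)))) \<in> borel_measurable ?M" for n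
      by (simp add: approx_def)
    fix x assume "x \<in> space ?M"
    then have x: "x \<in> \<Omega>" "norm (x - c) > R" by (auto simp: in_\<Omega>[simplified])
    show "(\<lambda>n. norm (approx G n x - G (norm (x - c)))) \<longlonglongrightarrow> 0"
      by (rule tendsto_eventually, use cutoff_eventually[OF x(2)] in eventually_elim)
         (simp add: approx_def cutoff_plateau)
    fix n
    have "\<bar>cutoff R n (norm (x - c)) - 1\<bar> * \<bar>G (norm (x - c))\<bar> \<le> 1 * \<bar>G (norm (x - c))\<bar>"
      using cutoff_range[of R n "norm (x - c)"] by (intro mult_right_mono) (auto simp: abs_le_iff)
    then have "norm (approx G n x - G (norm (x - c))) \<le> \<bar>G (norm (x - c))\<bar>"
      by (simp add: approx_def abs_mult[symmetric] left_diff_distrib)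
    then show "norm (approx G n x - G (norm (x - c))) \<le> H x"
      using bG(1)[OF x(2)] leH[OF x(1) refl] by linarith
  qed
  have lim2: "(\<lambda>n. Lp_norm ?M 2 (\<lambda>x. grad (approx G n) x - g x)) \<longlonglongrightarrow> 0"
  proof (rule Lp_norm_2_dominated[OF _ Hm Hfin])
    have "continuous_on {R<..} (\<lambda>r. \<bar>cutoff' R n r * G r + (cutoff R n r - 1) * deriv G r\<bar>)" for n
      by (intro continuous_intros c1 c2 contG)
    from radial_measurable[OF this]
    show "(\<lambda>x. norm (grad (approx G n) x - g x)) \<in> borel_measurable ?M" for n
      by (rule measurable_cong[THEN iffD1, rotated]) (simp add: grad_diff)
    fix x assume "x \<in> space ?M"
    then have x: "x \<in> \<Omega>" "norm (x - c) > R" by (auto simp: in_\<Omega>[simplified])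
    show "(\<lambda>n. norm (grad (approx G n) x - g x)) \<longlonglongrightarrow> 0"
      by (rule tendsto_eventually, use cutoff_eventually[OF x(2)] in eventually_elim)
         (simp only: grad_diff[OF x(1)] cutoff_plateau, simp)
    fix n
    let ?r = "norm (x - c)"
    have "\<bar>cutoff' R n ?r * G ?r\<bar> \<le> \<bar>cutoff' R n ?r\<bar> * ((?r - R) * (K * q ?r))"
      unfolding abs_mult using q(1)[OF x(2)] by (intro mult_left_mono) (auto simp: mult_ac)
    also have "\<dots> = (\<bar>cutoff' R n ?r\<bar> * (?r - R)) * (K * q ?r)" by simp
    also have "\<dots> \<le> (2 * B + B * (?r - R)) * (K * q ?r)"
      by (rule mult_right_mono[OF cutoff'_bound[OF B(2) x(2)] q0[OF x(2)]])
    finally have 1: "\<bar>cutoff' R n ?r * G ?r\<bar> \<le> (2 * B + B * (?r - R)) * (K * q ?r)" .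
    have "\<bar>cutoff R n ?r - 1\<bar> * \<bar>deriv G ?r\<bar> \<le> 1 * (K * q ?r)"
      using cutoff_range[of R n ?r] q(2)[OF x(2)] by (intro mult_mono) (auto simp: abs_le_iff)
    then have 2: "\<bar>(cutoff R n ?r - 1) * deriv G ?r\<bar> \<le> K * q ?r" by (simp add: abs_mult)
    have "norm (grad (approx G n) x - g x) \<le> (2 * B + B * (?r - R)) * (K * q ?r) + K * q ?r"
      unfolding grad_diff[OF x(1)] using 1 2 by linarith
    also have "\<dots> = (2 * B + B * (?r - R) + 1) * (K * q ?r)" by (simp add: algebra_simps)
    also have "\<dots> \<le> ((2 * B + 1) * (1 + (?r - R))) * (K * q ?r)"
    proof (rule mult_right_mono[OF _ q0[OF x(2)]])
      have "0 \<le> B * (?r - R)" using B(1) x(2) by simp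
      then show "2 * B + B * (?r - R) + 1 \<le> (2 * B + 1) * (1 + (?r - R))"
        using x(2) by (simp add: algebra_simps)
    qed
    also have "\<dots> = H x" by (simp add: H_def mult_ac)
    finally show "norm (grad (approx G n) x - g x) \<le> H x" .
  qed
  show ?thesis
    unfolding H10_def using uL gL approx_test lim1 lim2 by blast
qed

text \<open>Against a test function \<phi> only the behaviour on its support counts. There the
  radial function coincides with a truncation \<open>approx G n\<close>, itself a test function, so
  Green's formula for two test functions moves the Laplacian without boundary terms.\<close>

lemma radial_dirichlet:
  assumes H10: "(\<lambda>x. G (norm (x - c))) \<in> H10 \<Omega>" and v: "v \<in> Lp_space (lebesgue_on \<Omega>) 2"
    and G1: "\<And>r. r > R \<Longrightarrow> (G has_real_derivative G' r) (at r)"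
    and G2: "\<And>r. r > R \<Longrightarrow> (G' has_real_derivative G'' r) (at r)"
    and vG: "\<And>x. x \<in> \<Omega> \<Longrightarrow> v x = - (G'' (norm (x - c)) + (real CARD('n) - 1) * G' (norm (x - c)) / norm (x - c))"
  shows "dirichlet_laplacian \<Omega> (\<lambda>x. G (norm (x - c))) v"
  unfolding dirichlet_laplacian_def
proof (intro conjI ballI H10 v)
  let ?M = "lebesgue_on \<Omega>"
  fix \<phi> assume \<phi>: "\<phi> \<in> test_functions \<Omega>"
  let ?K = "closure {x. \<phi> x \<noteq> 0}"
  have K: "compact ?K" "?K \<subseteq> \<Omega>" using \<phi> by (auto simp: test_functions_def)
  \<comment> \<open>The distance to \<open>c\<close> attains its extrema on the compact support, so
    the plateau of a single cut-off covers all of it.\<close>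
  have "\<exists>n. \<forall>x\<in>?K. 2 < real (Suc n) * (norm (x - c) - R) \<and> norm (x - c) - R < real (Suc n)"
  proof (cases "?K = {}")
    case False
    have cn: "continuous_on ?K (\<lambda>x. norm (x - c))" by (intro continuous_intros)
    obtain a where a: "a \<in> ?K" "\<And>x. x \<in> ?K \<Longrightarrow> norm (a - c) \<le> norm (x - c)"
      using continuous_attains_inf[OF K(1) False cn] by blast
    obtain b where b: "b \<in> ?K" "\<And>x. x \<in> ?K \<Longrightarrow> norm (x - c) \<le> norm (b - c)"
      using continuous_attains_sup[OF K(1) False cn] by blast
    have ar: "norm (a - c) > R" "norm (b - c) > R" using a(1) b(1) K(2) in_\<Omega> by blast+
    have "\<forall>\<^sub>F n in sequentially. 2 < real (Suc n) * (norm (a - c) - R) \<and> norm (b - c) - R < real (Suc n)"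
      using cutoff_eventually[OF ar(1)] cutoff_eventually[OF ar(2)] by eventually_elim auto
    then obtain n where n: "2 < real (Suc n) * (norm (a - c) - R)" "norm (b - c) - R < real (Suc n)"
      by (auto simp: eventually_sequentially simp del: of_nat_Suc)
    show ?thesis
    proof (intro exI[of _ n] ballI conjI)
      fix x assume x: "x \<in> ?K"
      have "real (Suc n) * (norm (a - c) - R) \<le> real (Suc n) * (norm (x - c) - R)"
        using a(2)[OF x] by (intro mult_left_mono) auto
      then show "2 < real (Suc n) * (norm (x - c) - R)" using n(1) by linarith
      show "norm (x - c) - R < real (Suc n)" using b(2)[OF x] n(2) by linarith
    qed
  qed auto
  then obtain n where n: "\<And>x. x \<in> ?K \<Longrightarrow> 2 < real (Suc n) * (norm (x - c) - R)" "\<And>x. x \<in> ?K \<Longrightarrow> norm (x - c) - R < real (Suc n)"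
    by blast
  let ?\<psi> = "approx G n"
  have \<psi>: "?\<psi> \<in> test_functions \<Omega>" by (rule approx_test)
  define I where "I = {r. R < r \<and> 2 < real (Suc n) * (r - R) \<and> r - R < real (Suc n)}"
  have "open I" unfolding I_def by (intro open_Collect_conj open_Collect_less continuous_intros)
  have eq: "?\<psi> x = G (norm (x - c))" "laplacian ?\<psi> x = - v x" if "x \<in> ?K" for x
  proof -
    have x: "x \<in> \<Omega>" "norm (x - c) \<in> I" using that K n[OF that] in_\<Omega>[of x] by (auto simp: I_def)
    show "?\<psi> x = G (norm (x - c))" using cutoff_plateau(1)[OF n[OF that]] by (simp add: approx_def)
    have "laplacian (\<lambda>x. cutoff R n (norm (x - c)) * G (norm (x - c))) x
        = G'' (norm (x - c)) + (real CARD('n) - 1) * G' (norm (x - c)) / norm (x - c)"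
    proof (rule laplacian_radial[where F="\<lambda>r. cutoff R n r * G r" and lo="R + 1 / real (Suc n)" and I=I and G=G])
      show "D_k 2 {0<..} (\<lambda>r. cutoff R n r * G r)" by (rule D_k_approx)
      show "I \<subseteq> {0<..}" using R by (auto simp: I_def)
      show "cutoff R n r * G r = G r" if "r \<in> I" for r using that by (simp add: I_def cutoff_plateau)
      show "(G has_real_derivative G' r) (at r)" if "r \<in> I" for r using that by (intro G1) (simp add: I_def)
      show "(G' has_real_derivative G'' (norm (x - c))) (at (norm (x - c)))"
        using x by (intro G2) (simp add: I_def)
    qed (use x \<open>open I\<close> R in \<open>auto simp: cutoff_near intro: add_pos_pos\<close>)
    then show "laplacian ?\<psi> x = - v x" using vG[OF x(1)] by (simp add: approx_def[abs_def])
  qed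
  have off: "\<phi> x = 0" "laplacian \<phi> x = 0" if "x \<notin> ?K" for x
  proof -
    show "\<phi> x = 0" using that closure_subset[of "{x. \<phi> x \<noteq> 0}"] by blast
    \<comment> \<open>A test function is also one for its own support, and the vanishing of the
      Laplacian off the domain becomes vanishing off the support.\<close>
    have "\<phi> \<in> test_functions ?K" using \<phi> by (simp add: test_functions_def)
    then show "laplacian \<phi> x = 0" by (rule laplacian_0_off) fact
  qed
  have "(\<integral>x. G (norm (x - c)) * - laplacian \<phi> x \<partial>?M) = (\<integral>x. ?\<psi> x * - laplacian \<phi> x \<partial>?M)"
  proof (rule Bochner_Integration.integral_cong[OF refl])
    show "G (norm (x - c)) * - laplacian \<phi> x = ?\<psi> x * - laplacian \<phi> x" for x
      using eq(1)[of x] off(2)[of x] by (cases "x \<in> ?K") auto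
  qed
  also have "\<dots> = inner (emb \<Omega> ?\<psi>) (emb \<Omega> (\<lambda>x. - laplacian \<phi> x))"
    by (rule inner_emb[symmetric]) (intro test_Lp2 \<psi> laplacian_Lp2 \<phi>)+
  also have "\<dots> = inner (emb \<Omega> \<phi>) (emb \<Omega> (\<lambda>x. - laplacian ?\<psi> x))"
    unfolding green_emb[OF \<psi> \<phi>] green_emb[OF \<phi> \<psi>] by (simp add: inner_commute)
  also have "\<dots> = (\<integral>x. \<phi> x * - laplacian ?\<psi> x \<partial>?M)"
    by (rule inner_emb) (intro test_Lp2 \<psi> laplacian_Lp2 \<phi>)+
  also have "\<dots> = (\<integral>x. v x * \<phi> x \<partial>?M)"
  proof (rule Bochner_Integration.integral_cong[OF refl])
    show "\<phi> x * - laplacian ?\<psi> x = v x * \<phi> x" for x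
      using eq(2)[of x] off(1)[of x] by (cases "x \<in> ?K") auto
  qed
  finally show "(\<integral>x. G (norm (x - c)) * - laplacian \<phi> x \<partial>?M) = (\<integral>x. v x * \<phi> x \<partial>?M)" .
qed

end

end

section \<open>Gaussian bounds and differentiation in the mean\<close>

lemma nn_integral_gaussian_real:
  assumes "a > 0"
  shows "(\<integral>\<^sup>+x. ennreal (exp (- a * x\<^sup>2)) \<partial>lborel) = ennreal (sqrt (pi / a))"
proof -
  define \<sigma> where "\<sigma> = sqrt (1 / (2 * a))"
  have \<sigma>: "\<sigma> > 0" "2 * \<sigma>\<^sup>2 = 1 / a" using assms by (auto simp: \<sigma>_def)
  have eq: "exp (- a * x\<^sup>2) = sqrt (pi / a) * normal_density 0 \<sigma> x" for x
  proof -
    have "normal_density 0 \<sigma> x = 1 / sqrt (pi * (2 * \<sigma>\<^sup>2)) * exp (- (x\<^sup>2 / (2 * \<sigma>\<^sup>2)))"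
      by (simp add: normal_density_def mult_ac)
    also have "\<dots> = 1 / sqrt (pi / a) * exp (- a * x\<^sup>2)" unfolding \<sigma>(2) by (simp add: mult.commute)
    finally show ?thesis using assms by simp
  qed
  have "(\<integral>\<^sup>+x. ennreal (exp (- a * x\<^sup>2)) \<partial>lborel) = (\<integral>\<^sup>+x. ennreal (sqrt (pi / a)) * ennreal (normal_density 0 \<sigma> x) \<partial>lborel)"
    unfolding eq using assms by (intro nn_integral_cong ennreal_mult) auto
  also have "\<dots> = ennreal (sqrt (pi / a)) * (\<integral>\<^sup>+x. ennreal (normal_density 0 \<sigma> x) \<partial>lborel)"
    by (rule nn_integral_cmult) simp
  also have "(\<integral>\<^sup>+x. ennreal (normal_density 0 \<sigma> x) \<partial>lborel) = 1"
    using \<sigma> by (simp add: nn_integral_eq_integral)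
  finally show ?thesis by simp
qed

lemma nn_integral_gaussian:
  fixes c :: "'a::euclidean_space"
  assumes "a > 0"
  shows "(\<integral>\<^sup>+x. ennreal (exp (- a * (norm (x - c))\<^sup>2)) \<partial>lebesgue) = ennreal (sqrt (pi / a) ^ DIM('a))"
proof -
  interpret product_sigma_finite "\<lambda>_::'a. lborel :: real measure" ..
  have [measurable]: "(\<lambda>x::'a. ennreal (exp (- a * (norm x)\<^sup>2))) \<in> borel_measurable borel" by measurable
  have n: "(norm (\<Sum>b\<in>Basis. f b *\<^sub>R b :: 'a))\<^sup>2 = (\<Sum>b\<in>Basis. (f b)\<^sup>2)" for f :: "'a \<Rightarrow> real"
    unfolding power2_norm_eq_inner
    by (subst euclidean_inner) (simp add: inner_sum_left_Basis power2_eq_square)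
  have "(\<integral>\<^sup>+x. ennreal (exp (- a * (norm (x - c))\<^sup>2)) \<partial>lebesgue) = (\<integral>\<^sup>+x. ennreal (exp (- a * (norm (- c + x))\<^sup>2)) \<partial>lborel)"
    by (simp add: nn_integral_completion)
  also have "\<dots> = (\<integral>\<^sup>+x. ennreal (exp (- a * (norm x)\<^sup>2)) \<partial>distr lborel borel ((+) (- c)))"
    by (subst nn_integral_distr) auto
  also have "\<dots> = (\<integral>\<^sup>+x. ennreal (exp (- a * (norm (x::'a))\<^sup>2)) \<partial>lborel)"
    unfolding lborel_distr_plus ..
  also have "\<dots> = (\<integral>\<^sup>+x. ennreal (exp (- a * (norm (x::'a))\<^sup>2)) \<partial>distr (\<Pi>\<^sub>M b\<in>Basis. lborel) borel (\<lambda>f. \<Sum>b\<in>Basis. f b *\<^sub>R b))"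
    by (subst lborel_eq) simp
  also have "\<dots> = (\<integral>\<^sup>+f. ennreal (exp (- a * (norm (\<Sum>b\<in>Basis. f b *\<^sub>R b :: 'a))\<^sup>2)) \<partial>(\<Pi>\<^sub>M b\<in>Basis. lborel))"
    by (subst nn_integral_distr) auto
  also have "\<dots> = (\<integral>\<^sup>+f. (\<Prod>b\<in>(Basis::'a set). ennreal (exp (- a * (f b)\<^sup>2))) \<partial>(\<Pi>\<^sub>M b\<in>Basis. lborel))"
    unfolding n by (simp add: sum_distrib_left exp_sum prod_ennreal sum_negf[symmetric] del: sum_negf)
  also have "\<dots> = (\<Prod>b\<in>(Basis::'a set). \<integral>\<^sup>+x. ennreal (exp (- a * x\<^sup>2)) \<partial>lborel)"
    by (rule product_nn_integral_prod) auto
  also have "\<dots> = ennreal (sqrt (pi / a) ^ DIM('a))"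
    unfolding nn_integral_gaussian_real[OF assms] using assms by (simp add: ennreal_power)
  finally show ?thesis .
qed

text \<open>Compares a Gaussian in \<open>r - R\<close> with a centred one of half the rate.\<close>

lemma shifted_square: "r\<^sup>2 / 2 - R\<^sup>2 \<le> (r - R)\<^sup>2" for r R :: real
  using zero_le_power2[of "r - 2 * R"] by (simp add: power2_eq_square algebra_simps)

lemma nn_integral_shifted_gaussian:
  fixes c :: "'a::euclidean_space"
  assumes "b > 0"
  shows "(\<integral>\<^sup>+x. ennreal (exp (- b * (norm (x - c) - R)\<^sup>2)) \<partial>lebesgue) \<le> ennreal (exp (b * R\<^sup>2) * sqrt (2 * pi / b) ^ DIM('a))"
proof -
  have "(\<integral>\<^sup>+x. ennreal (exp (- b * (norm (x - c) - R)\<^sup>2)) \<partial>lebesgue)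
      \<le> (\<integral>\<^sup>+x. ennreal (exp (b * R\<^sup>2)) * ennreal (exp (- (b / 2) * (norm (x - c))\<^sup>2)) \<partial>lebesgue)"
  proof (rule nn_integral_mono)
    fix x :: 'a
    have "b * ((norm (x - c))\<^sup>2 / 2 - R\<^sup>2) \<le> b * (norm (x - c) - R)\<^sup>2"
      using shifted_square assms by (intro mult_left_mono) auto
    then have "exp (- b * (norm (x - c) - R)\<^sup>2) \<le> exp (b * R\<^sup>2 + (- (b / 2) * (norm (x - c))\<^sup>2))"
      by (simp add: algebra_simps)
    then show "ennreal (exp (- b * (norm (x - c) - R)\<^sup>2)) \<le> ennreal (exp (b * R\<^sup>2)) * ennreal (exp (- (b / 2) * (norm (x - c))\<^sup>2))"
      unfolding exp_add by (subst ennreal_mult[symmetric]) (auto intro: ennreal_leI)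
  qed
  also have "\<dots> = ennreal (exp (b * R\<^sup>2)) * ennreal (sqrt (pi / (b / 2)) ^ DIM('a))"
    using nn_integral_gaussian[of "b / 2" c] assms by (subst nn_integral_cmult) (auto intro!: measurable_completion)
  also have "\<dots> = ennreal (exp (b * R\<^sup>2) * sqrt (2 * pi / b) ^ DIM('a))"
    using assms by (subst ennreal_mult[symmetric]) (auto simp: mult.commute)
  finally show ?thesis .
qed

text \<open>Used to absorb a factor \<open>(r - R)\<^sup>2\<close> at the price of half of the
  Gaussian rate.\<close>

lemma mult_exp_le:
  fixes b y :: real
  assumes "b > 0" shows "y * exp (- b * y) \<le> 1 / b"
proof -
  have "b * y \<le> exp (b * y)" using exp_ge_add_one_self[of "b * y"] by linarith
  then have "b * y * exp (- (b * y)) \<le> exp (b * y) * exp (- (b * y))" by (intro mult_right_mono) auto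
  then show ?thesis using assms by (simp add: exp_minus_inverse field_simps)
qed

context domain
begin

lemma shifted_gaussian_Lp2:
  assumes "b > 0" shows "(\<lambda>x. exp (- b * (norm (x - c) - R)\<^sup>2)) \<in> Lp_space M 2"
proof -
  let ?w = "\<lambda>x. exp (- b * (norm (x - c) - R)\<^sup>2)"
  have m: "?w \<in> borel_measurable lebesgue" by (intro measurable_completion) simp
  have sq: "(?w x)\<^sup>2 = exp (- (2 * b) * (norm (x - c) - R)\<^sup>2)" for x
    by (simp add: power2_eq_square[of "exp _"] exp_add[symmetric])
  have "(\<integral>\<^sup>+x. ennreal ((?w x)\<^sup>2) \<partial>lebesgue) < \<infinity>"
    unfolding sq using nn_integral_shifted_gaussian[of "2 * b" c R] assms by (auto intro: le_less_trans)
  then have s: "?w \<in> sqint" by (rule sqint_nnI[OF m])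
  show ?thesis
    unfolding Lp2_iff
    by (rule sqint_bound[OF s borel_measurable_times[OF _ m]]) (auto split: split_indicator)
qed

lemma Lp2_bound:
  fixes f g :: "'a \<Rightarrow> real"
  assumes "g \<in> Lp_space M 2" "f \<in> borel_measurable M" "\<And>x. x \<in> \<Omega> \<Longrightarrow> \<bar>f x\<bar> \<le> \<bar>g x\<bar>"
  shows "f \<in> Lp_space M 2"
proof -
  have "Lp_norm M 2 f \<le> Lp_norm M 2 g" using assms(3) by (intro Lp_norm_2_mono AE_I2) simp
  then show ?thesis using assms by (auto simp: Lp_space_def intro: le_less_trans)
qed

text \<open>Differentiation in the mean: pointwise the quotients converge to the derivative, and the
  mean value inequality bounds them by \<open>H\<close>, so dominated convergence gives convergence
  in L2.\<close>

lemma emb_has_derivative: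
  fixes f :: "real \<Rightarrow> 'a \<Rightarrow> real"
  assumes l: "l < \<tau>" "\<tau> < u"
    and L: "\<And>s. l < s \<Longrightarrow> s < u \<Longrightarrow> f s \<in> Lp_space M 2" "f' \<tau> \<in> Lp_space M 2" "H \<in> Lp_space M 2"
    and der: "\<And>s x. l < s \<Longrightarrow> s < u \<Longrightarrow> x \<in> \<Omega> \<Longrightarrow> ((\<lambda>s. f s x) has_real_derivative f' s x) (at s)"
    and bound: "\<And>s x. l < s \<Longrightarrow> s < u \<Longrightarrow> x \<in> \<Omega> \<Longrightarrow> \<bar>f' s x\<bar> \<le> H x"
  shows "((\<lambda>s. emb \<Omega> (f s)) has_vector_derivative emb \<Omega> (f' \<tau>)) (at \<tau>)"
  unfolding has_vector_derivative_def has_derivative_at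
proof (intro conjI bounded_linear_scaleR_left)
  show "(\<lambda>h. norm (emb \<Omega> (f (\<tau> + h)) - emb \<Omega> (f \<tau>) - h *\<^sub>R emb \<Omega> (f' \<tau>)) / norm h) \<midarrow>0\<rightarrow> 0"
  proof (subst LIMSEQ_SEQ_conv[symmetric], intro allI impI, elim conjE)
    fix h :: "nat \<Rightarrow> real" assume h0: "\<forall>n. h n \<noteq> 0" and hl: "h \<longlonglongrightarrow> 0"
    \<comment> \<open>Passing to a tail of the sequence keeps all times inside the interval where
      the hypotheses hold.\<close>
    define d where "d = min (\<tau> - l) (u - \<tau>)"
    have "d > 0" using l by (simp add: d_def)
    then obtain N where N: "\<And>n. n \<ge> N \<Longrightarrow> \<bar>h n\<bar> < d" using LIMSEQ_D[OF hl] by auto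
    define e where "e n = h (n + N)" for n
    have e: "e n \<noteq> 0" "\<bar>e n\<bar> < d" for n using h0 N by (auto simp: e_def)
    have el: "e \<longlonglongrightarrow> 0" unfolding e_def by (rule LIMSEQ_ignore_initial_segment[OF hl])
    have in_range: "l < s" "s < u" if "\<bar>s - \<tau>\<bar> < d" for s using that by (auto simp: d_def abs_less_iff)
    define w where "w n x = (f (\<tau> + e n) x - f \<tau> x) / e n - f' \<tau> x" for n x
    have L1: "f (\<tau> + e n) \<in> Lp_space M 2" for n using e[of n] by (intro L(1) in_range) simp_all
    have L0: "f \<tau> \<in> Lp_space M 2" using l by (intro L(1))
    have wq: "w n = (\<lambda>x. ((1 / e n) * f (\<tau> + e n) x + (- (1 / e n)) * f \<tau> x) - f' \<tau> x)" for n
      by (simp add: w_def fun_eq_iff diff_divide_distrib)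
    have wL: "w n \<in> Lp_space M 2" for n
      unfolding wq by (intro Lp2_diff Lp2_lin L1 L0 L(2))
    have ew: "emb \<Omega> (w n) = (emb \<Omega> (f (\<tau> + e n)) - emb \<Omega> (f \<tau>) - e n *\<^sub>R emb \<Omega> (f' \<tau>)) /\<^sub>R e n" for n
      unfolding wq using e[of n]
      by (simp only: emb_diff[OF Lp2_lin[OF L1 L0] L(2)] emb_lin[OF L1 L0]) (simp add: scaleR_diff_right divide_inverse)
    \<comment> \<open>The majorant is twice \<open>H\<close>: once for the difference quotient and
      once for the derivative subtracted from it.\<close>
    have "(\<lambda>n. Lp_norm M 2 (w n)) \<longlonglongrightarrow> 0"
    proof (rule Lp_norm_2_dominated[where H="\<lambda>x. 2 * H x"])
      show "(\<lambda>x. norm (w n x)) \<in> borel_measurable M" for n using wL[of n] by (auto simp: Lp_space_def)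
      have HL: "(\<lambda>x. 2 * H x) \<in> Lp_space M 2" using Lp2_lin[OF L(3) L(3), of 2 0] by simp
      then show "(\<lambda>x. 2 * H x) \<in> borel_measurable M" by (simp add: Lp_space_def)
      have "(\<integral>\<^sup>+x. ennreal ((norm (2 * H x))\<^sup>2) \<partial>M) < \<infinity>"
        using HL unfolding nn_M Lp2_iff by (subst nn_norm_l2_of) auto
      then show "(\<integral>\<^sup>+x. ennreal ((2 * H x)\<^sup>2) \<partial>M) < \<infinity>" by simp
      fix x assume "x \<in> space M"
      then have x: "x \<in> \<Omega>" by simp
      have "((\<lambda>h. (f (\<tau> + h) x - f \<tau> x) / h) \<longlongrightarrow> f' \<tau> x) (at 0)"
        using der[OF l x] by (simp add: DERIV_def)
      moreover have "filterlim e (at 0) sequentially" using e el by (simp add: filterlim_at)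
      ultimately have "(\<lambda>n. (f (\<tau> + e n) x - f \<tau> x) / e n) \<longlonglongrightarrow> f' \<tau> x" by (rule filterlim_compose)
      then show "(\<lambda>n. norm (w n x)) \<longlonglongrightarrow> 0" unfolding w_def by (rule tendsto_norm_zero[OF LIM_zero])
      fix n
      let ?J = "{\<tau> - \<bar>e n\<bar>..\<tau> + \<bar>e n\<bar>}"
      have J: "l < s" "s < u" if "s \<in> ?J" for s
      proof -
        have "\<tau> - \<bar>e n\<bar> \<le> s" "s \<le> \<tau> + \<bar>e n\<bar>" using that by auto
        then have "\<bar>s - \<tau>\<bar> < d" using e(2)[of n] by linarith
        then show "l < s" "s < u" by (rule in_range)+
      qed
      have "norm (f (\<tau> + e n) x - f \<tau> x) \<le> H x * norm (\<tau> + e n - \<tau>)"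
      proof (rule field_differentiable_bound[where S="?J" and f'="\<lambda>s. f' s x" and f="\<lambda>s. f s x"])
        fix s assume s: "s \<in> ?J"
        show "((\<lambda>s. f s x) has_field_derivative f' s x) (at s within ?J)"
          by (rule has_field_derivative_at_within[OF der[OF J[OF s] x]])
        show "norm (f' s x) \<le> H x" using bound[OF J[OF s] x] by simp
      next
        have "\<tau> - \<bar>e n\<bar> \<le> \<tau> + e n" "\<tau> + e n \<le> \<tau> + \<bar>e n\<bar>" by linarith+
        then show "\<tau> + e n \<in> ?J" "\<tau> \<in> ?J" "convex ?J"
          unfolding atLeastAtMost_iff by (simp_all add: convex_real_interval)
      qed
      then have "\<bar>f (\<tau> + e n) x - f \<tau> x\<bar> \<le> H x * \<bar>e n\<bar>" by simp
      then have "\<bar>(f (\<tau> + e n) x - f \<tau> x) / e n\<bar> \<le> H x" using e[of n] by (simp add: divide_le_eq)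
      then show "norm (w n x) \<le> 2 * H x" using bound[OF l x] unfolding w_def real_norm_def by linarith
    qed
    then have "(\<lambda>n. ennreal (norm (emb \<Omega> (w n)))) \<longlonglongrightarrow> ennreal 0" by (simp add: Lp_norm_emb wL)
    then have "(\<lambda>n. norm (emb \<Omega> (w n))) \<longlonglongrightarrow> 0" by (subst (asm) tendsto_ennreal_iff) auto
    then have "(\<lambda>n. norm (emb \<Omega> (f (\<tau> + h (n + N))) - emb \<Omega> (f \<tau>) - h (n + N) *\<^sub>R emb \<Omega> (f' \<tau>)) / norm (h (n + N))) \<longlonglongrightarrow> 0"
      unfolding ew by (simp add: e_def divide_inverse mult.commute)
    then show "(\<lambda>n. norm (emb \<Omega> (f (\<tau> + h n)) - emb \<Omega> (f \<tau>) - h n *\<^sub>R emb \<Omega> (f' \<tau>)) / norm (h n)) \<longlonglongrightarrow> 0"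
      by (rule LIMSEQ_offset)
  qed
qed

end

section \<open>The explicit solution\<close>

text \<open>With \<open>s = r - R\<close>, the product \<open>r * prof R \<tau> r\<close> is -2
  times the derivative in \<open>s\<close> of the one-dimensional heat kernel
  \<open>\<tau> powr (-1/2) * exp (- s\<^sup>2 / (4 * \<tau>))\<close>, up to normalisation. Being
  odd in \<open>s\<close>, it vanishes at \<open>r = R\<close>.\<close>

definition prof :: "real \<Rightarrow> real \<Rightarrow> real \<Rightarrow> real" where
  "prof R \<tau> r = \<tau> powr (- 3 / 2) * ((r - R) / r * exp (- (1 / (4 * \<tau>)) * (r - R)\<^sup>2))"

definition prof_r :: "real \<Rightarrow> real \<Rightarrow> real \<Rightarrow> real" where
  "prof_r R \<tau> r = \<tau> powr (- 3 / 2) * ((R / r\<^sup>2 - (r - R)\<^sup>2 / (2 * \<tau> * r)) * exp (- (1 / (4 * \<tau>)) * (r - R)\<^sup>2))"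

definition prof_t :: "real \<Rightarrow> real \<Rightarrow> real \<Rightarrow> real" where
  "prof_t R \<tau> r = prof R \<tau> r * ((r - R)\<^sup>2 / (4 * \<tau>\<^sup>2) - 3 / (2 * \<tau>))"

lemma shifted_gaussian_deriv:
  assumes "\<tau> > 0"
  shows "((\<lambda>r. exp (- (1 / (4 * \<tau>)) * (r - R)\<^sup>2)) has_real_derivative
    - (r - R) / (2 * \<tau>) * exp (- (1 / (4 * \<tau>)) * (r - R)\<^sup>2)) (at r)"
proof -
  have "((\<lambda>r. - (1 / (4 * \<tau>)) * (r - R)\<^sup>2) has_real_derivative - (1 / (4 * \<tau>)) * (2 * (r - R))) (at r)"
    by (rule DERIV_cmult) (auto intro!: derivative_eq_intros)
  from DERIV_chain2[OF DERIV_exp this] show ?thesis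
    by (rule DERIV_cong) (use assms in \<open>simp add: field_simps\<close>)
qed

lemma prof_deriv_r:
  assumes "\<tau> > 0" "r > 0"
  shows "(prof R \<tau> has_real_derivative prof_r R \<tau> r) (at r)"
proof -
  let ?e = "exp (- (1 / (4 * \<tau>)) * (r - R)\<^sup>2)"
  have 1: "((\<lambda>r. exp (- (1 / (4 * \<tau>)) * (r - R)\<^sup>2)) has_real_derivative - (r - R) / (2 * \<tau>) * ?e) (at r)"
    by (rule shifted_gaussian_deriv) fact
  have 2: "((\<lambda>r. (r - R) / r) has_real_derivative R / r\<^sup>2) (at r)"
    using assms by (auto intro!: derivative_eq_intros simp: power2_eq_square)
  have "((\<lambda>r. \<tau> powr (- 3 / 2) * ((r - R) / r * exp (- (1 / (4 * \<tau>)) * (r - R)\<^sup>2))) has_real_derivative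
     \<tau> powr (- 3 / 2) * (R / r\<^sup>2 * ?e + - (r - R) / (2 * \<tau>) * ?e * ((r - R) / r))) (at r)"
    by (rule DERIV_cmult[OF DERIV_mult[OF 2 1]])
  moreover have "R / r\<^sup>2 * y + - (r - R) / (2 * \<tau>) * y * ((r - R) / r) = (R / r\<^sup>2 - (r - R)\<^sup>2 / (2 * \<tau> * r)) * y" for y
    using assms by (simp add: divide_simps) (simp add: algebra_simps power2_eq_square)
  then have "\<tau> powr (- 3 / 2) * (R / r\<^sup>2 * ?e + - (r - R) / (2 * \<tau>) * ?e * ((r - R) / r)) = prof_r R \<tau> r"
    by (simp only: prof_r_def)
  ultimately show ?thesis by (simp add: prof_def[abs_def])
qed

text \<open>The rational identity left of the radial heat equation once the exponential is
  cancelled, with \<open>s = r - R\<close>. In the variables \<open>1 / r\<close> and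
  \<open>1 / \<tau>\<close> it is polynomial.\<close>

lemma prof_identity:
  fixes r s \<tau> :: real
  assumes "r > 0" "\<tau> > 0"
  shows "- 2 * (r - s) / r ^ 3 - (2 * s / (2 * \<tau> * r) - s\<^sup>2 / (2 * \<tau> * r\<^sup>2)) + - s / (2 * \<tau>) * ((r - s) / r\<^sup>2 - s\<^sup>2 / (2 * \<tau> * r))
    = s / r * (s\<^sup>2 / (4 * \<tau>\<^sup>2) - 3 / (2 * \<tau>)) - 2 * ((r - s) / r\<^sup>2 - s\<^sup>2 / (2 * \<tau> * r)) / r"
proof -
  define i j where "i = 1 / r" and "j = 1 / \<tau>"
  have e: "(r - s) / r\<^sup>2 = i - s * i\<^sup>2" "- 2 * (r - s) / r ^ 3 = - 2 * (i\<^sup>2 - s * i ^ 3)"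
    "2 * s / (2 * \<tau> * r) = s * i * j" "s\<^sup>2 / (2 * \<tau> * r\<^sup>2) = s\<^sup>2 * i\<^sup>2 * j / 2" "- s / (2 * \<tau>) = - s * j / 2"
    "s\<^sup>2 / (2 * \<tau> * r) = s\<^sup>2 * i * j / 2" "s / r = s * i" "s\<^sup>2 / (4 * \<tau>\<^sup>2) = s\<^sup>2 * j\<^sup>2 / 4" "3 / (2 * \<tau>) = 3 * j / 2"
    "x / r = x * i" for x
    using assms by (simp_all add: i_def j_def diff_divide_distrib power2_eq_square power3_eq_cube)
  show ?thesis unfolding e by (simp add: algebra_simps power2_eq_square power3_eq_cube)
qed
text \<open>This is the radial heat equation in dimension three, solved for the second derivative in
  \<open>r\<close>.\<close>

lemma prof_r_deriv:
  assumes "\<tau> > 0" "r > 0"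
  shows "(prof_r R \<tau> has_real_derivative prof_t R \<tau> r - 2 * prof_r R \<tau> r / r) (at r)"
proof -
  let ?e = "exp (- (1 / (4 * \<tau>)) * (r - R)\<^sup>2)"
  have 1: "((\<lambda>r. exp (- (1 / (4 * \<tau>)) * (r - R)\<^sup>2)) has_real_derivative - (r - R) / (2 * \<tau>) * ?e) (at r)"
    by (rule shifted_gaussian_deriv) fact
  let ?d = "- 2 * R / r ^ 3 - (2 * (r - R) / (2 * \<tau> * r) - (r - R)\<^sup>2 / (2 * \<tau> * r\<^sup>2))"
  have 2: "((\<lambda>r. R / r\<^sup>2 - (r - R)\<^sup>2 / (2 * \<tau> * r)) has_real_derivative ?d) (at r)"
  proof -
    have a: "((\<lambda>r. R / r\<^sup>2) has_real_derivative - 2 * R / r ^ 3) (at r)"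
      by (rule DERIV_cong[OF DERIV_divide[OF DERIV_const DERIV_power[OF DERIV_ident]]])
         (use assms in \<open>simp_all add: field_simps eval_nat_numeral\<close>)
    have b: "((\<lambda>r. (r - R)\<^sup>2 / (2 * \<tau> * r)) has_real_derivative
        2 * (r - R) / (2 * \<tau> * r) - (r - R)\<^sup>2 / (2 * \<tau> * r\<^sup>2)) (at r)"
      by (rule DERIV_cong[OF DERIV_divide[OF DERIV_power[OF DERIV_diff[OF DERIV_ident DERIV_const]] DERIV_cmult[OF DERIV_ident]]])
         (use assms in \<open>simp_all add: field_simps eval_nat_numeral\<close>)
    show ?thesis by (rule DERIV_diff[OF a b])
  qed
  have "((\<lambda>r. \<tau> powr (- 3 / 2) * ((R / r\<^sup>2 - (r - R)\<^sup>2 / (2 * \<tau> * r)) * exp (- (1 / (4 * \<tau>)) * (r - R)\<^sup>2))) has_real_derivative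
     \<tau> powr (- 3 / 2) * (?d * ?e + - (r - R) / (2 * \<tau>) * ?e * (R / r\<^sup>2 - (r - R)\<^sup>2 / (2 * \<tau> * r)))) (at r)"
    by (rule DERIV_cmult[OF DERIV_mult[OF 2 1]])
  moreover have "\<tau> powr (- 3 / 2) * (?d * ?e + - (r - R) / (2 * \<tau>) * ?e * (R / r\<^sup>2 - (r - R)\<^sup>2 / (2 * \<tau> * r)))
     = prof_t R \<tau> r - 2 * prof_r R \<tau> r / r"
  proof -
    define x y z A e where "x = ?d" and "y = - (r - R) / (2 * \<tau>)" and "z = R / r\<^sup>2 - (r - R)\<^sup>2 / (2 * \<tau> * r)"
      and "A = \<tau> powr (- 3 / 2)" and "e = ?e"
    define u v where "u = (r - R) / r" and "v = (r - R)\<^sup>2 / (4 * \<tau>\<^sup>2) - 3 / (2 * \<tau>)"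
    have "x + y * z = u * v - 2 * z / r"
      using prof_identity[of r \<tau> "r - R"] assms by (simp add: x_def y_def z_def u_def v_def)
    then have "A * e * (x + y * z) = A * e * (u * v - 2 * z / r)" by simp
    then have "A * (x * e + y * e * z) = A * (u * e) * v - 2 * (A * (z * e)) / r"
      by (simp add: algebra_simps)
    then show ?thesis unfolding prof_t_def prof_r_def prof_def x_def y_def z_def u_def v_def A_def e_def .
  qed
  ultimately show ?thesis by (simp add: prof_r_def[abs_def])
qed

lemma prof_deriv_t:
  assumes "\<tau> > 0"
  shows "((\<lambda>\<tau>. prof R \<tau> r) has_real_derivative prof_t R \<tau> r) (at \<tau>)"
proof -
  let ?s = "(r - R)\<^sup>2"
  let ?e = "exp (- (1 / (4 * \<tau>)) * ?s)"
  have 1: "((\<lambda>\<tau>. \<tau> powr (- 3 / 2)) has_real_derivative (- 3 / 2) * (\<tau> powr (- 3 / 2) / \<tau>)) (at \<tau>)"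
  proof -
    have "\<tau> powr (- 3 / 2 - 1) = \<tau> powr (- 3 / 2) / \<tau>"
      unfolding powr_diff using assms by simp
    then show ?thesis using has_real_derivative_powr[OF assms, of "- 3 / 2"] by (simp only:)
  qed
  have "((\<lambda>\<tau>. - (1 / (4 * \<tau>)) * ?s) has_real_derivative ?s / (4 * \<tau>\<^sup>2)) (at \<tau>)"
    using assms by (auto intro!: derivative_eq_intros simp: power2_eq_square field_simps)
  then have 2: "((\<lambda>\<tau>. (r - R) / r * exp (- (1 / (4 * \<tau>)) * ?s)) has_real_derivative (r - R) / r * (?e * (?s / (4 * \<tau>\<^sup>2)))) (at \<tau>)"
    by (intro DERIV_cmult DERIV_chain2[OF DERIV_exp])
  have "- 3 / 2 * (A / \<tau>) * (y * e) + y * (e * w) * A = A * (y * e) * (w - 3 / (2 * \<tau>))" for A y e w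
    by (simp add: algebra_simps)
  then show ?thesis unfolding prof_def[abs_def] prof_t_def
    by (intro DERIV_cong[OF DERIV_mult[OF 1 2]])
qed

lemma D_k_prof: "D_k k {0<..} (prof R \<tau>)"
proof -
  have "D_k k {0<..} (\<lambda>r. exp ((- (1 / (4 * \<tau>))) * ((1 * r + - R) * (1 * r + - R))))"
    by (rule D_k_compose[OF _ _ _ D_k_exp]) (intro D_k_mult D_k_linear D_k_const | simp)+
  then have "D_k k {0<..} (\<lambda>r. \<tau> powr (- 3 / 2) * ((1 * r + - R) * inverse r * exp ((- (1 / (4 * \<tau>))) * ((1 * r + - R) * (1 * r + - R)))))"
    by (intro D_k_mult D_k_linear D_k_const D_k_inverse) simp_all
  moreover have "1 * r + - R = r - R" for r by simp
  ultimately show ?thesis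
    unfolding prof_def[abs_def] by (simp only: power2_eq_square[symmetric] divide_inverse[symmetric])
qed

text \<open>The shape demanded by \<open>radial_H10\<close>, with the same constant in both
  estimates. Half of the Gaussian rate is spent on the factor \<open>(r - R)\<^sup>2\<close>; the 5
  is 1 from \<open>R / r\<^sup>2\<close> plus 4 from the other summand of the derivative.\<close>

lemma prof_bounds:
  assumes "R > 0" "\<tau> > 0" "r > R"
  shows "\<bar>prof R \<tau> r\<bar> \<le> (5 * \<tau> powr (- 3 / 2) / R) * (r - R) * exp (- (1 / (8 * \<tau>)) * (r - R)\<^sup>2)"
    and "\<bar>prof_r R \<tau> r\<bar> \<le> (5 * \<tau> powr (- 3 / 2) / R) * exp (- (1 / (8 * \<tau>)) * (r - R)\<^sup>2)"
proof -
  let ?A = "\<tau> powr (- 3 / 2)" and ?s = "r - R"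
  let ?e = "exp (- (1 / (4 * \<tau>)) * ?s\<^sup>2)" and ?q = "exp (- (1 / (8 * \<tau>)) * ?s\<^sup>2)"
  have s: "?s > 0" "r > 0" using assms by auto
  have eq: "?e = ?q * ?q" using assms by (simp add: exp_add[symmetric] field_simps)
  have q1: "?q \<le> 1" using assms by simp
  have eleq: "?e \<le> ?q" unfolding eq using q1 by (simp add: mult_left_le)
  have s2: "?s\<^sup>2 * ?q \<le> 8 * \<tau>" using mult_exp_le[of "1 / (8 * \<tau>)" "?s\<^sup>2"] assms by simp
  have "\<bar>prof R \<tau> r\<bar> = ?A * (?s / r * ?e)" using s assms by (simp add: prof_def abs_mult)
  also have "\<dots> \<le> ?A * (?s / R * ?q)"
    using s assms eleq by (intro mult_left_mono mult_mono divide_left_mono) auto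
  also have "\<dots> \<le> ?A * (5 * (?s / R * ?q))"
  proof (rule mult_left_mono)
    have "0 \<le> ?s / R * ?q" using s assms by simp
    moreover have "y \<le> 5 * y" if "0 \<le> y" for y :: real using that by simp
    ultimately show "?s / R * ?q \<le> 5 * (?s / R * ?q)" by blast
  qed simp
  finally show "\<bar>prof R \<tau> r\<bar> \<le> (5 * ?A / R) * ?s * ?q" by (simp add: mult_ac)
  have a: "\<bar>R / r\<^sup>2\<bar> \<le> 1 / R"
  proof -
    have "R * R \<le> r\<^sup>2" using assms by (simp add: power2_eq_square mult_mono)
    then show ?thesis using assms by (simp add: field_simps power2_eq_square)
  qed
  have b: "?s\<^sup>2 / (2 * \<tau> * r) * ?e \<le> 4 / R * ?q"
  proof -
    have "?s\<^sup>2 / (2 * \<tau> * r) * ?e = (?s\<^sup>2 * ?q) / (2 * \<tau> * r) * ?q"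
      unfolding eq by (simp only: times_divide_eq_left mult.assoc)
    also have "\<dots> \<le> (8 * \<tau>) / (2 * \<tau> * R) * ?q"
      using s s2 assms by (intro mult_right_mono frac_le) auto
    finally show ?thesis using assms by simp
  qed
  have "\<bar>(R / r\<^sup>2 - ?s\<^sup>2 / (2 * \<tau> * r)) * ?e\<bar> = \<bar>R / r\<^sup>2 * ?e - ?s\<^sup>2 / (2 * \<tau> * r) * ?e\<bar>" by (simp add: left_diff_distrib)
  also have "\<dots> \<le> \<bar>R / r\<^sup>2 * ?e\<bar> + \<bar>?s\<^sup>2 / (2 * \<tau> * r) * ?e\<bar>" by (rule abs_triangle_ineq4)
  also have "\<bar>R / r\<^sup>2 * ?e\<bar> \<le> 1 / R * ?q"
    unfolding abs_mult using a eleq assms by (intro mult_mono) auto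
  also have "\<bar>?s\<^sup>2 / (2 * \<tau> * r) * ?e\<bar> \<le> 4 / R * ?q"
    using b s assms by simp
  finally have "\<bar>(R / r\<^sup>2 - ?s\<^sup>2 / (2 * \<tau> * r)) * ?e\<bar> \<le> 5 / R * ?q" by (simp add: algebra_simps)
  then have "?A * \<bar>(R / r\<^sup>2 - ?s\<^sup>2 / (2 * \<tau> * r)) * ?e\<bar> \<le> ?A * (5 / R * ?q)" by (intro mult_left_mono) auto
  then show "\<bar>prof_r R \<tau> r\<bar> \<le> (5 * ?A / R) * ?q" by (simp add: prof_r_def abs_mult mult_ac)
qed

text \<open>A majorant uniform for times between \<open>l\<close> and \<open>u\<close>, as
  differentiation in the mean requires: the power of \<tau> is worst at \<open>l\<close>, the
  Gaussian at \<open>u\<close>, and half of its rate absorbs the factor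
  \<open>(r - R)\<^sup>2\<close>.\<close>

lemma prof_t_bound:
  assumes "R > 0" "0 < l" "l < \<tau>" "\<tau> < u" "r > R"
  shows "\<bar>prof_t R \<tau> r\<bar> \<le> l powr (- 3 / 2) * (2 * u / l\<^sup>2 + 3 / (2 * l)) * exp (- (1 / (8 * u)) * (r - R)\<^sup>2)"
proof -
  let ?s = "r - R" let ?w = "exp (- (1 / (8 * u)) * ?s\<^sup>2)"
  have p: "u > 0" "\<tau> > 0" "?s > 0" "r > 0" using assms by auto
  have ee: "exp (- (1 / (4 * u)) * ?s\<^sup>2) = ?w * ?w" using p by (simp add: exp_add[symmetric] field_simps)
  have e: "exp (- (1 / (4 * \<tau>)) * ?s\<^sup>2) \<le> ?w * ?w"
    unfolding ee[symmetric] using assms p by (simp add: divide_left_mono mult_right_mono frac_le)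
  have w1: "?w \<le> 1" using p by simp
  have s2: "?s\<^sup>2 * ?w \<le> 8 * u" using mult_exp_le[of "1 / (8 * u)" "?s\<^sup>2"] p by simp
  have P: "\<bar>prof R \<tau> r\<bar> \<le> l powr (- 3 / 2) * (?w * ?w)"
  proof -
    have "\<bar>prof R \<tau> r\<bar> = \<tau> powr (- 3 / 2) * (?s / r * exp (- (1 / (4 * \<tau>)) * ?s\<^sup>2))"
      using p by (simp add: prof_def abs_mult)
    also have "\<dots> \<le> l powr (- 3 / 2) * (1 * (?w * ?w))"
      using p e assms by (intro mult_mono powr_mono2') auto
    finally show ?thesis by simp
  qed
  have "\<bar>?s\<^sup>2 / (4 * \<tau>\<^sup>2) - 3 / (2 * \<tau>)\<bar> \<le> ?s\<^sup>2 / (4 * \<tau>\<^sup>2) + 3 / (2 * \<tau>)"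
    using p abs_triangle_ineq4[of "?s\<^sup>2 / (4 * \<tau>\<^sup>2)" "3 / (2 * \<tau>)"] by simp
  also have "\<dots> \<le> ?s\<^sup>2 / (4 * l\<^sup>2) + 3 / (2 * l)"
    using assms p by (intro add_mono frac_le) (auto intro: power_mono)
  finally have Q: "\<bar>?s\<^sup>2 / (4 * \<tau>\<^sup>2) - 3 / (2 * \<tau>)\<bar> \<le> ?s\<^sup>2 / (4 * l\<^sup>2) + 3 / (2 * l)" .
  have "\<bar>prof_t R \<tau> r\<bar> \<le> (l powr (- 3 / 2) * (?w * ?w)) * (?s\<^sup>2 / (4 * l\<^sup>2) + 3 / (2 * l))"
    unfolding prof_t_def abs_mult using P Q by (intro mult_mono) auto
  also have "\<dots> = l powr (- 3 / 2) * ((?s\<^sup>2 * ?w / (4 * l\<^sup>2) + 3 / (2 * l) * ?w) * ?w)" by (simp add: algebra_simps)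
  also have "\<dots> \<le> l powr (- 3 / 2) * ((8 * u / (4 * l\<^sup>2) + 3 / (2 * l) * 1) * ?w)"
    using s2 w1 assms by (intro mult_left_mono mult_right_mono add_mono divide_right_mono) auto
  finally show ?thesis by (simp add: mult_ac)
qed

locale exterior3 = exterior c R for c :: "real ^ 3" and R :: real
begin

definition sol :: "real \<Rightarrow> real ^ 3 \<Rightarrow> real" where "sol \<tau> x = prof R \<tau> (norm (x - c))"
definition sol_t :: "real \<Rightarrow> real ^ 3 \<Rightarrow> real" where "sol_t \<tau> x = prof_t R \<tau> (norm (x - c))"

lemma prof_continuous: "continuous_on {R<..} (prof R \<tau>)"
  using D_k_prof[of 0 R \<tau>] R by (auto intro: continuous_on_subset)

lemma sol_t_Lp2: assumes "\<tau> > 0" shows "sol_t \<tau> \<in> Lp_space M 2"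
proof (rule Lp2_bound)
  have "continuous_on {R<..} (prof_t R \<tau>)"
    unfolding prof_t_def[abs_def] using assms by (intro continuous_intros prof_continuous) auto
  then show "sol_t \<tau> \<in> borel_measurable M"
    unfolding sol_t_def[abs_def] by (rule radial_measurable)
  \<comment> \<open>The constant of \<open>prof_t_bound\<close> for the interval from
    \<open>\<tau> / 2\<close> to \<open>2 * \<tau>\<close>. The summand with coefficient 0 further
    down puts the majorant into the form of \<open>Lp2_lin\<close>.\<close>
  let ?K = "(\<tau> / 2) powr (- 3 / 2) * (2 * (2 * \<tau>) / (\<tau> / 2)\<^sup>2 + 3 / (2 * (\<tau> / 2)))"
  have "1 / (8 * (2 * \<tau>)) > 0" using assms by simp
  then show "(\<lambda>x. ?K * exp (- (1 / (8 * (2 * \<tau>))) * (norm (x - c) - R)\<^sup>2) + 0 * exp (- (1 / (8 * (2 * \<tau>))) * (norm (x - c) - R)\<^sup>2)) \<in> Lp_space M 2"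
    by (intro Lp2_lin shifted_gaussian_Lp2)
  fix x assume "x \<in> \<Omega>"
  then have r: "norm (x - c) > R" by (rule in_\<Omega>[THEN iffD1])
  have "\<bar>sol_t \<tau> x\<bar> \<le> ?K * exp (- (1 / (8 * (2 * \<tau>))) * (norm (x - c) - R)\<^sup>2)"
    unfolding sol_t_def using assms R r by (intro prof_t_bound) auto
  then show "\<bar>sol_t \<tau> x\<bar> \<le> \<bar>?K * exp (- (1 / (8 * (2 * \<tau>))) * (norm (x - c) - R)\<^sup>2) + 0 * exp (- (1 / (8 * (2 * \<tau>))) * (norm (x - c) - R)\<^sup>2)\<bar>"
    by linarith
qed

lemma sol_H10: assumes "\<tau> > 0" shows "sol \<tau> \<in> H10 \<Omega>"
  unfolding sol_def[abs_def]
proof (rule radial_H10[OF D_k_prof, where K="5 * \<tau> powr (- 3 / 2) / R" and q="\<lambda>r. exp (- (1 / (8 * \<tau>)) * (r - R)\<^sup>2)"])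
  show "\<bar>prof R \<tau> r\<bar> \<le> (5 * \<tau> powr (- 3 / 2) / R) * (r - R) * exp (- (1 / (8 * \<tau>)) * (r - R)\<^sup>2)" if "r > R" for r
    by (rule prof_bounds(1)[OF R assms that])
  show "\<bar>deriv (prof R \<tau>) r\<bar> \<le> (5 * \<tau> powr (- 3 / 2) / R) * exp (- (1 / (8 * \<tau>)) * (r - R)\<^sup>2)" if "r > R" for r
    using prof_bounds(2)[OF R assms that] DERIV_imp_deriv[OF prof_deriv_r[OF assms], of r R] that R by simp
  let ?w = "\<lambda>x. exp (- (1 / (16 * \<tau>)) * (norm (x - c) - R)\<^sup>2)"
  have "1 / (16 * \<tau>) > 0" using assms by simp
  then have wL: "(\<lambda>x. (2 + 16 * \<tau>) * ?w x + 0 * ?w x) \<in> Lp_space M 2"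
    by (intro Lp2_lin shifted_gaussian_Lp2)
  show "(\<lambda>x. (1 + (norm (x - c) - R)) * exp (- (1 / (8 * \<tau>)) * (norm (x - c) - R)\<^sup>2)) \<in> Lp_space M 2"
  proof (rule Lp2_bound[OF wL])
    show "(\<lambda>x. (1 + (norm (x - c) - R)) * exp (- (1 / (8 * \<tau>)) * (norm (x - c) - R)\<^sup>2)) \<in> borel_measurable M"
      by (rule radial_measurable[where F="\<lambda>r. (1 + (r - R)) * exp (- (1 / (8 * \<tau>)) * (r - R)\<^sup>2)"]) (intro continuous_intros)
    fix x assume "x \<in> \<Omega>"
    then have "norm (x - c) > R" by (rule in_\<Omega>[THEN iffD1])
    let ?s = "norm (x - c) - R"
    have s: "?s > 0" using \<open>norm (x - c) > R\<close> by simp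
    \<comment> \<open>The Gaussian is split into two equal factors: one absorbs the quadratic
      growth, the other remains as square integrable majorant.\<close>
    have qq: "exp (- (1 / (8 * \<tau>)) * ?s\<^sup>2) = ?w x * ?w x" using assms by (simp add: exp_add[symmetric] field_simps)
    have w1: "?w x \<le> 1" using assms by simp
    have s2: "?s\<^sup>2 * ?w x \<le> 16 * \<tau>" using mult_exp_le[of "1 / (16 * \<tau>)" "?s\<^sup>2"] assms by simp
    have "1 + ?s \<le> 2 + ?s\<^sup>2"
      using zero_le_power2[of "?s - 1"] s by (simp add: power2_eq_square algebra_simps)
    then have "(1 + ?s) * (?w x * ?w x) \<le> (2 + ?s\<^sup>2) * (?w x * ?w x)" by (intro mult_right_mono) auto
    also have "\<dots> = (2 * ?w x + ?s\<^sup>2 * ?w x) * ?w x" by (simp add: algebra_simps)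
    also have "\<dots> \<le> (2 * 1 + 16 * \<tau>) * ?w x" using w1 s2 by (intro mult_right_mono add_mono) auto
    finally have "(1 + ?s) * (?w x * ?w x) \<le> (2 + 16 * \<tau>) * ?w x" by simp
    moreover have "0 \<le> (1 + ?s) * (?w x * ?w x)" using s by simp
    ultimately show "\<bar>(1 + ?s) * exp (- (1 / (8 * \<tau>)) * ?s\<^sup>2)\<bar> \<le> \<bar>(2 + 16 * \<tau>) * ?w x + 0 * ?w x\<bar>"
      unfolding qq by linarith
  qed
  show "0 \<le> 5 * \<tau> powr (- 3 / 2) / R" using R by simp
qed

lemma sol_Lp2: "\<tau> > 0 \<Longrightarrow> sol \<tau> \<in> Lp_space M 2"
  using sol_H10 by (simp add: H10_def)

lemma sol_dirichlet: assumes "\<tau> > 0" shows "dirichlet_laplacian \<Omega> (sol \<tau>) (\<lambda>x. - sol_t \<tau> x)"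
  unfolding sol_def[abs_def]
proof (rule radial_dirichlet[OF D_k_prof, where G'="prof_r R \<tau>" and G''="\<lambda>r. prof_t R \<tau> r - 2 * prof_r R \<tau> r / r"])
  show "(\<lambda>x. prof R \<tau> (norm (x - c))) \<in> H10 \<Omega>" using sol_H10[OF assms] by (simp add: sol_def[abs_def])
  show "(\<lambda>x. - sol_t \<tau> x) \<in> Lp_space M 2"
    using Lp2_lin[OF sol_t_Lp2[OF assms] sol_t_Lp2[OF assms], of "-1" 0] by simp
qed (use assms R in \<open>auto intro!: prof_deriv_r prof_r_deriv simp: sol_t_def\<close>)

lemma sol_continuous: "continuous_on \<Omega> (sol \<tau>)"
  unfolding sol_def[abs_def]
  by (rule continuous_on_compose2[OF prof_continuous]) (auto intro!: continuous_intros simp: in_\<Omega>[simplified])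

lemma emb_sol_derivative:
  assumes "\<tau> > 0"
  shows "((\<lambda>s. emb \<Omega> (sol s)) has_vector_derivative emb \<Omega> (sol_t \<tau>)) (at \<tau>)"
proof (rule emb_has_derivative)
  show "\<tau> / 2 < \<tau>" "\<tau> < 2 * \<tau>" using assms by auto
  let ?K = "(\<tau> / 2) powr (- 3 / 2) * (2 * (2 * \<tau>) / (\<tau> / 2)\<^sup>2 + 3 / (2 * (\<tau> / 2)))"
  let ?w = "\<lambda>x. exp (- (1 / (8 * (2 * \<tau>))) * (norm (x - c) - R)\<^sup>2)"
  have "1 / (8 * (2 * \<tau>)) > 0" using assms by simp
  then have "(\<lambda>x. ?K * ?w x + 0 * ?w x) \<in> Lp_space M 2" by (intro Lp2_lin shifted_gaussian_Lp2)
  then show "(\<lambda>x. ?K * ?w x) \<in> Lp_space M 2" by simp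
  show "\<bar>sol_t s x\<bar> \<le> ?K * ?w x" if "\<tau> / 2 < s" "s < 2 * \<tau>" "x \<in> \<Omega>" for s x
    unfolding sol_t_def using assms R that in_\<Omega>[THEN iffD1, OF that(3)] by (intro prof_t_bound) auto
  show "((\<lambda>s. sol s x) has_real_derivative sol_t s x) (at s)" if "\<tau> / 2 < s" for s x
    unfolding sol_def sol_t_def using that assms by (intro prof_deriv_t) auto
qed (use assms in \<open>auto intro: sol_Lp2 sol_t_Lp2\<close>)

text \<open>Starting at a positive time \<open>a\<close> keeps the curve away from the singularity
  at \<tau> = 0, so it is differentiable in L2 on the closed interval and
  \<open>evolution_unique\<close> applies. The resulting identity of classes becomes pointwise by
  \<open>heat_solution_eq\<close>.\<close>

theorem heat_solution_sol:
  assumes k: "dirichlet_heat_kernel \<Omega> k" and "a > 0" "t > 0" "x \<in> \<Omega>"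
  shows "heat_solution \<Omega> k (sol a) t x = sol (a + t) x"
proof -
  obtain S where S: "dirichlet_heat_semigroup \<Omega> S"
    and cont: "\<And>t. t > 0 \<Longrightarrow> continuous_on (\<Omega> \<times> \<Omega>) (\<lambda>(x, y). k t x y)"
    and kern: "\<And>t f. t > 0 \<Longrightarrow> f \<in> Lp_space M 2 \<Longrightarrow> AE x in M.
            integrable M (\<lambda>y. k t x y * f y) \<and> S t f x = (\<integral>y. k t x y * f y \<partial>M)"
    using k unfolding dirichlet_heat_kernel_def by blast
  have C0: "C0_semigroup (semi S)" using S by (intro semi_C0) (simp add: dirichlet_heat_semigroup_def)
  have "semi S t (emb \<Omega> (sol (a + 0))) = emb \<Omega> (sol (a + t))"
  proof (rule C0_semigroup.evolution_unique[OF C0, where U'="\<lambda>s. emb \<Omega> (sol_t (a + s))"])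
    fix s assume s: "s \<in> {0..t}"
    then have "a + s > 0" using assms by simp
    have "((\<lambda>s. a + s) has_vector_derivative 1) (at s)" by (auto intro!: derivative_eq_intros)
    then have "((\<lambda>\<tau>. emb \<Omega> (sol \<tau>)) \<circ> (\<lambda>s. a + s) has_vector_derivative 1 *\<^sub>R emb \<Omega> (sol_t (a + s))) (at s)"
      by (rule vector_diff_chain_at) (rule emb_sol_derivative[OF \<open>a + s > 0\<close>])
    then show "((\<lambda>s. emb \<Omega> (sol (a + s))) has_vector_derivative emb \<Omega> (sol_t (a + s))) (at s within {0..t})"
      by (simp add: o_def has_vector_derivative_at_within)
    show "C0_semigroup.gen (semi S) (emb \<Omega> (sol (a + s))) (emb \<Omega> (sol_t (a + s)))"
      using gen_dirichlet[OF S cont kern sol_dirichlet[OF \<open>a + s > 0\<close>]] by simp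
  qed (use assms in simp)
  then show ?thesis
    using assms by (intro heat_solution_eq[OF S cont kern]) (auto intro: sol_Lp2 sol_continuous)
qed

end

section \<open>Norms of the explicit solution\<close>

lemma Lp_norm_infinity: "Lp_norm M \<infinity> f = esssup M (\<lambda>x. ennreal (norm (f x)))"
  by (simp add: Lp_norm_def)

lemma Lp_norm_finite:
  "0 \<le> q \<Longrightarrow> Lp_norm M (ennreal q) f =
    (let I = (\<integral>\<^sup>+x. ennreal (norm (f x) powr q) \<partial>M) in if I = \<infinity> then \<infinity> else ennreal (enn2real I powr (1 / q)))"
  by (simp add: Lp_norm_def Let_def)

lemma Lp_norm_finite_le:
  assumes "1 \<le> q" "(\<integral>\<^sup>+x. ennreal (norm (f x) powr q) \<partial>M) \<le> ennreal i" "0 \<le> i"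
  shows "Lp_norm M (ennreal q) f \<le> ennreal (i powr (1 / q))"
proof -
  let ?I = "\<integral>\<^sup>+x. ennreal (norm (f x) powr q) \<partial>M"
  have "?I \<noteq> \<infinity>" using assms(2) by (auto simp: top_unique)
  moreover have "enn2real ?I \<le> i" using assms by (intro enn2real_leI) auto
  ultimately show ?thesis
    using assms(1) by (simp add: Lp_norm_finite ennreal_leI powr_mono2)
qed

lemma Lp_norm_finite_ge:
  assumes "1 \<le> q" "ennreal i \<le> (\<integral>\<^sup>+x. ennreal (norm (f x) powr q) \<partial>M)" "0 \<le> i"
  shows "ennreal (i powr (1 / q)) \<le> Lp_norm M (ennreal q) f"
proof -
  let ?I = "\<integral>\<^sup>+x. ennreal (norm (f x) powr q) \<partial>M"
  have "i \<le> enn2real ?I" if "?I \<noteq> \<infinity>"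
    using assms(2) that by (metis assms(3) enn2real_ennreal enn2real_mono less_top infinity_ennreal_def)
  then show ?thesis
    using assms(1,3) by (simp add: Lp_norm_finite Let_def ennreal_leI powr_mono2)
qed

text \<open>Used for the gradient, whose measurability is thereby left open: the nonnegative
  integral is monotone for arbitrary functions, and the essential supremum of a non-measurable
  function is \<open>top\<close> by convention.\<close>

lemma Lp_norm_ge_on_set:
  fixes g b q :: real
  assumes B: "B \<in> sets M" "emeasure M B = ennreal b" "b > 0" and g: "g > 0"
    and f: "\<And>x. x \<in> B \<Longrightarrow> g \<le> norm (f x)"
  shows "ennreal g \<le> Lp_norm M \<infinity> f"
    and "1 \<le> q \<Longrightarrow> ennreal (g * b powr (1 / q)) \<le> Lp_norm M (ennreal q) f"
proof -
  show "ennreal g \<le> Lp_norm M \<infinity> f"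
  proof (cases "(\<lambda>x. ennreal (norm (f x))) \<in> borel_measurable M")
    case True
    show ?thesis
    proof (rule ccontr)
      let ?e = "esssup M (\<lambda>x. ennreal (norm (f x)))"
      assume "\<not> ennreal g \<le> Lp_norm M \<infinity> f"
      then have less: "?e < ennreal g" unfolding Lp_norm_infinity not_le .
      have "AE x in M. ennreal (norm (f x)) \<le> ?e" by (rule esssup_AE)
      then have "AE x in M. x \<notin> B"
      proof eventually_elim
        case (elim x)
        have "ennreal g \<le> ennreal (norm (f x))" if "x \<in> B" using f[OF that] by (rule ennreal_leI)
        then show ?case using elim less by (meson leD order_trans)
      qed
      then have "emeasure M B = 0" using B(1) by (simp add: AE_iff_measurable[OF B(1)] sets.sets_into_space[THEN subsetD] Collect_conj_eq Int_absorb1 sets.sets_into_space)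
      then show False using B by simp
    qed
  next
    case False
    then show ?thesis unfolding Lp_norm_infinity esssup_non_measurable[OF False] by (intro top_greatest)
  qed
  assume q: "1 \<le> q"
  have "ennreal (g powr q * b) = (\<integral>\<^sup>+x. ennreal (g powr q) * indicator B x \<partial>M)"
    using B by (simp add: nn_integral_cmult_indicator ennreal_mult)
  also have "\<dots> \<le> (\<integral>\<^sup>+x. ennreal (norm (f x) powr q) \<partial>M)"
    using f g q by (intro nn_integral_mono) (auto split: split_indicator intro!: ennreal_leI powr_mono2)
  finally have "ennreal ((g powr q * b) powr (1 / q)) \<le> Lp_norm M (ennreal q) f"
    using q B g by (intro Lp_norm_finite_ge) auto
  then show "ennreal (g * b powr (1 / q)) \<le> Lp_norm M (ennreal q) f"
    using q g B by (simp add: powr_mult powr_powr)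
qed

lemma inverse_antimono_ennreal:
  fixes x y :: ennreal
  assumes "x \<le> y" shows "inverse y \<le> inverse x"
proof (cases "x = 0 \<or> y = top")
  case False
  then have "x < top" "y < top" "x \<noteq> 0" using assms by (auto simp: less_top[symmetric] top_unique)
  then obtain a b where "x = ennreal a" "y = ennreal b" "0 < a" "0 < b" "a \<le> b"
    using assms by (cases x; cases y) (auto simp: ennreal_le_iff2)
  then show ?thesis by (simp add: inverse_ennreal)
qed auto

text \<open>In \<open>ennreal\<close> the numerator may be infinite and the denominator zero;
  monotonicity of product and inverse covers these cases too.\<close>

lemma ennreal_quotient_ge:
  assumes "ennreal n \<le> N" "F \<le> ennreal d" "0 \<le> n" "0 < d" "0 \<le> a"
  shows "ennreal (a * n / d) \<le> ennreal a * N / F"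
proof -
  have "ennreal (a * n / d) = ennreal a * ennreal n / ennreal d"
    using assms by (subst ennreal_mult[symmetric]) (auto simp: divide_ennreal)
  also have "\<dots> \<le> ennreal a * N / F"
    unfolding divide_ennreal_def using assms by (intro mult_mono inverse_antimono_ennreal) auto
  finally show ?thesis .
qed

context exterior3
begin

text \<open>After the power of \<tau> is taken out, what remains lies in \<open>{0..1}\<close>,
  where \<open>z powr q\<close> is at most \<open>z\<close>. Hence one Gaussian integral serves
  every \<open>q\<close>.\<close>

lemma sol_Lp_norm_le:
  assumes \<tau>: "\<tau> \<ge> R\<^sup>2" "\<tau> > 0"
  shows "Lp_norm M \<infinity> (sol \<tau>) \<le> ennreal (\<tau> powr (- 3 / 2))"
    and "1 \<le> q \<Longrightarrow> Lp_norm M (ennreal q) (sol \<tau>) \<le>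
      ennreal (\<tau> powr (- 3 / 2) * (2 * sqrt (8 * pi) ^ 3 * \<tau> powr (3 / 2)) powr (1 / q))"
proof -
  let ?A = "\<tau> powr (- 3 / 2)" and ?E = "\<lambda>x. exp (- (1 / (4 * \<tau>)) * (norm (x - c) - R)\<^sup>2)"
  have bound: "\<exists>y. 0 \<le> y \<and> y \<le> 1 \<and> norm (sol \<tau> x) = ?A * (y * ?E x)" if "x \<in> \<Omega>" for x
  proof -
    have r: "R < norm (x - c)" using that by (rule in_\<Omega>[THEN iffD1])
    then have "norm (sol \<tau> x) = ?A * ((norm (x - c) - R) / norm (x - c) * ?E x)"
      by (simp add: sol_def prof_def abs_mult)
    moreover have "0 \<le> (norm (x - c) - R) / norm (x - c)" "(norm (x - c) - R) / norm (x - c) \<le> 1"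
      using r R by (auto simp: divide_le_eq)
    ultimately show ?thesis by blast
  qed
  have E1: "?E x \<le> 1" for x using \<tau> by simp
  have "norm (sol \<tau> x) \<le> ?A" if x: "x \<in> \<Omega>" for x
  proof -
    obtain y where y: "0 \<le> y" "y \<le> 1" "norm (sol \<tau> x) = ?A * (y * ?E x)" using bound[OF x] by blast
    have "y * ?E x \<le> 1" using y E1[of x] by (intro mult_le_one) auto
    then show ?thesis unfolding y(3) by (intro mult_left_le) auto
  qed
  then show "Lp_norm M \<infinity> (sol \<tau>) \<le> ennreal ?A"
    unfolding Lp_norm_infinity using sol_Lp2[OF \<tau>(2)]
    by (intro esssup_I) (auto simp: Lp_space_def intro!: ennreal_leI AE_I2)
  assume q: "1 \<le> q"
  let ?I = "2 * sqrt (8 * pi) ^ 3 * \<tau> powr (3 / 2)"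
  have pw: "norm (sol \<tau> x) powr q \<le> ?A powr q * ?E x" if x: "x \<in> \<Omega>" for x
  proof -
    obtain y where y: "0 \<le> y" "y \<le> 1" "norm (sol \<tau> x) = ?A * (y * ?E x)" using bound[OF x] by blast
    have le1: "y * ?E x \<le> 1" using y E1[of x] by (intro mult_le_one) auto
    have "z powr q \<le> z" if "0 \<le> z" "z \<le> 1" for z :: real
      using powr_mono'[of 1 q z] that q by simp
    then have "(y * ?E x) powr q \<le> y * ?E x" using le1 y by simp
    also have "\<dots> \<le> 1 * ?E x" using y by (intro mult_right_mono) auto
    finally have "(y * ?E x) powr q \<le> ?E x" by simp
    then show ?thesis unfolding y(3) using y by (simp add: powr_mult mult_left_mono)
  qed
  have "(\<integral>\<^sup>+x. ennreal (norm (sol \<tau> x) powr q) \<partial>M) \<le> (\<integral>\<^sup>+x. ennreal (?A powr q) * ennreal (?E x) \<partial>lebesgue)"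
  proof -
    have "(\<integral>\<^sup>+x. ennreal (norm (sol \<tau> x) powr q) \<partial>M) = (\<integral>\<^sup>+x. ennreal (norm (sol \<tau> x) powr q) * indicator \<Omega> x \<partial>lebesgue)"
      by (subst nn_integral_restrict_space) auto
    also have "\<dots> \<le> (\<integral>\<^sup>+x. ennreal (?A powr q) * ennreal (?E x) \<partial>lebesgue)"
    proof (rule nn_integral_mono)
      fix x
      show "ennreal (norm (sol \<tau> x) powr q) * indicator \<Omega> x \<le> ennreal (?A powr q) * ennreal (?E x)"
        using pw[of x] by (cases "x \<in> \<Omega>") (auto simp: ennreal_mult[symmetric] intro!: ennreal_leI)
    qed
    finally show ?thesis .
  qed
  also have "\<dots> = ennreal (?A powr q) * (\<integral>\<^sup>+x. ennreal (?E x) \<partial>lebesgue)"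
    by (rule nn_integral_cmult) (intro measurable_completion, measurable)
  also have "(\<integral>\<^sup>+x. ennreal (?E x) \<partial>lebesgue) \<le> ennreal (exp (1 / (4 * \<tau>) * R\<^sup>2) * sqrt (2 * pi / (1 / (4 * \<tau>))) ^ DIM(real ^ 3))"
    by (rule nn_integral_shifted_gaussian) (use \<tau> in simp)
  \<comment> \<open>The condition that \<tau> is at least \<open>R\<^sup>2\<close> bounds the
    exponential by \<open>exp (1 / 4)\<close>, which is at most 2; the root gives
    \<open>sqrt (8 * pi) ^ 3\<close> times \<open>\<tau> powr (3 / 2)\<close>.\<close>
  also have "exp (1 / (4 * \<tau>) * R\<^sup>2) * sqrt (2 * pi / (1 / (4 * \<tau>))) ^ DIM(real ^ 3) \<le> ?I"
  proof -
    have "1 / (4 * \<tau>) * R\<^sup>2 \<le> 1 / 4" using \<tau> by (simp add: divide_le_eq)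
    then have "exp (1 / (4 * \<tau>) * R\<^sup>2) \<le> exp (1 / 4)" by simp
    also have "\<dots> \<le> 2" using exp_bound[of "1 / 4 :: real"] by (simp add: power2_eq_square)
    finally have e: "exp (1 / (4 * \<tau>) * R\<^sup>2) \<le> 2" .
    have "sqrt (2 * pi / (1 / (4 * \<tau>))) ^ 3 = sqrt (8 * pi) ^ 3 * sqrt \<tau> ^ 3"
      by (simp add: real_sqrt_mult[symmetric] power_mult_distrib[symmetric] mult_ac)
    also have "sqrt \<tau> ^ 3 = \<tau> powr (3 / 2)"
      using \<tau> by (simp add: powr_half_sqrt[symmetric] powr_realpow[symmetric] powr_powr del: powr_half_sqrt)
    finally show ?thesis using e by (simp add: mult_right_mono)
  qed
  finally have "(\<integral>\<^sup>+x. ennreal (norm (sol \<tau> x) powr q) \<partial>M) \<le> ennreal (?A powr q) * ennreal ?I"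
    by (simp add: mult_left_mono ennreal_leI)
  also have "\<dots> = ennreal (?A powr q * ?I)" by (rule ennreal_mult[symmetric]) auto
  finally have "Lp_norm M (ennreal q) (sol \<tau>) \<le> ennreal ((?A powr q * ?I) powr (1 / q))"
    using q by (intro Lp_norm_finite_le) auto
  then show "Lp_norm M (ennreal q) (sol \<tau>) \<le> ennreal (?A * ?I powr (1 / q))"
    using q by (simp add: powr_mult powr_powr)
qed

text \<open>\<Omega> is open, so the pointwise identity holds on a neighbourhood of
  \<open>x\<close>, and this is what the gradient sees.\<close>

lemma norm_grad_heat_solution:
  assumes k: "dirichlet_heat_kernel \<Omega> k" and "t > 0" "x \<in> \<Omega>"
  shows "norm (grad (heat_solution \<Omega> k (sol t) t) x) = \<bar>prof_r R (t + t) (norm (x - c))\<bar>"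
proof -
  have r: "norm (x - c) > 0" "x \<noteq> c" using in_\<Omega>[THEN iffD1, OF assms(3)] R by auto
  have "\<forall>\<^sub>F y in nhds x. y \<in> \<Omega>" using assms(3) by (intro eventually_nhds_in_open \<Omega>)
  then have ev: "\<forall>\<^sub>F y in nhds x. prof R (t + t) (norm (y - c)) = heat_solution \<Omega> k (sol t) t y"
    by eventually_elim (use heat_solution_sol[OF k assms(2,2)] in \<open>simp add: sol_def\<close>)
  have "(prof R (t + t) has_real_derivative prof_r R (t + t) (norm (x - c))) (at (norm (x - c)))"
    using assms r by (intro prof_deriv_r) auto
  from GDERIV_cong_ev[OF GDERIV_radial[OF r(2) this] ev] show ?thesis
    using r by (simp add: grad_eqI)
qed

lemma prof_r_eq:
  assumes "t > 0"
  shows "\<bar>prof_r R (t + t) r\<bar> = 2 powr (- 3 / 2) * t powr (- 3 / 2) * (\<bar>R / r\<^sup>2 - (r - R)\<^sup>2 / (4 * t * r)\<bar> * exp (- ((r - R)\<^sup>2 / (8 * t))))"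
proof -
  have "(t + t) powr (- 3 / 2) = 2 powr (- 3 / 2) * t powr (- 3 / 2)"
    unfolding mult_2[symmetric] by (rule powr_mult)
  then show ?thesis by (simp add: prof_r_def abs_mult mult_ac)
qed

text \<open>Here \<open>R / r\<^sup>2\<close> dominates: it is at least \<open>1 / (4 * R)\<close>,
  while the competing term is at most \<open>1 / (16 * R)\<close> for these \<open>t\<close>. Their
  difference exceeds \<open>1 / (8 * R)\<close>, and the exponential costs a further factor
  1/2.\<close>

lemma prof_r_near:
  assumes "t \<ge> 4 * R\<^sup>2" "R < r" "r < 2 * R"
  shows "2 powr (- 3 / 2) * t powr (- 3 / 2) * (1 / (16 * R)) \<le> \<bar>prof_r R (t + t) r\<bar>"
proof -
  have R2: "R\<^sup>2 > 0" using R by simp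
  then have t: "t > 0" using assms by linarith
  have s: "0 < r - R" "r - R < R" using assms by auto
  have "(r - R)\<^sup>2 \<le> R\<^sup>2" using s by (intro power_mono) auto
  moreover from this have "(r - R)\<^sup>2 \<le> 4 * t" using assms t by linarith
  ultimately have e: "(r - R)\<^sup>2 / (8 * t) \<le> 1 / 2" "(r - R)\<^sup>2 \<le> R\<^sup>2" using t by (auto simp: divide_le_eq)
  then have "1 / 2 \<le> exp (- ((r - R)\<^sup>2 / (8 * t)))"
    using exp_ge_add_one_self[of "- ((r - R)\<^sup>2 / (8 * t))"] by linarith
  moreover have "1 / (8 * R) \<le> \<bar>R / r\<^sup>2 - (r - R)\<^sup>2 / (4 * t * r)\<bar>"
  proof -
    have "r\<^sup>2 \<le> (2 * R)\<^sup>2" using assms R by (intro power_mono) auto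
    then have 1: "R / (2 * R)\<^sup>2 \<le> R / r\<^sup>2" using R assms by (intro divide_left_mono) auto
    have 2: "(r - R)\<^sup>2 / (4 * t * r) \<le> R\<^sup>2 / (4 * (4 * R\<^sup>2) * R)"
      using assms e R R2 t by (intro frac_le mult_mono) auto
    have "R / (2 * R)\<^sup>2 = 1 / (4 * R)" "R\<^sup>2 / (4 * (4 * R\<^sup>2) * R) = 1 / (16 * R)" using R by (auto simp: power2_eq_square)
    moreover have "1 / (8 * R) + 1 / (16 * R) \<le> 1 / (4 * R)" using R by (simp add: field_simps)
    ultimately show ?thesis using 1 2 by linarith
  qed
  ultimately have "1 / (8 * R) * (1 / 2) \<le> \<bar>R / r\<^sup>2 - (r - R)\<^sup>2 / (4 * t * r)\<bar> * exp (- ((r - R)\<^sup>2 / (8 * t)))"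
    using R by (intro mult_mono) auto
  then show ?thesis unfolding prof_r_eq[OF t] by (intro mult_left_mono) auto
qed

text \<open>At distance of order \<open>sqrt t\<close> the other term dominates: with
  \<open>y = sqrt t\<close> at least \<open>2 * R\<close> it is at least \<open>1 / (5 * y)\<close>,
  against at most \<open>1 / (18 * y)\<close>. The exponential stays above
  \<open>exp (- 25 / 8)\<close> because \<open>r - R\<close> is at most
  \<open>5 * y\<close>.\<close>

lemma prof_r_far:
  assumes "t \<ge> 4 * R\<^sup>2" "3 * sqrt t < r" "r < 5 * sqrt t"
  shows "2 powr (- 3 / 2) * t powr (- 3 / 2) * (exp (- 25 / 8) / 10 * t powr (- 1 / 2)) \<le> \<bar>prof_r R (t + t) r\<bar>"
proof -
  have R2: "R\<^sup>2 > 0" using R by simp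
  then have t: "t > 0" using assms by linarith
  define y where "y = sqrt t"
  have y: "y > 0" "y * y = t" using t by (auto simp: y_def)
  have "(2 * R)\<^sup>2 \<le> t" using assms by (simp add: power2_eq_square)
  then have yR: "2 * R \<le> y" unfolding y_def by (rule real_le_rsqrt)
  have r: "3 * y < r" "r < 5 * y" using assms by (auto simp: y_def)
  have s: "2 * y \<le> r - R" "r - R \<le> 5 * y" using r yR R by auto
  have "(r - R)\<^sup>2 \<le> (5 * y)\<^sup>2" using s y by (intro power_mono) auto
  then have "(r - R)\<^sup>2 / (8 * t) \<le> 25 / 8" using t y by (simp add: divide_le_eq power2_eq_square)
  then have E: "exp (- 25 / 8) \<le> exp (- ((r - R)\<^sup>2 / (8 * t)))" by simp
  have "1 / (10 * y) \<le> \<bar>R / r\<^sup>2 - (r - R)\<^sup>2 / (4 * t * r)\<bar>"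
  proof -
    have "R / r\<^sup>2 \<le> (y / 2) / (3 * y)\<^sup>2" using yR r y R by (intro frac_le power_mono) auto
    also have "(y / 2) / (3 * y)\<^sup>2 = 1 / (18 * y)" using y(1) by (simp add: power2_eq_square)
    finally have 1: "R / r\<^sup>2 \<le> 1 / (18 * y)" .
    have "(2 * y)\<^sup>2 \<le> (r - R)\<^sup>2" using s y by (intro power_mono) auto
    then have "(2 * y)\<^sup>2 / (4 * t * (5 * y)) \<le> (r - R)\<^sup>2 / (4 * t * r)"
      using r y t by (intro frac_le mult_left_mono) auto
    moreover have "(2 * y)\<^sup>2 / (4 * t * (5 * y)) = 1 / (5 * y)" using y by (simp add: power2_eq_square flip: y(2))
    ultimately have 2: "1 / (5 * y) \<le> (r - R)\<^sup>2 / (4 * t * r)" by simp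
    have "1 / (10 * y) + 1 / (18 * y) \<le> 1 / (5 * y)" using y by (simp add: field_simps)
    then show ?thesis using 1 2 by linarith
  qed
  then have "1 / (10 * y) * exp (- 25 / 8) \<le> \<bar>R / r\<^sup>2 - (r - R)\<^sup>2 / (4 * t * r)\<bar> * exp (- ((r - R)\<^sup>2 / (8 * t)))"
    using E y by (intro mult_mono) auto
  moreover have "t powr (- 1 / 2) = 1 / y"
    using t by (simp add: y_def powr_minus_divide powr_half_sqrt)
  ultimately have "exp (- 25 / 8) / 10 * t powr (- 1 / 2) \<le> \<bar>R / r\<^sup>2 - (r - R)\<^sup>2 / (4 * t * r)\<bar> * exp (- ((r - R)\<^sup>2 / (8 * t)))"
    by (simp add: mult.commute)
  then show ?thesis unfolding prof_r_eq[OF t] by (intro mult_left_mono) auto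
qed

text \<open>A ball of known volume inside the spherical shell where the gradient has been bounded
  below; the axis is an arbitrary direction.\<close>

lemma ball_axis:
  assumes "0 < b" "b \<le> a - R" "x \<in> ball (c + axis 1 a) b"
  shows "a - b < norm (x - c)" "norm (x - c) < a + b" "x \<in> \<Omega>"
proof -
  have a: "norm (axis 1 a :: real ^ 3) = a"
    using assms R by (simp add: norm_eq_sqrt_inner inner_axis_axis)
  have d: "norm (x - c - axis 1 a) < b" using assms(3) by (simp add: dist_norm norm_minus_commute diff_diff_eq)
  have "norm (x - c) \<le> norm (axis 1 a :: real ^ 3) + norm (x - c - axis 1 a)"
    using norm_triangle_ineq[of "axis 1 a" "x - c - axis 1 a"] by simp
  then show "norm (x - c) < a + b" using a d by simp
  have "norm (axis 1 a :: real ^ 3) \<le> norm (x - c) + norm (x - c - axis 1 a)"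
    using norm_triangle_ineq4[of "x - c" "x - c - axis 1 a"] by simp
  then show lo: "a - b < norm (x - c)" using a d by simp
  show "x \<in> \<Omega>" using lo assms(2) by (intro in_\<Omega>[THEN iffD2]) simp
qed

lemma emeasure_ball_axis:
  assumes "0 < b" "b \<le> a - R"
  shows "ball (c + axis 1 a) b \<in> sets M" "emeasure M (ball (c + axis 1 a) b) = ennreal (unit_ball_vol 3 * b ^ 3)"
proof -
  have sub: "ball (c + axis 1 a) b \<subseteq> \<Omega>" using ball_axis(3)[OF assms] by blast
  then show "ball (c + axis 1 a) b \<in> sets M" by (auto simp: sets_restrict_space_iff)
  have "emeasure M (ball (c + axis 1 a) b) = emeasure lebesgue (ball (c + axis 1 a) b)"
    using sub by (intro emeasure_restrict_space) auto
  also have "\<dots> = ennreal (unit_ball_vol 3 * b ^ 3)"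
    using assms emeasure_ball[of b "c + axis 1 a"] by (simp add: DIM_cart)
  finally show "emeasure M (ball (c + axis 1 a) b) = ennreal (unit_ball_vol 3 * b ^ 3)" .
qed

text \<open>The threshold \<open>4 * R\<^sup>2\<close> gives both \<open>t\<close> at least
  \<open>R\<^sup>2\<close>, for the upper bound on the datum, and \<open>sqrt t\<close> at least
  \<open>2 * R\<close>, which keeps the far ball inside \<Omega>.\<close>

lemma quotient_bound:
  assumes k: "dirichlet_heat_kernel \<Omega> k" and p: "1 \<le> p"
  obtains \<kappa> where "\<kappa> > 0" "\<And>t. t \<ge> 4 * R\<^sup>2 \<Longrightarrow> ennreal \<kappa> \<le> ennreal (t powr decay_exponent p) *
    Lp_norm M p (grad (heat_solution \<Omega> k (sol t) t)) / Lp_norm M p (sol t)"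
proof -
  let ?u = "\<lambda>t. grad (heat_solution \<Omega> k (sol t) t)" and ?A = "\<lambda>t::real. t powr (- 3 / 2)" and ?d = "2 powr (- 3 / 2) :: real"
  let ?V = "unit_ball_vol 3" and ?C = "2 * sqrt (8 * pi) ^ 3"
  have V: "?V > 0" and C: "?C > 0" by simp_all
  have t0: "t > 0" "t \<ge> R\<^sup>2" if "t \<ge> 4 * R\<^sup>2" for t
  proof -
    have "R\<^sup>2 > 0" using R by simp
    then show "t > 0" "t \<ge> R\<^sup>2" using that by linarith+
  qed
  \<comment> \<open>This ball lies in the shell where \<open>r\<close> is between \<open>R\<close>
    and \<open>2 * R\<close>, the range of \<open>prof_r_near\<close>.\<close>
  let ?B1 = "ball (c + axis 1 (3 / 2 * R)) (R / 2)"
  have R2: "0 < R / 2" "R / 2 \<le> 3 / 2 * R - R" using R by auto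
  have near: "?d * ?A t * (1 / (16 * R)) \<le> norm (?u t x)" if "t \<ge> 4 * R\<^sup>2" "x \<in> ?B1" for t x
    unfolding norm_grad_heat_solution[OF k t0(1)[OF that(1)] ball_axis(3)[OF R2 that(2)]]
    using ball_axis[OF R2 that(2)] by (intro prof_r_near that) auto
  have b1: "?V * (R / 2) ^ 3 > 0" using V R by simp
  note near_norm = Lp_norm_ge_on_set[OF emeasure_ball_axis[OF R2] b1]
  show ?thesis
  proof (cases "p = \<infinity>")
    case True
    have "ennreal (?d * (1 / (16 * R))) \<le> ennreal (t powr decay_exponent p) * Lp_norm M p (?u t) / Lp_norm M p (sol t)"
      if "t \<ge> 4 * R\<^sup>2" for t
    proof -
      have t: "t > 0" "t \<ge> R\<^sup>2" using t0 that by auto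
      have "ennreal (?d * ?A t * (1 / (16 * R))) \<le> Lp_norm M \<infinity> (?u t)"
        by (rule near_norm(1)) (use near[OF that] t R in auto)
      from ennreal_quotient_ge[OF this sol_Lp_norm_le(1)[OF t(2,1)], of 1] show ?thesis
        using t R True by (simp add: decay_exponent_def top_unique)
    qed
    then show ?thesis using that[of "?d * (1 / (16 * R))"] R by simp
  next
    case False
    then obtain q where q: "p = ennreal q" "0 \<le> q" by (cases p) auto
    have q1: "1 \<le> q" using p q by (simp add: ennreal_1[symmetric] del: ennreal_1)
    show ?thesis
    proof (cases "p \<le> 3")
      case True
      then have de: "decay_exponent p = 1 / 2" by (simp add: decay_exponent_def)
      let ?\<kappa> = "?d * (exp (- 25 / 8) / 10) * (?V / ?C) powr (1 / q)"
      have "ennreal ?\<kappa> \<le> ennreal (t powr decay_exponent p) * Lp_norm M p (?u t) / Lp_norm M p (sol t)"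
        if tt: "t \<ge> 4 * R\<^sup>2" for t
      proof -
        have t: "t > 0" "t \<ge> R\<^sup>2" using t0 tt by auto
        have "(2 * R)\<^sup>2 \<le> t" using tt by (simp add: power2_eq_square)
        then have "2 * R \<le> sqrt t" by (rule real_le_rsqrt)
        then have st: "0 < sqrt t" "sqrt t \<le> 4 * sqrt t - R" using R t by auto
        have "sqrt t ^ 3 = t powr (3 / 2)"
          using t by (simp add: powr_half_sqrt[symmetric] powr_realpow[symmetric] powr_powr del: powr_half_sqrt)
        then have vol: "?V * sqrt t ^ 3 = ?V * t powr (3 / 2)" by simp
        let ?g = "?d * ?A t * (exp (- 25 / 8) / 10 * t powr (- 1 / 2))"
        have far: "?g \<le> norm (?u t x)" if x: "x \<in> ball (c + axis 1 (4 * sqrt t)) (sqrt t)" for x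
          unfolding norm_grad_heat_solution[OF k t(1) ball_axis(3)[OF st x]]
          using ball_axis[OF st x] by (intro prof_r_far tt) auto
        have N: "ennreal (?g * (?V * t powr (3 / 2)) powr (1 / q)) \<le> Lp_norm M (ennreal q) (?u t)"
          using Lp_norm_ge_on_set(2)[OF emeasure_ball_axis[OF st, unfolded vol] _ _ far q1] V t by simp
        have F: "0 < ?A t * (?C * t powr (3 / 2)) powr (1 / q)" using t C by simp
        \<comment> \<open>All powers of \<open>t\<close> cancel: the weight against the factor
          \<open>t powr (- 1 / 2)\<close> of the far gradient, and the volume of the growing ball
          against the volume factor in the norm of the datum.\<close>
        have kap: "?\<kappa> = t powr (1 / 2) * (?g * (?V * t powr (3 / 2)) powr (1 / q)) / (?A t * (?C * t powr (3 / 2)) powr (1 / q))"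
        proof -
          have h: "t powr (1 / 2) * t powr (- 1 / 2) = 1" using t by (simp add: powr_add[symmetric])
          have "(?V * t powr (3 / 2)) powr (1 / q) / (?C * t powr (3 / 2)) powr (1 / q) = (?V / ?C) powr (1 / q)"
            using V C t by (subst powr_divide[symmetric]) auto
          moreover have "a * (d * A * (e * y) * X) / (A * Y) = (a * y) * (A / A) * (d * e * (X / Y))" for a d A e y X Y :: real
            by simp
          moreover have "?A t / ?A t = 1" using t by simp
          ultimately show ?thesis by (simp only: h mult_1_left)
        qed
        show ?thesis
          unfolding kap de unfolding q(1)
          by (rule ennreal_quotient_ge[OF N sol_Lp_norm_le(2)[OF t(2,1) q1] _ F]) (use R V in simp_all)
      qed
      moreover have "?\<kappa> > 0"
      proof -
        have "0 < ?V / ?C" using V C by (rule divide_pos_pos)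
        then have "0 < (?V / ?C) powr (1 / q)" by (metis powr_gt_zero less_irrefl)
        then show ?thesis by (intro mult_pos_pos) simp_all
      qed
      ultimately show ?thesis using that by blast
    next
      case False
      then have de: "decay_exponent p = 3 / (2 * q)" using q by (simp add: decay_exponent_def)
      let ?b = "?V * (R / 2) ^ 3"
      let ?\<kappa> = "?d * (1 / (16 * R)) * (?b / ?C) powr (1 / q)"
      have "ennreal ?\<kappa> \<le> ennreal (t powr decay_exponent p) * Lp_norm M p (?u t) / Lp_norm M p (sol t)"
        if tt: "t \<ge> 4 * R\<^sup>2" for t
      proof -
        have t: "t > 0" "t \<ge> R\<^sup>2" using t0 tt by auto
        have N: "ennreal (?d * ?A t * (1 / (16 * R)) * ?b powr (1 / q)) \<le> Lp_norm M (ennreal q) (?u t)"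
          by (rule near_norm(2)[OF _ near[OF tt] q1]) (use t R in auto)
        have F: "0 < ?A t * (?C * t powr (3 / 2)) powr (1 / q)" using t C by simp
        \<comment> \<open>The ball is now fixed, so the factor \<open>t powr (3 / (2 * q))\<close>
          in the norm of the datum is not matched by a volume; the weight compensates it.\<close>
        have kap: "?\<kappa> = t powr (3 / (2 * q)) * (?d * ?A t * (1 / (16 * R)) * ?b powr (1 / q)) / (?A t * (?C * t powr (3 / 2)) powr (1 / q))"
        proof -
          have "(?C * t powr (3 / 2)) powr (1 / q) = ?C powr (1 / q) * t powr (3 / (2 * q))"
            using C t by (simp add: powr_mult powr_powr)
          moreover have "?b powr (1 / q) / ?C powr (1 / q) = (?b / ?C) powr (1 / q)"
            using b1 C by (subst powr_divide[symmetric]) auto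
          moreover have "a * (d * A * e * X) / (A * (Y * a)) = (a / a) * (A / A) * (d * e * (X / Y))" for a d A e X Y :: real
            by simp
          moreover have "?A t / ?A t = 1" "t powr (3 / (2 * q)) / t powr (3 / (2 * q)) = 1" using t by simp_all
          ultimately show ?thesis by (simp only: mult_1_left)
        qed
        show ?thesis
          unfolding kap de unfolding q(1)
          by (rule ennreal_quotient_ge[OF N sol_Lp_norm_le(2)[OF t(2,1) q1] _ F]) (use R V in simp_all)
      qed
      moreover have "?\<kappa> > 0"
      proof -
        have "0 < ?b / ?C" using b1 C by (rule divide_pos_pos)
        then have "0 < (?b / ?C) powr (1 / q)" by (metis powr_gt_zero less_irrefl)
        then show ?thesis using R by (intro mult_pos_pos) simp_all
      qed
      ultimately show ?thesis using that by blast
    qed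
  qed
qed

lemma sol_not_AE_0: "\<tau> > 0 \<Longrightarrow> \<not> (AE x in M. sol \<tau> x = 0)"
proof
  assume \<tau>: "\<tau> > 0" and ae: "AE x in M. sol \<tau> x = 0"
  have "sol \<tau> x > 0" if "x \<in> \<Omega>" for x
    unfolding sol_def prof_def using in_\<Omega>[THEN iffD1, OF that] R \<tau>
    by (intro mult_pos_pos divide_pos_pos) (auto simp del: zero_less_norm_iff)
  then have pos: "sol \<tau> x \<noteq> 0" if "x \<in> space M" for x using that by force
  have "AE x in M. False" using ae AE_space[of M] by eventually_elim (use pos in blast)
  then have "emeasure M (space M) = 0" by (simp add: eventually_False ae_filter_eq_bot_iff)
  moreover have "emeasure M (ball (c + axis 1 (3 / 2 * R)) (R / 2)) \<le> emeasure M (space M)"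
    by (rule emeasure_space)
  moreover have R2: "0 < R / 2" "R / 2 \<le> 3 / 2 * R - R" using R by auto
  ultimately show False
    using emeasure_ball_axis(2)[OF R2] R unit_ball_vol_pos[of 3] by simp
qed

lemma sol_Lp_space:
  assumes "1 \<le> p" "\<tau> \<ge> R\<^sup>2" "\<tau> > 0" shows "sol \<tau> \<in> Lp_space M p"
proof -
  have "sol \<tau> \<in> borel_measurable M" using sol_Lp2[OF assms(3)] by (simp add: Lp_space_def)
  moreover have "Lp_norm M p (sol \<tau>) < \<infinity>"
  proof (cases p)
    case (real q)
    then have "1 \<le> q" using assms(1) by (simp add: ennreal_1[symmetric] del: ennreal_1)
    from sol_Lp_norm_le(2)[OF assms(2,3) this] show ?thesis
      unfolding real by (rule le_less_trans) simp
  next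
    case top
    from le_less_trans[OF sol_Lp_norm_le(1)[OF assms(2,3)] ennreal_less_top] show ?thesis
      unfolding top by simp
  qed
  ultimately show ?thesis by (simp add: Lp_space_def)
qed

end

theorem theorem2p7:
  fixes c :: "real ^ 3" and R :: real and \<Omega> :: "(real ^ 3) set"
    and k :: "real \<Rightarrow> real ^ 3 \<Rightarrow> real ^ 3 \<Rightarrow> real" and p :: ennreal
  assumes "R > 0" and "\<Omega> = - cball c R"
    and "dirichlet_heat_kernel \<Omega> k"
    and "1 \<le> p"
  shows "\<exists>(f :: nat \<Rightarrow> real ^ 3 \<Rightarrow> real) (t :: nat \<Rightarrow> real).
           (\<forall>m. f m \<in> Lp_space (lebesgue_on \<Omega>) p \<and> \<not> (AE x in lebesgue_on \<Omega>. f m x = 0)) \<and>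
           (\<forall>m. t m > 0) \<and> filterlim t at_top sequentially \<and>
           limsup (\<lambda>m. ennreal (t m powr decay_exponent p) *
                       Lp_norm (lebesgue_on \<Omega>) p (grad (heat_solution \<Omega> k (f m) (t m))) /
                       Lp_norm (lebesgue_on \<Omega>) p (f m)) > 0"
proof -
  interpret exterior3 c R by unfold_locales fact
  have k: "dirichlet_heat_kernel (- cball c R) k" using assms by simp
  obtain \<kappa> where \<kappa>: "\<kappa> > 0" "\<And>t. t \<ge> 4 * R\<^sup>2 \<Longrightarrow> ennreal \<kappa> \<le> ennreal (t powr decay_exponent p) *
    Lp_norm (lebesgue_on (- cball c R)) p (grad (heat_solution (- cball c R) k (sol t) t)) / Lp_norm (lebesgue_on (- cball c R)) p (sol t)"
    using quotient_bound[OF k assms(4)] by blast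
  \<comment> \<open>Starting at the threshold makes the lower bound valid for every
    \<open>m\<close>, so the limsup is at least the constant \<kappa>.\<close>
  define t where "t m = 4 * R\<^sup>2 + real m" for m
  have R2: "R\<^sup>2 > 0" using assms(1) by simp
  then have t: "t m \<ge> 4 * R\<^sup>2" "t m > 0" "t m \<ge> R\<^sup>2" for m by (auto simp: t_def add_pos_nonneg)
  have lim: "filterlim t at_top sequentially"
    unfolding t_def by (rule filterlim_tendsto_add_at_top[OF tendsto_const filterlim_real_sequentially])
  have "ennreal \<kappa> = limsup (\<lambda>m::nat. ennreal \<kappa>)" by (simp add: Limsup_const)
  also have "\<dots> \<le> limsup (\<lambda>m. ennreal (t m powr decay_exponent p) *
                       Lp_norm (lebesgue_on \<Omega>) p (grad (heat_solution \<Omega> k (sol (t m)) (t m))) /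
                       Lp_norm (lebesgue_on \<Omega>) p (sol (t m)))"
    unfolding assms(2) by (intro Limsup_mono always_eventually allI \<kappa>(2) t)
  finally have le: "ennreal \<kappa> \<le> limsup (\<lambda>m. ennreal (t m powr decay_exponent p) *
                       Lp_norm (lebesgue_on \<Omega>) p (grad (heat_solution \<Omega> k (sol (t m)) (t m))) /
                       Lp_norm (lebesgue_on \<Omega>) p (sol (t m)))" .
  have "0 < ennreal \<kappa>" using \<kappa>(1) by simp
  note less_le_trans[OF this le]
  moreover have "sol (t m) \<in> Lp_space (lebesgue_on \<Omega>) p" "\<not> (AE x in lebesgue_on \<Omega>. sol (t m) x = 0)" for m
    unfolding assms(2) by (rule sol_Lp_space[OF assms(4) t(3,2)] sol_not_AE_0[OF t(2)])+
  ultimately show ?thesis using t(2) lim by (intro exI[of _ "\<lambda>m. sol (t m)"] exI[of _ t]) blast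
qed

end
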